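(* For every $\delta\in\mathbb C^\times$, the operad $\mathcal M_\delta$ governing $\delta$-mock-Novikov algebras over $\mathbb C$ is not Koszul.
   Context: The ground field is $\mathbb C$. Let $E$ be the $S$-module concentrated in arity two with $E(2)=\mathbb C[S_2]$ the regular $S_2$-module (one binary operation $\circ$ with no symmetry), and let $\mathcal F(E)$ be the free symmetric operad generated by $E$. Let $\mathcal R_\delta\subseteq\mathcal F(E)(3)$ be the $S_3$-submodule generated by $$\delta(x\circ y)\circ z+\delta(y\circ x)\circ z+x\circ(y\circ z)+y\circ(x\circ z)\quad\text{and}\quad (x\circ y)\circ z+(x\circ z)\circ y.$$ Then $\mathcal M_\delta=\mathcal F(E)/(\mathcal R_\delta)$, where $(\mathcal R_\delta)$ is the operadic ideal generated by $\mathcal R_\delta$. "Koszul" is meant in the standard sense of Ginzburg–Kapranov for binary quadratic operads. *)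

theory Defs
  imports Complex_Main "HOL-Library.Poly_Mapping" "HOL-Library.FuncSet" "HOL-Library.Nat_Bijection"
begin

section \<open>Symmetric operads over the complex numbers\<close>

text \<open>
  Operads are presented in the coordinate-free (species) style: instead of a space \<open>P(n)\<close>
  with an action of \<open>S\<^sub>n\<close> there is a space \<open>P(I)\<close> for every finite set \<open>I\<close> of input labels, functorial
  in injective relabellings; \<open>P(n)\<close> is \<open>P({1..n})\<close>, and \<open>S\<^sub>n\<close> acts on it through the bijections of
  \<open>{1..n}\<close>. The partial composition \<open>pcomp P I a J x y\<close> inserts \<open>y \<in> P(J)\<close> into the input \<open>a\<close> of
  \<open>x \<in> P(I)\<close>; the result has inputs \<open>(I - {a}) \<union> J\<close>. The label \<open>a\<close> itself may be reused in \<open>J\<close>.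
\<close>

record 'v operad =
  op_space :: "nat set \<Rightarrow> 'v set"
  vadd :: "nat set \<Rightarrow> 'v \<Rightarrow> 'v \<Rightarrow> 'v"
  vscale :: "nat set \<Rightarrow> complex \<Rightarrow> 'v \<Rightarrow> 'v"
  relabel :: "nat set \<Rightarrow> (nat \<Rightarrow> nat) \<Rightarrow> 'v \<Rightarrow> 'v"
  op_unit :: "nat \<Rightarrow> 'v"
  pcomp :: "nat set \<Rightarrow> nat \<Rightarrow> nat set \<Rightarrow> 'v \<Rightarrow> 'v \<Rightarrow> 'v"

definition composable :: "nat set \<Rightarrow> nat \<Rightarrow> nat set \<Rightarrow> bool" where
  "composable I a J \<longleftrightarrow> finite I \<and> finite J \<and> a \<in> I \<and> (I - {a}) \<inter> J = {}"

locale symmetric_operad =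
  fixes P :: "'v operad"
  assumes space_nonempty: "finite I \<Longrightarrow> op_space P I \<noteq> {}"
    and vadd_closed: "\<lbrakk>finite I; x \<in> op_space P I; y \<in> op_space P I\<rbrakk> \<Longrightarrow> vadd P I x y \<in> op_space P I"
    and vscale_closed: "\<lbrakk>finite I; x \<in> op_space P I\<rbrakk> \<Longrightarrow> vscale P I c x \<in> op_space P I"
    and vadd_assoc: "\<lbrakk>finite I; x \<in> op_space P I; y \<in> op_space P I; z \<in> op_space P I\<rbrakk>
      \<Longrightarrow> vadd P I (vadd P I x y) z = vadd P I x (vadd P I y z)"
    and vadd_commute: "\<lbrakk>finite I; x \<in> op_space P I; y \<in> op_space P I\<rbrakk> \<Longrightarrow> vadd P I x y = vadd P I y x"
    and vadd_zero: "\<lbrakk>finite I; x \<in> op_space P I; y \<in> op_space P I\<rbrakk> \<Longrightarrow> vadd P I (vscale P I 0 x) y = y"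
    and vscale_one: "\<lbrakk>finite I; x \<in> op_space P I\<rbrakk> \<Longrightarrow> vscale P I 1 x = x"
    and vscale_vscale: "\<lbrakk>finite I; x \<in> op_space P I\<rbrakk>
      \<Longrightarrow> vscale P I c (vscale P I d x) = vscale P I (c * d) x"
    and vscale_vadd: "\<lbrakk>finite I; x \<in> op_space P I; y \<in> op_space P I\<rbrakk>
      \<Longrightarrow> vscale P I c (vadd P I x y) = vadd P I (vscale P I c x) (vscale P I c y)"
    and vscale_plus: "\<lbrakk>finite I; x \<in> op_space P I\<rbrakk>
      \<Longrightarrow> vscale P I (c + d) x = vadd P I (vscale P I c x) (vscale P I d x)"
    and relabel_closed: "\<lbrakk>finite I; inj_on \<sigma> I; x \<in> op_space P I\<rbrakk> \<Longrightarrow> relabel P I \<sigma> x \<in> op_space P (\<sigma> ` I)"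
    and relabel_vadd: "\<lbrakk>finite I; inj_on \<sigma> I; x \<in> op_space P I; y \<in> op_space P I\<rbrakk>
      \<Longrightarrow> relabel P I \<sigma> (vadd P I x y) = vadd P (\<sigma> ` I) (relabel P I \<sigma> x) (relabel P I \<sigma> y)"
    and relabel_vscale: "\<lbrakk>finite I; inj_on \<sigma> I; x \<in> op_space P I\<rbrakk>
      \<Longrightarrow> relabel P I \<sigma> (vscale P I c x) = vscale P (\<sigma> ` I) c (relabel P I \<sigma> x)"
    and relabel_cong: "\<lbrakk>finite I; x \<in> op_space P I; \<And>i. i \<in> I \<Longrightarrow> \<sigma> i = \<tau> i\<rbrakk>
      \<Longrightarrow> relabel P I \<sigma> x = relabel P I \<tau> x"
    and relabel_id: "\<lbrakk>finite I; x \<in> op_space P I\<rbrakk> \<Longrightarrow> relabel P I id x = x"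
    and relabel_relabel: "\<lbrakk>finite I; inj_on \<sigma> I; inj_on \<tau> (\<sigma> ` I); x \<in> op_space P I\<rbrakk>
      \<Longrightarrow> relabel P (\<sigma> ` I) \<tau> (relabel P I \<sigma> x) = relabel P I (\<tau> \<circ> \<sigma>) x"
    and unit_closed: "op_unit P a \<in> op_space P {a}"
    and relabel_unit: "relabel P {a} \<sigma> (op_unit P a) = op_unit P (\<sigma> a)"
    and pcomp_closed: "\<lbrakk>composable I a J; x \<in> op_space P I; y \<in> op_space P J\<rbrakk>
      \<Longrightarrow> pcomp P I a J x y \<in> op_space P ((I - {a}) \<union> J)"
    and pcomp_vadd_left: "\<lbrakk>composable I a J; x \<in> op_space P I; x' \<in> op_space P I; y \<in> op_space P J\<rbrakk>
      \<Longrightarrow> pcomp P I a J (vadd P I x x') y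
        = vadd P ((I - {a}) \<union> J) (pcomp P I a J x y) (pcomp P I a J x' y)"
    and pcomp_vscale_left: "\<lbrakk>composable I a J; x \<in> op_space P I; y \<in> op_space P J\<rbrakk>
      \<Longrightarrow> pcomp P I a J (vscale P I c x) y = vscale P ((I - {a}) \<union> J) c (pcomp P I a J x y)"
    and pcomp_vadd_right: "\<lbrakk>composable I a J; x \<in> op_space P I; y \<in> op_space P J; y' \<in> op_space P J\<rbrakk>
      \<Longrightarrow> pcomp P I a J x (vadd P J y y')
        = vadd P ((I - {a}) \<union> J) (pcomp P I a J x y) (pcomp P I a J x y')"
    and pcomp_vscale_right: "\<lbrakk>composable I a J; x \<in> op_space P I; y \<in> op_space P J\<rbrakk>
      \<Longrightarrow> pcomp P I a J x (vscale P J c y) = vscale P ((I - {a}) \<union> J) c (pcomp P I a J x y)"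
    and pcomp_relabel: "\<lbrakk>composable I a J; inj_on \<tau> I; inj_on \<sigma> J; \<tau> ` (I - {a}) \<inter> \<sigma> ` J = {};
        x \<in> op_space P I; y \<in> op_space P J\<rbrakk>
      \<Longrightarrow> pcomp P (\<tau> ` I) (\<tau> a) (\<sigma> ` J) (relabel P I \<tau> x) (relabel P J \<sigma> y)
        = relabel P ((I - {a}) \<union> J) (\<lambda>i. if i \<in> J then \<sigma> i else \<tau> i) (pcomp P I a J x y)"
    and pcomp_unit_left: "\<lbrakk>finite I; x \<in> op_space P I\<rbrakk> \<Longrightarrow> pcomp P {a} a I (op_unit P a) x = x"
    and pcomp_unit_right: "\<lbrakk>finite I; a \<in> I; x \<in> op_space P I\<rbrakk> \<Longrightarrow> pcomp P I a {a} x (op_unit P a) = x"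
    and pcomp_sequential: "\<lbrakk>composable I a J; composable J b K; composable ((I - {a}) \<union> J) b K;
        x \<in> op_space P I; y \<in> op_space P J; z \<in> op_space P K\<rbrakk>
      \<Longrightarrow> pcomp P ((I - {a}) \<union> J) b K (pcomp P I a J x y) z
        = pcomp P I a ((J - {b}) \<union> K) x (pcomp P J b K y z)"
    and pcomp_parallel: "\<lbrakk>composable I a J; composable I b K; a \<noteq> b; J \<inter> K = {};
        x \<in> op_space P I; y \<in> op_space P J; z \<in> op_space P K\<rbrakk>
      \<Longrightarrow> pcomp P ((I - {a}) \<union> J) b K (pcomp P I a J x y) z
        = pcomp P ((I - {b}) \<union> K) a J (pcomp P I b K x z) y"

section \<open>Submodules, operadic ideals and quotient operads\<close>

definition op_subspace :: "'v operad \<Rightarrow> nat set \<Rightarrow> 'v set \<Rightarrow> bool" where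
  "op_subspace P I M \<longleftrightarrow> M \<subseteq> op_space P I \<and> M \<noteq> {}
    \<and> (\<forall>x\<in>M. \<forall>y\<in>M. vadd P I x y \<in> M) \<and> (\<forall>c. \<forall>x\<in>M. vscale P I c x \<in> M)"

definition sym_submodule :: "'v operad \<Rightarrow> nat set \<Rightarrow> 'v set \<Rightarrow> bool" where
  "sym_submodule P I M \<longleftrightarrow> op_subspace P I M
    \<and> (\<forall>\<sigma>. bij_betw \<sigma> I I \<longrightarrow> (\<forall>x\<in>M. relabel P I \<sigma> x \<in> M))"

definition sym_submodule_gen :: "'v operad \<Rightarrow> nat set \<Rightarrow> 'v set \<Rightarrow> 'v set" where
  "sym_submodule_gen P I X = \<Inter>{M. sym_submodule P I M \<and> X \<subseteq> M}"

definition operadic_ideal :: "'v operad \<Rightarrow> (nat set \<Rightarrow> 'v set) \<Rightarrow> bool" where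
  "operadic_ideal P J \<longleftrightarrow>
     (\<forall>I. finite I \<longrightarrow> op_subspace P I (J I))
   \<and> (\<forall>I \<sigma>. finite I \<and> inj_on \<sigma> I \<longrightarrow> (\<forall>x\<in>J I. relabel P I \<sigma> x \<in> J (\<sigma> ` I)))
   \<and> (\<forall>I a K. composable I a K \<longrightarrow>
        (\<forall>x\<in>J I. \<forall>y\<in>op_space P K. pcomp P I a K x y \<in> J ((I - {a}) \<union> K))
      \<and> (\<forall>x\<in>op_space P I. \<forall>y\<in>J K. pcomp P I a K x y \<in> J ((I - {a}) \<union> K)))"

definition operadic_ideal_gen :: "'v operad \<Rightarrow> (nat set \<Rightarrow> 'v set) \<Rightarrow> nat set \<Rightarrow> 'v set" where
  "operadic_ideal_gen P R = (\<lambda>I. \<Inter>{J I |J. operadic_ideal P J \<and> (\<forall>K. R K \<subseteq> J K)})"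

definition op_coset :: "'v operad \<Rightarrow> (nat set \<Rightarrow> 'v set) \<Rightarrow> nat set \<Rightarrow> 'v \<Rightarrow> 'v set" where
  "op_coset P J I x = vadd P I x ` J I"

text \<open>
  The structure maps of the quotient take the union over all representatives; for an operadic ideal
  all the cosets in such a union coincide.
\<close>

definition quotient_operad :: "'v operad \<Rightarrow> (nat set \<Rightarrow> 'v set) \<Rightarrow> 'v set operad" where
  "quotient_operad P J = \<lparr>
     op_space = (\<lambda>I. op_coset P J I ` op_space P I),
     vadd = (\<lambda>I X Y. \<Union>x\<in>X. \<Union>y\<in>Y. op_coset P J I (vadd P I x y)),
     vscale = (\<lambda>I c X. \<Union>x\<in>X. op_coset P J I (vscale P I c x)),
     relabel = (\<lambda>I \<sigma> X. \<Union>x\<in>X. op_coset P J (\<sigma> ` I) (relabel P I \<sigma> x)),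
     op_unit = (\<lambda>a. op_coset P J {a} (op_unit P a)),
     pcomp = (\<lambda>I a K X Y. \<Union>x\<in>X. \<Union>y\<in>Y. op_coset P J ((I - {a}) \<union> K) (pcomp P I a K x y)) \<rparr>"

section \<open>The free operad on one binary operation without symmetry\<close>

datatype (labels: 'a) monomial =
  Var 'a
| Prod "'a monomial" "'a monomial"  (infixl \<open>\<odot>\<close> 70)

text \<open>
  For \<open>E\<close> concentrated in arity two with \<open>E(2)\<close> the regular representation, \<open>F(E)(I)\<close> has as
  basis the bracketed (nonassociative, noncommutative) monomials in which every variable from \<open>I\<close>
  occurs exactly once; composition is substitution.
\<close>

fun multilinear :: "'a monomial \<Rightarrow> bool" where
  "multilinear (Var x) \<longleftrightarrow> True"
| "multilinear (s \<odot> t) \<longleftrightarrow> multilinear s \<and> multilinear t \<and> labels s \<inter> labels t = {}"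

definition monomials :: "'a set \<Rightarrow> 'a monomial set" where
  "monomials I = {t. multilinear t \<and> labels t = I}"

primrec graft :: "'a \<Rightarrow> 'a monomial \<Rightarrow> 'a monomial \<Rightarrow> 'a monomial" where
  "graft a t (Var x) = (if x = a then t else Var x)"
| "graft a t (s\<^sub>1 \<odot> s\<^sub>2) = graft a t s\<^sub>1 \<odot> graft a t s\<^sub>2"

definition cscale :: "complex \<Rightarrow> ('a \<Rightarrow>\<^sub>0 complex) \<Rightarrow> ('a \<Rightarrow>\<^sub>0 complex)" where
  "cscale c p = Poly_Mapping.map ((*) c) p"

definition lin_ext :: "('a \<Rightarrow> 'b \<Rightarrow>\<^sub>0 complex) \<Rightarrow> ('a \<Rightarrow>\<^sub>0 complex) \<Rightarrow> ('b \<Rightarrow>\<^sub>0 complex)" where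
  "lin_ext f p = (\<Sum>s\<in>Poly_Mapping.keys p. cscale (Poly_Mapping.lookup p s) (f s))"

abbreviation mon :: "'a \<Rightarrow> ('a \<Rightarrow>\<^sub>0 complex)" where
  "mon t \<equiv> Poly_Mapping.single t 1"

type_synonym nonassoc_poly = "nat monomial \<Rightarrow>\<^sub>0 complex"

definition free_binary_operad :: "nonassoc_poly operad" where
  "free_binary_operad = \<lparr>
     op_space = (\<lambda>I. {p. Poly_Mapping.keys p \<subseteq> monomials I}),
     vadd = (\<lambda>I. (+)),
     vscale = (\<lambda>I. cscale),
     relabel = (\<lambda>I \<sigma>. lin_ext (\<lambda>t. mon (map_monomial \<sigma> t))),
     op_unit = (\<lambda>a. mon (Var a)),
     pcomp = (\<lambda>I a J p q. lin_ext (\<lambda>s. lin_ext (\<lambda>t. mon (graft a t s)) q) p) \<rparr>"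

section \<open>The operads of mock-Novikov algebras\<close>

definition mock_novikov_identities :: "complex \<Rightarrow> nonassoc_poly set" where
  "mock_novikov_identities \<delta> = (let x = Var 1; y = Var 2; z = Var 3 in
     {cscale \<delta> (mon ((x \<odot> y) \<odot> z)) + cscale \<delta> (mon ((y \<odot> x) \<odot> z))
        + mon (x \<odot> (y \<odot> z)) + mon (y \<odot> (x \<odot> z)),
      mon ((x \<odot> y) \<odot> z) + mon ((x \<odot> z) \<odot> y)})"

definition mock_novikov_relations :: "complex \<Rightarrow> nonassoc_poly set" where
  "mock_novikov_relations \<delta> =
     sym_submodule_gen free_binary_operad {1, 2, 3} (mock_novikov_identities \<delta>)"

definition mock_novikov_operad :: "complex \<Rightarrow> nonassoc_poly set operad" where
  "mock_novikov_operad \<delta> = quotient_operad free_binary_operad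
     (operadic_ideal_gen free_binary_operad
        (\<lambda>I. if I = {1, 2, 3} then mock_novikov_relations \<delta> else {}))"

section \<open>The cobar complex and Koszul operads\<close>

text \<open>
  Isomorphism classes of reduced (nonplanar) trees with leaves labelled by \<open>1, \<dots>, n\<close> correspond
  bijectively to hierarchies of subsets of \<open>{1..n}\<close>: a vertex is encoded by the set of leaves above
  it. Such trees have no nontrivial automorphisms. The internal edges are the members other than the
  root \<open>{1..n}\<close>, an edge being encoded by its upper vertex.
\<close>

definition reduced_tree :: "nat \<Rightarrow> nat set set \<Rightarrow> bool" where
  "reduced_tree n H \<longleftrightarrow> {1..n} \<in> H \<and> (\<forall>A\<in>H. A \<subseteq> {1..n} \<and> 2 \<le> card A)
    \<and> (\<forall>A\<in>H. \<forall>B\<in>H. A \<subseteq> B \<or> B \<subseteq> A \<or> A \<inter> B = {})"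

definition internal_edges :: "nat \<Rightarrow> nat set set \<Rightarrow> nat set set" where
  "internal_edges n H = H - {{1..n}}"

text \<open>
  The inputs of a vertex \<open>A\<close> are the leaves and edges entering it; they induce a partition of \<open>A\<close>,
  and each input is named by the least element of its block.
\<close>

definition inputs :: "nat set set \<Rightarrow> nat set \<Rightarrow> nat set" where
  "inputs H A = {x \<in> A. \<forall>B\<in>H. B \<subset> A \<and> x \<in> B \<longrightarrow> x = Min B}"

definition lower_vertex :: "nat set set \<Rightarrow> nat set \<Rightarrow> nat set" where
  "lower_vertex H B = \<Inter>{A \<in> H. B \<subset> A}"

definition decorations :: "'v operad \<Rightarrow> nat set set \<Rightarrow> (nat set \<Rightarrow> 'v) set" where
  "decorations P H = (\<Pi>\<^sub>E A\<in>H. op_space P (inputs H A))"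

definition contract :: "'v operad \<Rightarrow> nat set set \<Rightarrow> nat set \<Rightarrow> (nat set \<Rightarrow> 'v) \<Rightarrow> (nat set \<Rightarrow> 'v)" where
  "contract P H B d = (let A = lower_vertex H B in
     restrict (d(A := pcomp P (inputs H A) (Min B) (inputs H B) (d A) (d B))) (H - {B}))"

text \<open>
  The dual of the tensor product of the spaces \<open>P(In(v))\<close> over the vertices \<open>v\<close> of a tree is the space
  of multilinear functionals on decorations of the vertices.
\<close>

definition multilinear_functional ::
    "'v operad \<Rightarrow> nat set set \<Rightarrow> ((nat set \<Rightarrow> 'v) \<Rightarrow> complex) \<Rightarrow> bool" where
  "multilinear_functional P H f \<longleftrightarrow> (\<forall>d\<in>decorations P H. \<forall>A\<in>H.
      (\<forall>x\<in>op_space P (inputs H A). \<forall>y\<in>op_space P (inputs H A).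
         f (d(A := vadd P (inputs H A) x y)) = f (d(A := x)) + f (d(A := y)))
    \<and> (\<forall>c. \<forall>x\<in>op_space P (inputs H A). f (d(A := vscale P (inputs H A) c x)) = c * f (d(A := x))))"

text \<open>
  The trees with \<open>i\<close> internal edges, that is with \<open>i + 1\<close> vertices. The term of the
  Ginzburg--Kapranov complex \<open>D(P)(n)\<close> indexed by \<open>i\<close> is the direct sum over these trees \<open>T\<close> of
  \<open>P(T)\<^sup>* \<otimes> det(T)\<close>, where \<open>det(T)\<close> is the top exterior power of the space spanned by the internal
  edges. Sorting the edges with respect to the injective enumeration \<open>set_encode\<close> of finite sets
  trivialises \<open>det(T)\<close>. (The twist by the sign representation of \<open>S\<^sub>n\<close> does not affect the
  underlying complex of vector spaces.) The values of a cochain outside of its trees and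
  decorations are irrelevant. For \<open>m = 0\<close> there is no tree.
\<close>

definition trees_with :: "nat \<Rightarrow> nat \<Rightarrow> nat set set set" where
  "trees_with n m = {H. reduced_tree n H \<and> card H = m}"

definition cochain ::
    "'v operad \<Rightarrow> nat \<Rightarrow> nat \<Rightarrow> (nat set set \<Rightarrow> (nat set \<Rightarrow> 'v) \<Rightarrow> complex) \<Rightarrow> bool" where
  "cochain P n m \<phi> \<longleftrightarrow> (\<forall>H\<in>trees_with n m. multilinear_functional P H (\<phi> H))"

definition edge_sign :: "nat \<Rightarrow> nat set set \<Rightarrow> nat set \<Rightarrow> complex" where
  "edge_sign n H B = (-1) ^ card {C \<in> internal_edges n H. set_encode C < set_encode B}"

definition cobar_diff :: "'v operad \<Rightarrow> nat \<Rightarrow> (nat set set \<Rightarrow> (nat set \<Rightarrow> 'v) \<Rightarrow> complex)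
    \<Rightarrow> nat set set \<Rightarrow> (nat set \<Rightarrow> 'v) \<Rightarrow> complex" where
  "cobar_diff P n \<phi> H d =
     (\<Sum>B\<in>internal_edges n H. edge_sign n H B * \<phi> (H - {B}) (contract P H B d))"

definition cobar_exact_at :: "'v operad \<Rightarrow> nat \<Rightarrow> nat \<Rightarrow> bool" where
  "cobar_exact_at P n i \<longleftrightarrow> (\<forall>\<phi>. cochain P n (i + 1) \<phi>
      \<and> (\<forall>H\<in>trees_with n (i + 2). \<forall>d\<in>decorations P H. cobar_diff P n \<phi> H d = 0)
    \<longrightarrow> (\<exists>\<psi>. cochain P n i \<psi>
      \<and> (\<forall>H\<in>trees_with n (i + 1). \<forall>d\<in>decorations P H. \<phi> H d = cobar_diff P n \<psi> H d)))"

text \<open>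
  Binary trees are the reduced trees with the maximal number \<open>n - 2\<close> of internal edges. Koszulness
  in the sense of Ginzburg and Kapranov is exactness of every complex \<open>D(P)(n)\<close> everywhere
  but at its right end, i.e. for all \<open>i < n - 2\<close>; equivalently, the projection of \<open>D(P)\<close>
  onto the cohomology at the right end, which is the Koszul dual operad, is a quasi-isomorphism.
  This is meant for quadratic operads with binary generators.
\<close>

definition koszul :: "'v operad \<Rightarrow> bool" where
  "koszul P \<longleftrightarrow> (\<forall>n i. i + 2 < n \<longrightarrow> cobar_exact_at P n i)"

section \<open>The operads above satisfy the axioms of symmetric operads\<close>

lemma lookup_cscale [simp]: "Poly_Mapping.lookup (cscale c p) k = c * Poly_Mapping.lookup p k"
  by (simp add: cscale_def Poly_Mapping.map.rep_eq when_def)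

lemma keys_cscale: "Poly_Mapping.keys (cscale c p) \<subseteq> Poly_Mapping.keys p"
  by (auto simp: in_keys_iff)

interpretation cscale: vector_space "cscale :: complex \<Rightarrow> ('a \<Rightarrow>\<^sub>0 complex) \<Rightarrow> _"
  by standard (auto intro!: poly_mapping_eqI simp: lookup_add algebra_simps)

lemma lin_ext_superset:
  assumes "finite A" "Poly_Mapping.keys p \<subseteq> A"
  shows "lin_ext f p = (\<Sum>s\<in>A. cscale (Poly_Mapping.lookup p s) (f s))"
  unfolding lin_ext_def
  by (rule sum.mono_neutral_left) (use assms in \<open>auto simp: in_keys_iff\<close>)

lemma lin_ext_add: "lin_ext f (p + q) = lin_ext f p + lin_ext f q"
proof -
  let ?A = "Poly_Mapping.keys p \<union> Poly_Mapping.keys q"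
  have "lin_ext f (p + q) = (\<Sum>s\<in>?A. cscale (Poly_Mapping.lookup (p + q) s) (f s))"
    by (rule lin_ext_superset) (auto dest!: keys_add[THEN subsetD])
  also have "\<dots> = lin_ext f p + lin_ext f q"
    by (simp add: lookup_add cscale.scale_left_distrib sum.distrib
        lin_ext_superset[of ?A p] lin_ext_superset[of ?A q])
  finally show ?thesis .
qed

lemma lin_ext_cscale: "lin_ext f (cscale c p) = cscale c (lin_ext f p)"
proof -
  have "lin_ext f (cscale c p) =
      (\<Sum>s\<in>Poly_Mapping.keys p. cscale (Poly_Mapping.lookup (cscale c p) s) (f s))"
    by (rule lin_ext_superset) (auto dest!: keys_cscale[THEN subsetD])
  also have "\<dots> = cscale c (lin_ext f p)"
    by (simp add: lin_ext_def cscale.scale_sum_right)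
  finally show ?thesis .
qed

lemma lin_ext_zero [simp]: "lin_ext f 0 = 0"
  by (simp add: lin_ext_def)

lemma lin_ext_sum: "lin_ext f (sum g A) = (\<Sum>a\<in>A. lin_ext f (g a))"
  by (induction A rule: infinite_finite_induct) (simp_all add: lin_ext_add)

lemma lin_ext_mon [simp]: "lin_ext f (mon t) = f t"
  by (simp add: lin_ext_def)

lemma lin_ext_lin_ext: "lin_ext f (lin_ext g p) = lin_ext (\<lambda>t. lin_ext f (g t)) p"
  by (subst (2 3) lin_ext_def) (simp add: lin_ext_sum lin_ext_cscale)

lemma lin_ext_cong:
  "(\<And>t. t \<in> Poly_Mapping.keys p \<Longrightarrow> f t = g t) \<Longrightarrow> lin_ext f p = lin_ext g p"
  by (simp add: lin_ext_def)

lemma lin_ext_mon_id [simp]: "lin_ext mon p = p"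
proof (rule poly_mapping_eqI)
  fix k show "Poly_Mapping.lookup (lin_ext mon p) k = Poly_Mapping.lookup p k"
    by (auto simp: lin_ext_def lookup_sum lookup_single when_def in_keys_iff
        if_distrib[of "\<lambda>x. _ * x"] cong: if_cong)
qed

lemma lin_ext_add_fun: "lin_ext (\<lambda>t. f t + g t) p = lin_ext f p + lin_ext g p"
  by (simp add: lin_ext_def cscale.scale_right_distrib sum.distrib)

lemma lin_ext_cscale_fun: "lin_ext (\<lambda>t. cscale c (f t)) p = cscale c (lin_ext f p)"
  by (simp add: lin_ext_def cscale.scale_sum_right mult.commute)

lemma lin_ext_swap:
  "lin_ext (\<lambda>s. lin_ext (f s) q) p = lin_ext (\<lambda>t. lin_ext (\<lambda>s. f s t) p) q"
  unfolding lin_ext_def cscale.scale_sum_right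
  by (subst sum.swap) (simp add: mult.commute)

lemma keys_lin_ext:
  assumes "\<And>t. t \<in> Poly_Mapping.keys p \<Longrightarrow> Poly_Mapping.keys (f t) \<subseteq> B"
  shows "Poly_Mapping.keys (lin_ext f p) \<subseteq> B"
proof
  fix k assume "k \<in> Poly_Mapping.keys (lin_ext f p)"
  then have "(\<Sum>s\<in>Poly_Mapping.keys p. Poly_Mapping.lookup p s * Poly_Mapping.lookup (f s) k) \<noteq> 0"
    by (simp add: lin_ext_def lookup_sum in_keys_iff)
  then obtain s where "s \<in> Poly_Mapping.keys p" "Poly_Mapping.lookup (f s) k \<noteq> 0"
    by (metis (no_types, lifting) mult_not_zero sum.not_neutral_contains_not_neutral)
  then show "k \<in> B" using assms[of s] by (auto simp: in_keys_iff)
qed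

lemma labels_map [simp]: "labels (map_monomial \<sigma> t) = \<sigma> ` labels t"
  by (rule monomial.set_map)

lemma multilinear_map: "inj_on \<sigma> (labels t) \<Longrightarrow> multilinear t \<Longrightarrow> multilinear (map_monomial \<sigma> t)"
proof (induction t)
  case (Prod s t)
  have "\<sigma> ` labels s \<inter> \<sigma> ` labels t = \<sigma> ` (labels s \<inter> labels t)"
    by (rule inj_on_image_Int[symmetric, OF Prod.prems(1)]) auto
  then show ?case using Prod by (auto intro: inj_on_subset)
qed auto

lemma map_in_monomials:
  "inj_on \<sigma> I \<Longrightarrow> t \<in> monomials I \<Longrightarrow> map_monomial \<sigma> t \<in> monomials (\<sigma> ` I)"
  by (auto simp: monomials_def multilinear_map)

lemma graft_absent [simp]: "a \<notin> labels s \<Longrightarrow> graft a t s = s"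
  by (induction s) auto

lemma labels_graft: "a \<in> labels s \<Longrightarrow> multilinear s \<Longrightarrow> labels (graft a t s) = labels s - {a} \<union> labels t"
proof (induction s)
  case (Prod s1 s2)
  show ?case
  proof (cases "a \<in> labels s1")
    case True
    then have "a \<notin> labels s2" using Prod.prems by auto
    then show ?thesis using Prod True by auto
  next
    case False
    then show ?thesis using Prod by auto
  qed
qed auto

lemma multilinear_graft:
  "multilinear s \<Longrightarrow> multilinear t \<Longrightarrow> (labels s - {a}) \<inter> labels t = {} \<Longrightarrow> multilinear (graft a t s)"
proof (induction s)
  case (Prod s1 s2)
  consider "a \<in> labels s1" "a \<notin> labels s2" | "a \<in> labels s2" "a \<notin> labels s1"
    | "a \<notin> labels s1" "a \<notin> labels s2" using Prod.prems by auto
  then show ?case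
    by cases (use Prod in \<open>auto simp: labels_graft\<close>)
qed auto

lemma graft_in_monomials:
  "composable I a J \<Longrightarrow> s \<in> monomials I \<Longrightarrow> t \<in> monomials J \<Longrightarrow> graft a t s \<in> monomials (I - {a} \<union> J)"
  by (simp add: composable_def monomials_def labels_graft multilinear_graft)

lemma graft_map:
  assumes "inj_on \<tau> (insert a (labels s))" "(labels s - {a}) \<inter> labels t = {}"
  shows "graft (\<tau> a) (map_monomial \<sigma> t) (map_monomial \<tau> s)
    = map_monomial (\<lambda>i. if i \<in> labels t then \<sigma> i else \<tau> i) (graft a t s)"
  using assms
proof (induction s)
  case (Var x)
  have "map_monomial \<sigma> t = map_monomial (\<lambda>i. if i \<in> labels t then \<sigma> i else \<tau> i) t"
    by (rule monomial.map_cong) auto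
  then show ?case using Var by (auto dest: inj_onD)
next
  case (Prod s1 s2)
  have "inj_on \<tau> (insert a (labels s1))" "inj_on \<tau> (insert a (labels s2))"
    by (rule inj_on_subset[OF Prod.prems(1)]; auto)+
  moreover have "(labels s1 - {a}) \<inter> labels t = {}" "(labels s2 - {a}) \<inter> labels t = {}"
    using Prod.prems(2) by auto
  ultimately show ?case by (simp only: monomial.map graft.simps Prod.IH)
qed

lemma graft_graft_sequential:
  "b \<notin> labels s - {a} \<Longrightarrow> b \<in> labels t \<Longrightarrow> graft b u (graft a t s) = graft a (graft b u t) s"
  by (induction s) auto

lemma graft_graft_parallel:
  "a \<noteq> b \<Longrightarrow> b \<notin> labels t \<Longrightarrow> a \<notin> labels u \<Longrightarrow> graft b u (graft a t s) = graft a t (graft b u s)"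
  by (induction s) auto

lemma graft_Var [simp]: "graft a (Var a) s = s"
  by (induction s) auto

theorem symmetric_operad_free_binary_operad: "symmetric_operad free_binary_operad"
proof
  fix I :: "nat set" and x :: nonassoc_poly and \<sigma> \<tau> :: "nat \<Rightarrow> nat"
  assume "x \<in> op_space free_binary_operad I"
  then have x: "\<And>t. t \<in> Poly_Mapping.keys x \<Longrightarrow> t \<in> monomials I" by (auto simp: free_binary_operad_def)
  { assume "\<And>i. i \<in> I \<Longrightarrow> \<sigma> i = \<tau> i"
    then have "map_monomial \<sigma> t = map_monomial \<tau> t" if "t \<in> Poly_Mapping.keys x" for t
      using x[OF that] by (intro monomial.map_cong) (auto simp: monomials_def)
    then show "relabel free_binary_operad I \<sigma> x = relabel free_binary_operad I \<tau> x"
      by (auto simp: free_binary_operad_def intro!: lin_ext_cong) }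
  show "relabel free_binary_operad (\<sigma> ` I) \<tau> (relabel free_binary_operad I \<sigma> x)
      = relabel free_binary_operad I (\<tau> \<circ> \<sigma>) x"
    by (simp add: free_binary_operad_def lin_ext_lin_ext monomial.map_comp)
  show "relabel free_binary_operad I id x = x"
    by (simp add: free_binary_operad_def monomial.map_id)
  { assume \<sigma>: "inj_on \<sigma> I"
    show "relabel free_binary_operad I \<sigma> x \<in> op_space free_binary_operad (\<sigma> ` I)"
      unfolding free_binary_operad_def operad.simps mem_Collect_eq
      by (rule keys_lin_ext) (simp add: map_in_monomials[OF \<sigma>] x) }
  fix a J K y z b
  assume "y \<in> op_space free_binary_operad J"
  then have y: "\<And>t. t \<in> Poly_Mapping.keys y \<Longrightarrow> t \<in> monomials J" by (auto simp: free_binary_operad_def)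
  { assume c: "composable I a J"
    show "pcomp free_binary_operad I a J x y \<in> op_space free_binary_operad (I - {a} \<union> J)"
      unfolding free_binary_operad_def operad.simps mem_Collect_eq
      by (intro keys_lin_ext) (simp add: graft_in_monomials[OF c] x y)
    { assume *: "inj_on \<tau> I" "inj_on \<sigma> J" "\<tau> ` (I - {a}) \<inter> \<sigma> ` J = {}"
      have "graft (\<tau> a) (map_monomial \<sigma> t) (map_monomial \<tau> s)
          = map_monomial (\<lambda>i. if i \<in> J then \<sigma> i else \<tau> i) (graft a t s)"
        if "s \<in> Poly_Mapping.keys x" "t \<in> Poly_Mapping.keys y" for s t
        proof -
        have "labels s = I" "labels t = J" "insert a I = I"
          using x[OF that(1)] y[OF that(2)] c by (auto simp: monomials_def composable_def)
        then show ?thesis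
          using graft_map[of \<tau> a s t \<sigma>] *(1) c by (simp add: composable_def)
      qed
      then show "pcomp free_binary_operad (\<tau> ` I) (\<tau> a) (\<sigma> ` J) (relabel free_binary_operad I \<tau> x)
          (relabel free_binary_operad J \<sigma> y) = relabel free_binary_operad (I - {a} \<union> J)
            (\<lambda>i. if i \<in> J then \<sigma> i else \<tau> i) (pcomp free_binary_operad I a J x y)"
        by (auto simp: free_binary_operad_def lin_ext_lin_ext intro!: lin_ext_cong) }
    assume "z \<in> op_space free_binary_operad K"
    then have z: "\<And>t. t \<in> Poly_Mapping.keys z \<Longrightarrow> t \<in> monomials K" by (auto simp: free_binary_operad_def)
    { assume *: "composable J b K" "composable (I - {a} \<union> J) b K"
      have "graft b u (graft a t s) = graft a (graft b u t) s"
        if "s \<in> Poly_Mapping.keys x" "t \<in> Poly_Mapping.keys y" for s t u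
        using x[OF that(1)] y[OF that(2)] *(1) c
        by (intro graft_graft_sequential) (auto simp: monomials_def composable_def)
      then show "pcomp free_binary_operad (I - {a} \<union> J) b K (pcomp free_binary_operad I a J x y) z
          = pcomp free_binary_operad I a (J - {b} \<union> K) x (pcomp free_binary_operad J b K y z)"
        by (auto simp: free_binary_operad_def lin_ext_lin_ext intro!: lin_ext_cong) }
    { assume *: "composable I b K" "a \<noteq> b" "J \<inter> K = {}"
      have "graft b u (graft a t s) = graft a t (graft b u s)"
        if "s \<in> Poly_Mapping.keys x" "t \<in> Poly_Mapping.keys y" "u \<in> Poly_Mapping.keys z" for s t u
        using x[OF that(1)] y[OF that(2)] z[OF that(3)] * c
        by (intro graft_graft_parallel) (auto simp: monomials_def composable_def)
      then have "lin_ext (\<lambda>s. lin_ext (\<lambda>t. lin_ext (\<lambda>u. mon (graft b u (graft a t s))) z) y) x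
          = lin_ext (\<lambda>s. lin_ext (\<lambda>t. lin_ext (\<lambda>u. mon (graft a t (graft b u s))) z) y) x"
        by (intro lin_ext_cong) simp
      also have "\<dots> = lin_ext (\<lambda>s. lin_ext (\<lambda>u. lin_ext (\<lambda>t. mon (graft a t (graft b u s))) y) z) x"
        by (rule lin_ext_cong, rule lin_ext_swap)
      finally show "pcomp free_binary_operad (I - {a} \<union> J) b K (pcomp free_binary_operad I a J x y) z
          = pcomp free_binary_operad (I - {b} \<union> K) a J (pcomp free_binary_operad I b K x z) y"
        by (simp add: free_binary_operad_def lin_ext_lin_ext) }
    }
qed (auto simp: free_binary_operad_def lin_ext_add lin_ext_cscale lin_ext_add_fun lin_ext_cscale_fun
   monomials_def cscale.scale_left_distrib cscale.scale_right_distrib algebra_simps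
   intro: exI[of _ 0] dest: keys_add[THEN subsetD] keys_cscale[THEN subsetD])

locale operad_with_ideal = symmetric_operad P for P :: "'v operad" +
  fixes J
  assumes ideal: "operadic_ideal P J"
begin

abbreviation Q where "Q \<equiv> quotient_operad P J"

lemma J_sub: "finite I \<Longrightarrow> j \<in> J I \<Longrightarrow> j \<in> op_space P I"
  and J_nonempty: "finite I \<Longrightarrow> J I \<noteq> {}"
  and J_vadd: "finite I \<Longrightarrow> j \<in> J I \<Longrightarrow> k \<in> J I \<Longrightarrow> vadd P I j k \<in> J I"
  and J_vscale: "finite I \<Longrightarrow> j \<in> J I \<Longrightarrow> vscale P I c j \<in> J I"
  using ideal unfolding operadic_ideal_def op_subspace_def by (meson subsetD)+

lemma J_relabel: "finite I \<Longrightarrow> inj_on \<sigma> I \<Longrightarrow> j \<in> J I \<Longrightarrow> relabel P I \<sigma> j \<in> J (\<sigma> ` I)"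
  and J_pcomp_left: "composable I a K \<Longrightarrow> j \<in> J I \<Longrightarrow> y \<in> op_space P K
    \<Longrightarrow> pcomp P I a K j y \<in> J (I - {a} \<union> K)"
  and J_pcomp_right: "composable I a K \<Longrightarrow> x \<in> op_space P I \<Longrightarrow> k \<in> J K
    \<Longrightarrow> pcomp P I a K x k \<in> J (I - {a} \<union> K)"
  using ideal by (simp_all add: operadic_ideal_def)

lemma mem_coset: "y \<in> op_coset P J I x \<longleftrightarrow> (\<exists>j\<in>J I. y = vadd P I x j)"
  by (auto simp: op_coset_def)

lemma vadd_zero_right: "finite I \<Longrightarrow> x \<in> op_space P I \<Longrightarrow> y \<in> op_space P I \<Longrightarrow> vadd P I y (vscale P I 0 x) = y"
  by (subst vadd_commute) (auto simp: vadd_zero vscale_closed)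

lemma coset_self:
  assumes "finite I" "x \<in> op_space P I"
  shows "x \<in> op_coset P J I x"
proof -
  obtain j where "j \<in> J I" using J_nonempty[OF assms(1)] by blast
  then have "vscale P I 0 j \<in> J I" "vadd P I x (vscale P I 0 j) = x"
    using assms by (simp_all add: J_vscale J_sub vadd_zero_right)
  then show ?thesis unfolding mem_coset by (metis (no_types))
qed

lemma coset_eq:
  assumes I: "finite I" and x: "x \<in> op_space P I" and y: "y \<in> op_coset P J I x"
  shows "op_coset P J I y = op_coset P J I x"
proof -
  obtain j where j: "j \<in> J I" "y = vadd P I x j" using y by (auto simp: mem_coset)
  have j': "j \<in> op_space P I" using J_sub I j by simp
  have both: "vadd P I y k \<in> op_coset P J I x" "vadd P I x k \<in> op_coset P J I y" if k: "k \<in> J I" for k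
  proof -
    have k': "k \<in> op_space P I" using J_sub[OF I k] .
    have "vadd P I y k = vadd P I x (vadd P I j k)"
      using I x j' k' j(2) by (simp add: vadd_assoc)
    then show "vadd P I y k \<in> op_coset P J I x"
      using I J_vadd[OF _ j(1) k] by (auto simp: mem_coset)
    let ?n = "vscale P I (-1) j"
    have n: "?n \<in> op_space P I" "?n \<in> J I" using I j j' by (simp_all add: vscale_closed J_vscale)
    have "vadd P I j ?n = vscale P I 0 j"
      using vscale_plus[OF I j', of 1 "-1"] unfolding vscale_one[OF I j'] by simp
    then have "vadd P I j (vadd P I ?n k) = k"
      unfolding vadd_assoc[OF I j' n(1) k', symmetric] by (simp only: vadd_zero[OF I j' k'])
    then have "vadd P I y (vadd P I ?n k) = vadd P I x k"
      by (simp only: j(2) vadd_assoc[OF I x j' vadd_closed[OF I n(1) k']])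
    then show "vadd P I x k \<in> op_coset P J I y"
      unfolding op_coset_def using J_vadd[OF I n(2) k] by (intro image_eqI) (simp_all only:)
  qed
  show ?thesis
  proof (intro equalityI subsetI)
    fix w assume "w \<in> op_coset P J I y"
    then obtain k where "k \<in> J I" "w = vadd P I y k" unfolding mem_coset by (elim bexE)
    then show "w \<in> op_coset P J I x" using both(1) by simp
  next
    fix w assume "w \<in> op_coset P J I x"
    then obtain k where "k \<in> J I" "w = vadd P I x k" unfolding mem_coset by (elim bexE)
    then show "w \<in> op_coset P J I y" using both(2) by simp
  qed
qed

lemma UN_coset:
  assumes "finite I" "finite K" "x \<in> op_space P I" "f x \<in> op_space P K"
    and "\<And>j. j \<in> J I \<Longrightarrow> f (vadd P I x j) \<in> op_coset P J K (f x)"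
  shows "(\<Union>y\<in>op_coset P J I x. op_coset P J K (f y)) = op_coset P J K (f x)"
proof -
  have "op_coset P J K (f y) = op_coset P J K (f x)" if "y \<in> op_coset P J I x" for y
    using that assms(5) coset_eq[OF assms(2,4)] by (metis mem_coset)
  moreover have "op_coset P J I x \<noteq> {}" using coset_self assms(1,3) by blast
  ultimately show ?thesis by simp
qed

lemma UN_UN_coset:
  assumes "finite I" "finite I'" "finite K" "x \<in> op_space P I" "x' \<in> op_space P I'" "f x x' \<in> op_space P K"
    and "\<And>j j'. j \<in> J I \<Longrightarrow> j' \<in> J I' \<Longrightarrow> f (vadd P I x j) (vadd P I' x' j') \<in> op_coset P J K (f x x')"
  shows "(\<Union>y\<in>op_coset P J I x. \<Union>y'\<in>op_coset P J I' x'. op_coset P J K (f y y')) = op_coset P J K (f x x')"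
proof -
  have "op_coset P J K (f y y') = op_coset P J K (f x x')"
    if "y \<in> op_coset P J I x" "y' \<in> op_coset P J I' x'" for y y'
    using that assms(7) coset_eq[OF assms(3,6)] by (metis mem_coset)
  moreover have "op_coset P J I x \<noteq> {}" "op_coset P J I' x' \<noteq> {}" using coset_self assms(1,2,4,5) by blast+
  ultimately show ?thesis by simp
qed

lemma Q_space: "op_space Q I = op_coset P J I ` op_space P I"
  by (simp add: quotient_operad_def)

lemma Q_unit: "op_unit Q a = op_coset P J {a} (op_unit P a)"
  by (simp add: quotient_operad_def)

lemma Q_vadd:
  assumes [simp]: "finite I" "x \<in> op_space P I" "y \<in> op_space P I"
  shows "vadd Q I (op_coset P J I x) (op_coset P J I y) = op_coset P J I (vadd P I x y)"
  unfolding quotient_operad_def operad.simps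
proof (rule UN_UN_coset)
  fix j k assume j: "j \<in> J I" "k \<in> J I"
  then have [simp]: "j \<in> op_space P I" "k \<in> op_space P I" by (simp_all add: J_sub)
  have "vadd P I (vadd P I x j) (vadd P I y k) = vadd P I (vadd P I x y) (vadd P I j k)"
    by (simp add: vadd_assoc vadd_closed) (metis assms \<open>j \<in> op_space P I\<close> \<open>k \<in> op_space P I\<close> vadd_assoc vadd_commute vadd_closed)
  then show "vadd P I (vadd P I x j) (vadd P I y k) \<in> op_coset P J I (vadd P I x y)"
    using j by (auto simp: mem_coset J_vadd)
qed (auto simp: vadd_closed)

lemma Q_vscale:
  assumes [simp]: "finite I" "x \<in> op_space P I"
  shows "vscale Q I c (op_coset P J I x) = op_coset P J I (vscale P I c x)"
  unfolding quotient_operad_def operad.simps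
  by (rule UN_coset) (auto simp: vscale_closed vscale_vadd J_sub mem_coset intro!: bexI J_vscale)

lemma Q_relabel:
  assumes [simp]: "finite I" "inj_on \<sigma> I" "x \<in> op_space P I"
  shows "relabel Q I \<sigma> (op_coset P J I x) = op_coset P J (\<sigma> ` I) (relabel P I \<sigma> x)"
  unfolding quotient_operad_def operad.simps
  by (rule UN_coset) (auto simp: relabel_closed relabel_vadd J_sub mem_coset intro!: bexI J_relabel)

lemma Q_pcomp:
  assumes c: "composable I a K" and [simp]: "x \<in> op_space P I" "y \<in> op_space P K"
  shows "pcomp Q I a K (op_coset P J I x) (op_coset P J K y)
    = op_coset P J (I - {a} \<union> K) (pcomp P I a K x y)"
  unfolding quotient_operad_def operad.simps
proof (rule UN_UN_coset)
  let ?L = "I - {a} \<union> K"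
  have fin [simp]: "finite I" "finite K" using c by (auto simp: composable_def)
  then have finL: "finite ?L" by blast
  fix j k assume j: "j \<in> J I" "k \<in> J K"
  then have [simp]: "j \<in> op_space P I" "k \<in> op_space P K" by (simp_all add: J_sub)
  have *: "pcomp P I a K x k \<in> J ?L" "pcomp P I a K j y \<in> J ?L" "pcomp P I a K j k \<in> J ?L"
    using c j by (auto intro: J_pcomp_left J_pcomp_right)
  have **: "pcomp P I a K x y \<in> op_space P ?L" "pcomp P I a K x k \<in> op_space P ?L"
      "pcomp P I a K j y \<in> op_space P ?L" "pcomp P I a K j k \<in> op_space P ?L"
    using c by (auto intro: pcomp_closed)
  have "pcomp P I a K (vadd P I x j) (vadd P K y k) =
      vadd P ?L (pcomp P I a K x y) (vadd P ?L (pcomp P I a K j y)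
        (vadd P ?L (pcomp P I a K x k) (pcomp P I a K j k)))"
    using c finL ** by (simp add: pcomp_vadd_left pcomp_vadd_right vadd_closed vadd_assoc)
  then show "pcomp P I a K (vadd P I x j) (vadd P K y k) \<in> op_coset P J ?L (pcomp P I a K x y)"
    using * finL by (auto simp: mem_coset J_vadd)
qed (use c in \<open>auto simp: composable_def intro: pcomp_closed[OF c]\<close>)

lemmas Q_simps = Q_vadd Q_vscale Q_relabel Q_pcomp Q_unit

theorem symmetric_operad_quotient: "symmetric_operad Q"
proof
  show "pcomp Q (\<tau> ` I) (\<tau> a) (\<sigma> ` K) (relabel Q I \<tau> x) (relabel Q K \<sigma> y)
        = relabel Q ((I - {a}) \<union> K) (\<lambda>i. if i \<in> K then \<sigma> i else \<tau> i) (pcomp Q I a K x y)"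
    if c: "composable I a K" and t: "inj_on \<tau> I" "inj_on \<sigma> K" "\<tau> ` (I - {a}) \<inter> \<sigma> ` K = {}"
      and xy: "x \<in> op_space Q I" "y \<in> op_space Q K" for I a K \<tau> \<sigma> x y
  proof -
    obtain u v where u: "u \<in> op_space P I" "x = op_coset P J I u"
      and v: "v \<in> op_space P K" "y = op_coset P J K v"
      using xy by (auto simp: Q_space)
    let ?\<rho> = "\<lambda>i. if i \<in> K then \<sigma> i else \<tau> i"
    have fin: "finite I" "finite K" "(I - {a}) \<inter> K = {}" "a \<in> I" using c by (auto simp: composable_def)
    have "inj_on ?\<rho> (I - {a} \<union> K)"
    proof (rule inj_onI)
      fix i j assume "i \<in> I - {a} \<union> K" "j \<in> I - {a} \<union> K" "?\<rho> i = ?\<rho> j"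
      then show "i = j" using t fin by (auto split: if_splits dest: inj_onD)
    qed
    moreover have "\<tau> ` I - {\<tau> a} = \<tau> ` (I - {a})"
      using t(1) fin(4) by (auto dest: inj_onD)
    moreover have "?\<rho> ` (I - {a} \<union> K) = \<tau> ` (I - {a}) \<union> \<sigma> ` K" using fin by (auto simp: image_iff)
    moreover have "composable (\<tau> ` I) (\<tau> a) (\<sigma> ` K)"
      using calculation fin t by (simp add: composable_def)
    ultimately show ?thesis
      using u v fin c t
      by (simp add: Q_relabel Q_pcomp pcomp_closed relabel_closed pcomp_relabel)
  qed
next
  show "pcomp Q ((I - {a}) \<union> K) b L (pcomp Q I a K x y) z = pcomp Q I a ((K - {b}) \<union> L) x (pcomp Q K b L y z)"
    if c: "composable I a K" "composable K b L" "composable ((I - {a}) \<union> K) b L"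
      and xy: "x \<in> op_space Q I" "y \<in> op_space Q K" "z \<in> op_space Q L" for I a K b L x y z
  proof -
    obtain u v w where u: "u \<in> op_space P I" "x = op_coset P J I u"
      and v: "v \<in> op_space P K" "y = op_coset P J K v"
      and w: "w \<in> op_space P L" "z = op_coset P J L w"
      using xy by (auto simp: Q_space)
    have "composable I a ((K - {b}) \<union> L)" "I - {a} \<union> K - {b} \<union> L = I - {a} \<union> (K - {b} \<union> L)"
      using c by (auto simp: composable_def)
    then show ?thesis using c u v w
      by (simp add: Q_pcomp pcomp_closed pcomp_sequential)
  qed
next
  show "pcomp Q ((I - {a}) \<union> K) b L (pcomp Q I a K x y) z = pcomp Q ((I - {b}) \<union> L) a K (pcomp Q I b L x z) y"
    if c: "composable I a K" "composable I b L" "a \<noteq> b" "K \<inter> L = {}"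
      and xy: "x \<in> op_space Q I" "y \<in> op_space Q K" "z \<in> op_space Q L" for I a K b L x y z
  proof -
    obtain u v w where u: "u \<in> op_space P I" "x = op_coset P J I u"
      and v: "v \<in> op_space P K" "y = op_coset P J K v"
      and w: "w \<in> op_space P L" "z = op_coset P J L w"
      using xy by (auto simp: Q_space)
    have "composable (I - {a} \<union> K) b L" "composable (I - {b} \<union> L) a K"
       "I - {a} \<union> K - {b} \<union> L = I - {b} \<union> L - {a} \<union> K"
      using c by (auto simp: composable_def)
    then show ?thesis using c u v w pcomp_parallel[OF c u(1) v(1) w(1)]
      by (simp add: Q_pcomp pcomp_closed)
  qed
next
  show "relabel Q I \<sigma> x = relabel Q I \<tau> x"
    if "finite I" "x \<in> op_space Q I" "\<And>i. i \<in> I \<Longrightarrow> \<sigma> i = \<tau> i" for I \<sigma> \<tau> x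
  proof -
    have "\<sigma> ` I = \<tau> ` I" using that(3) by auto
    moreover have "relabel P I \<sigma> u = relabel P I \<tau> u" if "u \<in> x" for u
      using that \<open>x \<in> op_space Q I\<close> \<open>finite I\<close> \<open>\<And>i. i \<in> I \<Longrightarrow> \<sigma> i = \<tau> i\<close>
      by (intro relabel_cong) (auto simp: Q_space mem_coset J_sub vadd_closed)
    ultimately show ?thesis by (simp add: quotient_operad_def)
  qed
next
  show "vadd Q I x y = vadd Q I y x" if "finite I" "x \<in> op_space Q I" "y \<in> op_space Q I" for I x y
    using that by (auto simp: Q_space Q_vadd vadd_commute[of I])
next
  fix I :: "nat set" and x y z c d and \<sigma> \<tau> :: "nat \<Rightarrow> nat"
  assume I: "finite I"
  show "op_space Q I \<noteq> {}" using I by (simp add: Q_space space_nonempty)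
  assume "x \<in> op_space Q I"
  then obtain u where u: "u \<in> op_space P I" "x = op_coset P J I u" by (auto simp: Q_space)
  note simps = I u Q_simps vadd_closed vscale_closed
  show "vscale Q I c x \<in> op_space Q I" by (simp add: simps) (simp add: Q_space I u vscale_closed)
  show "vscale Q I 1 x = x" by (simp add: simps vscale_one)
  show "vscale Q I c (vscale Q I d x) = vscale Q I (c * d) x" by (simp add: simps vscale_vscale)
  show "vscale Q I (c + d) x = vadd Q I (vscale Q I c x) (vscale Q I d x)"
    by (simp add: simps vscale_plus)
  show "relabel Q I id x = x" using Q_relabel[OF I inj_on_id u(1)] by (simp add: simps relabel_id)
  show "pcomp Q {a} a I (op_unit Q a) x = x" for a
    using Q_pcomp[of "{a}" a I "op_unit P a" u] I u
    by (simp add: composable_def unit_closed Q_unit pcomp_unit_left)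
  show "pcomp Q I a {a} x (op_unit Q a) = x" if "a \<in> I" for a
    using Q_pcomp[of I a "{a}" u "op_unit P a"] I u that
    by (simp add: composable_def unit_closed Q_unit pcomp_unit_right insert_absorb)
  { assume \<sigma>: "inj_on \<sigma> I"
    note simps = simps \<sigma> relabel_closed
    show "relabel Q I \<sigma> x \<in> op_space Q (\<sigma> ` I)"
      by (simp add: simps) (simp add: Q_space I u \<sigma> relabel_closed)
    show "relabel Q I \<sigma> (vscale Q I c x) = vscale Q (\<sigma> ` I) c (relabel Q I \<sigma> x)"
      by (simp add: simps relabel_vscale)
    show "relabel Q (\<sigma> ` I) \<tau> (relabel Q I \<sigma> x) = relabel Q I (\<tau> \<circ> \<sigma>) x" if "inj_on \<tau> (\<sigma> ` I)"
      using that by (simp add: simps relabel_relabel comp_inj_on image_comp) }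
  assume "y \<in> op_space Q I"
  then obtain v where v: "v \<in> op_space P I" "y = op_coset P J I v" by (auto simp: Q_space)
  note simps = simps v
  show "vadd Q I x y \<in> op_space Q I" by (simp add: simps) (simp add: Q_space I u v vadd_closed)
  show "vadd Q I (vscale Q I 0 x) y = y" by (simp add: simps vadd_zero)
  show "vscale Q I c (vadd Q I x y) = vadd Q I (vscale Q I c x) (vscale Q I c y)"
    by (simp add: simps vscale_vadd)
  show "relabel Q I \<sigma> (vadd Q I x y) = vadd Q (\<sigma> ` I) (relabel Q I \<sigma> x) (relabel Q I \<sigma> y)"
    if "inj_on \<sigma> I" using that by (simp add: simps relabel_vadd relabel_closed)
  assume "z \<in> op_space Q I"
  then show "vadd Q I (vadd Q I x y) z = vadd Q I x (vadd Q I y z)"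
    by (auto simp: simps Q_space vadd_assoc)
next
  fix I K :: "nat set" and x x' y y' a c
  assume c: "composable I a K"
  then have fin: "finite I" "finite K" "finite (I - {a} \<union> K)" by (auto simp: composable_def)
  assume "x \<in> op_space Q I" "y \<in> op_space Q K"
  then obtain u v where u: "u \<in> op_space P I" "x = op_coset P J I u"
    and v: "v \<in> op_space P K" "y = op_coset P J K v" by (auto simp: Q_space)
  have fin': "finite (I - {a} \<union> K) = True" using fin by simp
  note simps = u v Q_pcomp[OF c] Q_vadd[OF fin(1)] Q_vadd[OF fin(2)] Q_vadd[OF fin(3)]
    Q_vscale[OF fin(1)] Q_vscale[OF fin(2)] Q_vscale[OF fin(3)] fin
    vadd_closed vscale_closed pcomp_closed[OF c]
  show "pcomp Q I a K x y \<in> op_space Q (I - {a} \<union> K)"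
    by (simp add: simps) (simp add: Q_space pcomp_closed c u v)
  show "pcomp Q I a K (vscale Q I c x) y = vscale Q (I - {a} \<union> K) c (pcomp Q I a K x y)" for c
    by (simp add: simps pcomp_vscale_left c)
  show "pcomp Q I a K x (vscale Q K c y) = vscale Q (I - {a} \<union> K) c (pcomp Q I a K x y)" for c
    by (simp add: simps pcomp_vscale_right c)
  { assume "x' \<in> op_space Q I"
    then show "pcomp Q I a K (vadd Q I x x') y
        = vadd Q (I - {a} \<union> K) (pcomp Q I a K x y) (pcomp Q I a K x' y)"
      by (auto simp: Q_space simps pcomp_vadd_left c) }
  { assume "y' \<in> op_space Q K"
    then show "pcomp Q I a K x (vadd Q K y y')
        = vadd Q (I - {a} \<union> K) (pcomp Q I a K x y) (pcomp Q I a K x y')"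
      by (auto simp: Q_space simps pcomp_vadd_right c) }
next
  show "op_unit Q a \<in> op_space Q {a}" for a by (simp add: Q_unit Q_space unit_closed)
  show "relabel Q {a} \<sigma> (op_unit Q a) = op_unit Q (\<sigma> a)" for a \<sigma>
    using Q_relabel[of "{a}" \<sigma> "op_unit P a"] by (simp add: Q_unit unit_closed relabel_unit)
qed

end

text \<open>A generated ideal is an ideal, so that the quotient by it is an operad.\<close>

lemma (in symmetric_operad) operadic_ideal_gen:
  assumes "\<And>I. R I \<subseteq> op_space P I"
  shows "operadic_ideal P (operadic_ideal_gen P R)"
proof -
  have whole: "operadic_ideal P (op_space P)"
    unfolding operadic_ideal_def op_subspace_def
    by (simp add: space_nonempty vadd_closed vscale_closed relabel_closed pcomp_closed)
  have zero: "vscale P I 0 x \<in> J I" if J: "operadic_ideal P J" and I: "finite I" and x: "x \<in> op_space P I" for J I x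
  proof -
    interpret operad_with_ideal P J by unfold_locales (rule J)
    obtain j where j: "j \<in> J I" using J_nonempty[OF I] by blast
    have "vscale P I 0 x = vscale P I 0 j"
      using I x j J_sub by (metis vadd_zero vadd_zero_right vscale_closed)
    then show ?thesis using J_vscale[OF I j] by simp
  qed
  let ?G = "operadic_ideal_gen P R"
  have mem: "x \<in> ?G I \<longleftrightarrow> (\<forall>J. operadic_ideal P J \<and> (\<forall>K. R K \<subseteq> J K) \<longrightarrow> x \<in> J I)" for x I
    unfolding operadic_ideal_gen_def by blast
  have sub: "?G I \<subseteq> op_space P I" for I using whole assms mem by blast
  have nonempty: "?G I \<noteq> {}" if I: "finite I" for I
  proof -
    obtain x where x: "x \<in> op_space P I" using space_nonempty[OF I] by blast
    then have "vscale P I 0 x \<in> ?G I" using zero[OF _ I x] by (simp add: mem)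
    then show ?thesis by blast
  qed
  have O: "operad_with_ideal P J" if "operadic_ideal P J" for J
    by unfold_locales (rule that)
  have "vadd P I x y \<in> ?G I" if "finite I" "x \<in> ?G I" "y \<in> ?G I" for I x y
    using that unfolding mem by (blast intro: operad_with_ideal.J_vadd[OF O])
  moreover have "vscale P I c x \<in> ?G I" if "finite I" "x \<in> ?G I" for I x c
    using that unfolding mem by (blast intro: operad_with_ideal.J_vscale[OF O])
  moreover have "relabel P I \<sigma> x \<in> ?G (\<sigma> ` I)" if "finite I" "inj_on \<sigma> I" "x \<in> ?G I" for I \<sigma> x
    using that unfolding mem by (blast intro: operad_with_ideal.J_relabel[OF O])
  moreover have "pcomp P I a K x y \<in> ?G (I - {a} \<union> K)"
    if "composable I a K" "x \<in> ?G I" "y \<in> op_space P K" for I a K x y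
    using that unfolding mem by (blast intro: operad_with_ideal.J_pcomp_left[OF O])
  moreover have "pcomp P I a K x y \<in> ?G (I - {a} \<union> K)"
    if "composable I a K" "x \<in> op_space P I" "y \<in> ?G K" for I a K x y
    using that unfolding mem by (blast intro: operad_with_ideal.J_pcomp_right[OF O])
  ultimately show ?thesis
    using sub nonempty by (simp add: operadic_ideal_def[of P ?G] op_subspace_def)
qed

theorem symmetric_operad_mock_novikov: "symmetric_operad (mock_novikov_operad \<delta>)"
proof -
  let ?F = free_binary_operad
  interpret F: symmetric_operad ?F by (rule symmetric_operad_free_binary_operad)
  have "mock_novikov_identities \<delta> \<subseteq> op_space ?F {1, 2, 3}"
    unfolding mock_novikov_identities_def free_binary_operad_def Let_def
    by (auto dest!: keys_add[THEN subsetD] keys_cscale[THEN subsetD] split: if_splits simp: monomials_def)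
  moreover have "sym_submodule ?F {1, 2, 3} (op_space ?F {1, 2, 3})"
    unfolding sym_submodule_def op_subspace_def bij_betw_def
    using F.relabel_closed[of "{1, 2, 3}"] F.space_nonempty F.vadd_closed F.vscale_closed
    by (metis finite.emptyI finite_insert order_refl)
  ultimately have "mock_novikov_relations \<delta> \<subseteq> op_space ?F {1, 2, 3}"
    unfolding mock_novikov_relations_def sym_submodule_gen_def by blast
  then interpret operad_with_ideal ?F
      "operadic_ideal_gen ?F (\<lambda>I. if I = {1, 2, 3} then mock_novikov_relations \<delta> else {})"
    by unfold_locales (rule F.operadic_ideal_gen, simp)
  show ?thesis unfolding mock_novikov_operad_def by (rule symmetric_operad_quotient)
qed

end

theory Submission
  imports Defs "HOL-Combinatorics.Permutations"
begin

text \<open>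
  The cobar complex of \<open>M\<^sub>\<delta>\<close> in arity six is not exact at the trees with four vertices, for every
  \<open>\<delta> \<noteq> 0\<close> at once. A family of monomials decorating the vertices of a tree assembles to a binary
  planar tree on the same leaves, some of whose inner edges are contracted; in this way a cochain is a
  function on such trees that satisfies the defining relations at every contracted edge. The cocycle
  depends only on the position of the leaf \<open>1\<close>, that is, it has weight \<open>x\<^sup>5 y\<close>, and its values are
  polynomials in \<open>\<delta>\<close>. They were found by linear algebra over the field of rational functions in \<open>\<delta>\<close>.
  The cocycle is detected by the cycle \<open>x(x(tx)) - \<delta> (x(tx))x\<close> with \<open>t = x(xy)\<close>, where the outer
  product of \<open>t\<close> is contracted into \<open>tx\<close>: its boundary vanishes by three consequences of the relations
  with repeated arguments, whereas the cocycle takes the value \<open>\<delta>\<close> on it.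
\<close>

section \<open>The ideal of relations\<close>

text \<open>The operad itself is never computed. Index 3 in arity six is the last place before the
  right end; a cochain there lives on trees with four vertices, hence with one contracted edge and
  at most three inputs at each vertex. So the cocycle descends to the quotient once the ideal is
  bounded from above in arity at most three (\<open>cubic_ideal\<close>). Of a hypothetical
  primitive, which lives on trees with two contracted edges, only the vanishing on relations is
  used, and for this it suffices to exhibit elements of the ideal. A primitive need not be a
  function of planar shapes. Its sum over the permutations of 2, ..., 6 is one, up to sign, and its
  differential is 5! times the cocycle; the five leaves other than 1 then act as equal arguments
  \<open>x\<close>. The required identities hold coefficientwise over the integers, so no special
  value of \<delta> needs separate care; \<delta> \<noteq> 0 enters through the final value. The
  complex orders edges by \<open>set_encode\<close>, which is not compatible with permuting leaves.
  Multiplication by \<open>orientation\<close> passes to the planar order, in which contractions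
  have alternating signs.\<close>

definition mn_ideal :: "complex \<Rightarrow> nat set \<Rightarrow> nonassoc_poly set" where
  "mn_ideal \<delta> = operadic_ideal_gen free_binary_operad
     (\<lambda>I. if I = {1, 2, 3} then mock_novikov_relations \<delta> else {})"

lemma mock_novikov_operad_eq: "mock_novikov_operad \<delta> = quotient_operad free_binary_operad (mn_ideal \<delta>)"
  by (simp add: mock_novikov_operad_def mn_ideal_def)

interpretation F: symmetric_operad free_binary_operad
  by (rule symmetric_operad_free_binary_operad)

lemma mock_novikov_identities_sub: "mock_novikov_identities \<delta> \<subseteq> op_space free_binary_operad {1, 2, 3}"
  unfolding mock_novikov_identities_def free_binary_operad_def Let_def
  by (auto dest!: keys_add[THEN subsetD] keys_cscale[THEN subsetD] split: if_splits simp: monomials_def)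

lemma mock_novikov_relations_sub: "mock_novikov_relations \<delta> \<subseteq> op_space free_binary_operad {1, 2, 3}"
proof -
  have "sym_submodule free_binary_operad {1, 2, 3} (op_space free_binary_operad {1, 2, 3})"
    unfolding sym_submodule_def op_subspace_def bij_betw_def
    using F.relabel_closed[of "{1, 2, 3}"] F.space_nonempty F.vadd_closed F.vscale_closed
    by (metis finite.emptyI finite_insert order_refl)
  then show ?thesis
    using mock_novikov_identities_sub unfolding mock_novikov_relations_def sym_submodule_gen_def by blast
qed

interpretation M: operad_with_ideal free_binary_operad "mn_ideal \<delta>" for \<delta>
  unfolding mn_ideal_def
  using mock_novikov_relations_sub by unfold_locales (rule F.operadic_ideal_gen, simp)

lemma mock_novikov_identities_ideal: "mock_novikov_identities \<delta> \<subseteq> mn_ideal \<delta> {1, 2, 3}"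
proof -
  have "mock_novikov_relations \<delta> \<subseteq> mn_ideal \<delta> {1, 2, 3}"
    unfolding mn_ideal_def operadic_ideal_gen_def by fastforce
  then show ?thesis
    unfolding mock_novikov_relations_def sym_submodule_gen_def by blast
qed

lemma free_space: "op_space free_binary_operad I = {p. Poly_Mapping.keys p \<subseteq> monomials I}"
  and free_vadd: "vadd free_binary_operad I p q = p + q"
  and free_vscale: "vscale free_binary_operad I c p = cscale c p"
  and free_relabel: "relabel free_binary_operad I \<sigma> p = lin_ext (\<lambda>t. mon (map_monomial \<sigma> t)) p"
  and free_pcomp: "pcomp free_binary_operad I a J p q = lin_ext (\<lambda>s. lin_ext (\<lambda>t. mon (graft a t s)) q) p"
  by (simp_all add: free_binary_operad_def)

lemma mon_space: "t \<in> monomials I \<Longrightarrow> mon t \<in> op_space free_binary_operad I"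
  by (simp add: free_space)

lemma finite_labels [simp]: "finite (labels (t :: 'a monomial))"
  by (induction t) auto

lemma labels_nonempty [simp]: "labels t \<noteq> {}"
  by (induction t) auto

text \<open>An entry \<open>(k, t)\<close> of a relation instance stands for the monomial \<open>t\<close> with coefficient \<open>\<delta> ^ k\<close>.\<close>

fun relations :: "'a monomial \<Rightarrow> (nat \<times> 'a monomial) list list" where
  "relations (Var a) = []"
| "relations (s \<odot> t) =
     map (map (apsnd (\<lambda>s'. s' \<odot> t))) (relations s) @ map (map (apsnd (\<lambda>t'. s \<odot> t'))) (relations t) @
     (case s of Var a \<Rightarrow> [] | u \<odot> v \<Rightarrow> [[(0, (u \<odot> v) \<odot> t), (0, (u \<odot> t) \<odot> v)]]) @
     (case t of Var a \<Rightarrow> [] | u \<odot> v \<Rightarrow>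
       [[(1, (s \<odot> u) \<odot> v), (1, (u \<odot> s) \<odot> v), (0, s \<odot> (u \<odot> v)), (0, u \<odot> (s \<odot> v))]])"

definition relation_poly :: "complex \<Rightarrow> (nat \<times> 'a monomial) list \<Rightarrow> 'a monomial \<Rightarrow>\<^sub>0 complex" where
  "relation_poly \<delta> L = (\<Sum>(k, t)\<leftarrow>L. cscale (\<delta> ^ k) (mon t))"

lemma relation_poly_map:
  "relation_poly \<delta> (map (apsnd f) L) = lin_ext (\<lambda>t. mon (f t)) (relation_poly \<delta> L)"
  by (induction L) (auto simp: relation_poly_def lin_ext_add lin_ext_cscale)

text \<open>Multiplication by \<open>t\<close> is composition into the slot \<open>a\<close> of
  \<open>Var a \<odot> t\<close>. The slot must avoid \<open>labels t\<close>, but it may occur in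
  \<open>I\<close>, since the label of a slot can be reused.\<close>

lemma ideal_prod_left:
  assumes p: "p \<in> mn_ideal \<delta> I" and fin: "finite I" and t: "multilinear t" "labels t \<inter> I = {}"
  shows "lin_ext (\<lambda>s. mon (s \<odot> t)) p \<in> mn_ideal \<delta> (I \<union> labels t)"
proof -
  obtain a where a: "a \<notin> labels t" using infinite_UNIV_nat finite_labels by (metis ex_new_if_finite)
  have "composable (insert a (labels t)) a I" using fin t by (auto simp: composable_def)
  moreover have "mon (Var a \<odot> t) \<in> op_space free_binary_operad (insert a (labels t))"
    using a t by (simp add: free_space monomials_def)
  ultimately have "pcomp free_binary_operad (insert a (labels t)) a I (mon (Var a \<odot> t)) p
      \<in> mn_ideal \<delta> (insert a (labels t) - {a} \<union> I)"
    using M.J_pcomp_right p by blast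
  moreover have "insert a (labels t) - {a} \<union> I = I \<union> labels t" using a by auto
  ultimately show ?thesis using a by (simp add: free_pcomp)
qed

lemma ideal_prod_right:
  assumes p: "p \<in> mn_ideal \<delta> I" and fin: "finite I" and t: "multilinear t" "labels t \<inter> I = {}"
  shows "lin_ext (\<lambda>s. mon (t \<odot> s)) p \<in> mn_ideal \<delta> (labels t \<union> I)"
proof -
  obtain a where a: "a \<notin> labels t" using infinite_UNIV_nat finite_labels by (metis ex_new_if_finite)
  have "composable (insert a (labels t)) a I" using fin t by (auto simp: composable_def)
  moreover have "mon (t \<odot> Var a) \<in> op_space free_binary_operad (insert a (labels t))"
    using a t by (simp add: free_space monomials_def)
  ultimately have "pcomp free_binary_operad (insert a (labels t)) a I (mon (t \<odot> Var a)) p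
      \<in> mn_ideal \<delta> (insert a (labels t) - {a} \<union> I)"
    using M.J_pcomp_right p by blast
  moreover have "insert a (labels t) - {a} \<union> I = labels t \<union> I" using a by auto
  ultimately show ?thesis using a by (simp add: free_pcomp)
qed

text \<open>The labels of \<open>u\<close>, \<open>v\<close>, \<open>w\<close> may meet {1, 2, 3},
  and the three partial compositions are made one after another; hence the variables are first
  renamed to fresh \<open>a\<close>, \<open>b\<close>, \<open>c\<close>. The nested grafts are left
  unevaluated, because for a concrete \<open>p\<close> simplification computes them from the
  freshness conditions.\<close>

lemma ideal_subst:
  assumes p: "p \<in> mn_ideal \<delta> {1, 2, 3}"
    and uvw: "multilinear u" "multilinear v" "multilinear w"
      "labels u \<inter> labels v = {}" "labels u \<inter> labels w = {}" "labels v \<inter> labels w = {}"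
  obtains a b c where "distinct [a, b, c]" "{a, b, c} \<inter> (labels u \<union> labels v \<union> labels w) = {}"
    "lin_ext (\<lambda>t. mon (graft c w (graft b v (graft a u
        (map_monomial (\<lambda>i. if i = 1 then a else if i = 2 then b else c) t))))) p
      \<in> mn_ideal \<delta> (labels u \<union> labels v \<union> labels w)"
proof -
  let ?U = "labels u \<union> labels v \<union> labels w"
  obtain a where a: "a \<notin> ?U" using infinite_UNIV_nat by (metis ex_new_if_finite finite_UnI finite_labels)
  obtain b where b: "b \<notin> insert a ?U"
    using infinite_UNIV_nat by (metis ex_new_if_finite finite_UnI finite_insert finite_labels)
  obtain c where c: "c \<notin> insert a (insert b ?U)"
    using infinite_UNIV_nat by (metis ex_new_if_finite finite_UnI finite_insert finite_labels)
  define \<sigma> :: "nat \<Rightarrow> nat" where "\<sigma> = (\<lambda>i. if i = 1 then a else if i = 2 then b else c)"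
  have img: "\<sigma> ` {1, 2, 3} = {a, b, c}" "inj_on \<sigma> {1, 2, 3}"
    using a b c by (auto simp: \<sigma>_def inj_on_def)
  have 1: "lin_ext (\<lambda>t. mon (map_monomial \<sigma> t)) p \<in> mn_ideal \<delta> {a, b, c}"
    using M.J_relabel[OF _ img(2) p] unfolding free_relabel img(1) by simp
  have s: "composable I x (labels y) \<Longrightarrow> multilinear y \<Longrightarrow> q \<in> mn_ideal \<delta> I \<Longrightarrow>
      lin_ext (\<lambda>t. mon (graft x y t)) q \<in> mn_ideal \<delta> (I - {x} \<union> labels y)" for I x y q
    using M.J_pcomp_left[of I x "labels y" q \<delta> "mon y"]
    by (simp add: free_pcomp free_space monomials_def)
  have 2: "lin_ext (\<lambda>t. mon (graft a u (map_monomial \<sigma> t))) p \<in> mn_ideal \<delta> ({a, b, c} - {a} \<union> labels u)"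
    using s[OF _ uvw(1) 1, of a] a b c by (auto simp: lin_ext_lin_ext composable_def)
  have 3: "lin_ext (\<lambda>t. mon (graft b v (graft a u (map_monomial \<sigma> t)))) p
      \<in> mn_ideal \<delta> ({a, b, c} - {a} \<union> labels u - {b} \<union> labels v)"
    using s[OF _ uvw(2) 2, of b] a b c uvw(4) by (auto simp: lin_ext_lin_ext composable_def)
  have 4: "lin_ext (\<lambda>t. mon (graft c w (graft b v (graft a u (map_monomial \<sigma> t))))) p
      \<in> mn_ideal \<delta> ({a, b, c} - {a} \<union> labels u - {b} \<union> labels v - {c} \<union> labels w)"
    using s[OF _ uvw(3) 3, of c] a b c uvw(5,6) by (auto simp: lin_ext_lin_ext composable_def)
  have "{a, b, c} - {a} \<union> labels u - {b} \<union> labels v - {c} \<union> labels w = ?U"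
    using a b c by auto
  then show ?thesis using 4 a b c by (intro that[of a b c]) (auto simp: \<sigma>_def)
qed

lemma ideal_relations_root:
  assumes uvw: "multilinear u" "multilinear v" "multilinear w"
      "labels u \<inter> labels v = {}" "labels u \<inter> labels w = {}" "labels v \<inter> labels w = {}"
  shows "relation_poly \<delta> [(0, (u \<odot> v) \<odot> w), (0, (u \<odot> w) \<odot> v)] \<in> mn_ideal \<delta> (labels u \<union> labels v \<union> labels w)"
    and "relation_poly \<delta> [(1, (u \<odot> v) \<odot> w), (1, (v \<odot> u) \<odot> w), (0, u \<odot> (v \<odot> w)), (0, v \<odot> (u \<odot> w))]
      \<in> mn_ideal \<delta> (labels u \<union> labels v \<union> labels w)"
proof -
  let ?x = "Var 1 :: nat monomial" and ?y = "Var 2 :: nat monomial" and ?z = "Var 3 :: nat monomial"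
  have "mon ((?x \<odot> ?y) \<odot> ?z) + mon ((?x \<odot> ?z) \<odot> ?y) \<in> mn_ideal \<delta> {1, 2, 3}"
    using mock_novikov_identities_ideal[of \<delta>] unfolding mock_novikov_identities_def Let_def by simp
  then show "relation_poly \<delta> [(0, (u \<odot> v) \<odot> w), (0, (u \<odot> w) \<odot> v)]
      \<in> mn_ideal \<delta> (labels u \<union> labels v \<union> labels w)"
    by (rule ideal_subst[OF _ uvw]) (simp add: lin_ext_add relation_poly_def)
  have "cscale \<delta> (mon ((?x \<odot> ?y) \<odot> ?z)) + cscale \<delta> (mon ((?y \<odot> ?x) \<odot> ?z))
        + mon (?x \<odot> (?y \<odot> ?z)) + mon (?y \<odot> (?x \<odot> ?z)) \<in> mn_ideal \<delta> {1, 2, 3}"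
    using mock_novikov_identities_ideal[of \<delta>] unfolding mock_novikov_identities_def Let_def by simp
  then show "relation_poly \<delta>
      [(1, (u \<odot> v) \<odot> w), (1, (v \<odot> u) \<odot> w), (0, u \<odot> (v \<odot> w)), (0, v \<odot> (u \<odot> w))]
      \<in> mn_ideal \<delta> (labels u \<union> labels v \<union> labels w)"
    by (rule ideal_subst[OF _ uvw]) (simp add: lin_ext_add lin_ext_cscale relation_poly_def add.assoc)
qed

text \<open>An instance at the root is a substitution into one of the two identities; an instance
  further up is carried to the root by products, which the ideal absorbs.\<close>

lemma relations_in_ideal:
  "L \<in> set (relations t) \<Longrightarrow> multilinear t \<Longrightarrow> relation_poly \<delta> L \<in> mn_ideal \<delta> (labels t)"
proof (induction t arbitrary: L)
  case (Prod s t)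
  note ml = Prod.prems(2)
  from Prod.prems(1) consider
      L' where "L' \<in> set (relations s)" "L = map (apsnd (\<lambda>s'. s' \<odot> t)) L'"
    | L' where "L' \<in> set (relations t)" "L = map (apsnd (\<lambda>t'. s \<odot> t')) L'"
    | u v where "s = u \<odot> v" "L = [(0, (u \<odot> v) \<odot> t), (0, (u \<odot> t) \<odot> v)]"
    | u v where "t = u \<odot> v" "L = [(1, (s \<odot> u) \<odot> v), (1, (u \<odot> s) \<odot> v), (0, s \<odot> (u \<odot> v)), (0, u \<odot> (s \<odot> v))]"
    by (auto split: monomial.splits)
  then show ?case
  proof cases
    case 1
    then have "relation_poly \<delta> L' \<in> mn_ideal \<delta> (labels s)" using Prod.IH(1) ml by simp
    then show ?thesis using 1 ml ideal_prod_left[of _ \<delta> "labels s" t]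
      by (simp add: relation_poly_map Int_commute)
  next
    case 2
    then have "relation_poly \<delta> L' \<in> mn_ideal \<delta> (labels t)" using Prod.IH(2) ml by simp
    then show ?thesis using 2 ml ideal_prod_right[of _ \<delta> "labels t" s]
      by (simp add: relation_poly_map)
  next
    case 3
    then show ?thesis using ideal_relations_root(1)[of u v t \<delta>] ml by (auto simp: Int_Un_distrib2)
  next
    case 4
    then show ?thesis using ideal_relations_root(2)[of s u v \<delta>] ml by (auto simp: Int_Un_distrib Un_assoc)
  qed
qed simp

text \<open>The pairing of a functional, given by its values on monomials, with a polynomial. It is
  routed through \<open>lin_ext\<close> with the one-element basis \<open>()\<close>, so that its
  linearity is inherited from \<open>lin_ext\<close>.\<close>

definition eval_at :: "('a \<Rightarrow> complex) \<Rightarrow> ('a \<Rightarrow>\<^sub>0 complex) \<Rightarrow> complex" where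
  "eval_at v p = Poly_Mapping.lookup (lin_ext (\<lambda>t. Poly_Mapping.single () (v t)) p) ()"

lemma eval_at_add [simp]: "eval_at v (p + q) = eval_at v p + eval_at v q"
  and eval_at_cscale [simp]: "eval_at v (cscale c p) = c * eval_at v p"
  and eval_at_mon [simp]: "eval_at v (mon t) = v t"
  and eval_at_0 [simp]: "eval_at v 0 = 0"
  by (simp_all add: eval_at_def lin_ext_add lin_ext_cscale lookup_add)

lemma eval_at_lin_ext: "eval_at v (lin_ext f p) = eval_at (\<lambda>t. eval_at v (f t)) p"
proof -
  have "Poly_Mapping.single () (Poly_Mapping.lookup x ()) = x" for x :: "unit \<Rightarrow>\<^sub>0 complex"
    by (rule poly_mapping_eqI) (simp add: lookup_single when_def)
  then show ?thesis unfolding eval_at_def lin_ext_lin_ext by simp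
qed

lemma eval_at_superset:
  assumes "finite A" "Poly_Mapping.keys p \<subseteq> A"
  shows "eval_at v p = (\<Sum>t\<in>A. Poly_Mapping.lookup p t * v t)"
  unfolding eval_at_def lin_ext_superset[OF assms] by (simp add: lookup_sum)

lemma eval_at_cong: "(\<And>t. t \<in> Poly_Mapping.keys p \<Longrightarrow> v t = w t) \<Longrightarrow> eval_at v p = eval_at w p"
  unfolding eval_at_def by (metis (mono_tags, lifting) lin_ext_cong)

lemma eval_at_zero: "(\<And>t. t \<in> Poly_Mapping.keys p \<Longrightarrow> v t = 0) \<Longrightarrow> eval_at v p = 0"
  by (subst eval_at_superset[of "Poly_Mapping.keys p"]) auto

section \<open>An upper bound for the ideal in arity at most three\<close>

definition satisfies_relations :: "complex \<Rightarrow> (nat monomial \<Rightarrow> complex) \<Rightarrow> bool" where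
  "satisfies_relations \<delta> f \<longleftrightarrow> (\<forall>u v w. f ((u \<odot> v) \<odot> w) + f ((u \<odot> w) \<odot> v) = 0 \<and>
     \<delta> * f ((u \<odot> v) \<odot> w) + \<delta> * f ((v \<odot> u) \<odot> w) + f (u \<odot> (v \<odot> w)) + f (v \<odot> (u \<odot> w)) = 0)"

text \<open>In arity at most three this is the space annihilated by all functionals that respect the
  relations at the root; above arity three it is everything, which makes the ideal axioms easy to
  check there. The dual description is the one that gets applied to cochains.\<close>

definition cubic_ideal :: "complex \<Rightarrow> nat set \<Rightarrow> nonassoc_poly set" where
  "cubic_ideal \<delta> I = {p. Poly_Mapping.keys p \<subseteq> monomials I \<and>
     (card I \<le> 3 \<longrightarrow> (\<forall>f. satisfies_relations \<delta> f \<longrightarrow> eval_at f p = 0))}"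

lemma monomials_empty: "monomials {} = {}"
  by (auto simp: monomials_def)

lemma labels_card_prod: "multilinear (s \<odot> t) \<Longrightarrow> card (labels (s \<odot> t)) = card (labels s) + card (labels t)"
  by (simp add: card_Un_disjoint)

lemma card_labels_pos: "card (labels (t :: 'a monomial)) \<ge> 1"
  by (simp add: Suc_le_eq card_gt_0_iff)

text \<open>A monomial in at most two variables has neither of the shapes
  \<open>(u \<odot> v) \<odot> w\<close> and \<open>u \<odot> (v \<odot> w)\<close>. Hence its
  indicator function satisfies the relations vacuously, and this functional reads off its
  coefficient.\<close>

lemma cubic_ideal_small:
  assumes p: "p \<in> cubic_ideal \<delta> I" and I: "card I \<le> 2"
  shows "p = 0"
proof (rule poly_mapping_eqI)
  fix t
  show "Poly_Mapping.lookup p t = Poly_Mapping.lookup 0 t"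
  proof (cases "t \<in> monomials I")
    case True
    have no: "t \<noteq> (u \<odot> v) \<odot> w" "t \<noteq> u \<odot> (v \<odot> w)" for u v w
    proof -
      have *: "card (labels u) \<ge> 1" "card (labels v) \<ge> 1" "card (labels w) \<ge> 1" by (rule card_labels_pos)+
      show "t \<noteq> (u \<odot> v) \<odot> w"
      proof
        assume "t = (u \<odot> v) \<odot> w"
        then have "card I = card (labels u) + card (labels v) + card (labels w)"
          using True labels_card_prod[of "u \<odot> v" w] labels_card_prod[of u v] by (auto simp: monomials_def)
        then show False using * I by linarith
      qed
      show "t \<noteq> u \<odot> (v \<odot> w)"
      proof
        assume "t = u \<odot> (v \<odot> w)"
        then have "card I = card (labels u) + card (labels v) + card (labels w)"
          using True labels_card_prod[of u "v \<odot> w"] labels_card_prod[of v w] by (auto simp: monomials_def)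
        then show False using * I by linarith
      qed
    qed
    then have "satisfies_relations \<delta> (\<lambda>s. if s = t then 1 else 0)"
      by (simp add: satisfies_relations_def no[symmetric])
    then have "eval_at (\<lambda>s. if s = t then 1 else 0) p = 0" using p I by (simp add: cubic_ideal_def)
    moreover have "eval_at (\<lambda>s. if s = t then 1 else 0) p = Poly_Mapping.lookup p t"
      by (subst eval_at_superset[of "insert t (Poly_Mapping.keys p)"])
        (auto simp: if_distrib[of "\<lambda>x. _ * x"] cong: if_cong)
    ultimately show ?thesis by simp
  next
    case False
    then show ?thesis using p by (auto simp: cubic_ideal_def in_keys_iff)
  qed
qed

lemma eval_at_graft: "eval_at f (lin_ext (\<lambda>s. lin_ext (\<lambda>t. mon (graft a t s)) q) p)
    = eval_at (\<lambda>t. eval_at (\<lambda>s. f (graft a t s)) p) q"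
  by (subst lin_ext_swap) (simp add: eval_at_lin_ext)

lemma keys_pcomp:
  assumes "composable I a K" "Poly_Mapping.keys p \<subseteq> monomials I" "Poly_Mapping.keys q \<subseteq> monomials K"
  shows "Poly_Mapping.keys (lin_ext (\<lambda>s. lin_ext (\<lambda>t. mon (graft a t s)) q) p) \<subseteq> monomials (I - {a} \<union> K)"
  using F.pcomp_closed[OF assms(1), of p q] assms(2,3) by (simp add: free_space free_pcomp)

lemma card_composable:
  assumes "composable I a K"
  shows "card (I - {a} \<union> K) + 1 = card I + card K"
proof -
  have "finite I" "finite K" "a \<in> I" "(I - {a}) \<inter> K = {}" using assms by (auto simp: composable_def)
  moreover from this have "card I > 0" using card_gt_0_iff by blast
  ultimately show ?thesis by (simp add: card_Un_disjoint card_Diff_singleton)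
qed

text \<open>Grafting into a fixed slot is a homomorphism of products, so functionals that satisfy
  the relations pull back to such functionals; this settles composition of something into an element
  of the ideal. For an element \<open>q\<close> of the ideal composed into \<open>p\<close>, with a
  result of arity at most three, either \<open>p\<close> has a single input and is a multiple of the
  unit, or \<open>q\<close> has arity at most two and vanishes.\<close>

lemma operadic_ideal_cubic: "operadic_ideal free_binary_operad (cubic_ideal \<delta>)"
  unfolding operadic_ideal_def op_subspace_def free_space free_vadd free_vscale free_relabel free_pcomp
proof (intro conjI allI impI ballI)
  fix I :: "nat set" assume "finite I"
  show "cubic_ideal \<delta> I \<subseteq> {p. Poly_Mapping.keys p \<subseteq> monomials I}" by (auto simp: cubic_ideal_def)
  have "(0 :: nonassoc_poly) \<in> cubic_ideal \<delta> I"
    by (auto simp: cubic_ideal_def intro: eval_at_zero)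
  then show "cubic_ideal \<delta> I \<noteq> {}" by blast
  fix p q c assume p: "p \<in> cubic_ideal \<delta> I"
  show "cscale c p \<in> cubic_ideal \<delta> I"
    using p keys_cscale[of c p] by (auto simp: cubic_ideal_def)
  assume q: "q \<in> cubic_ideal \<delta> I"
  show "p + q \<in> cubic_ideal \<delta> I"
    using p q keys_add[of p q] by (auto simp: cubic_ideal_def)
next
  fix I :: "nat set" and \<sigma> :: "nat \<Rightarrow> nat" and p assume *: "finite I \<and> inj_on \<sigma> I" and p: "p \<in> cubic_ideal \<delta> I"
  have "satisfies_relations \<delta> (\<lambda>t. f (map_monomial \<sigma> t))" if "satisfies_relations \<delta> f" for f
    using that by (simp add: satisfies_relations_def)
  moreover have "Poly_Mapping.keys (lin_ext (\<lambda>t. mon (map_monomial \<sigma> t)) p) \<subseteq> monomials (\<sigma> ` I)"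
    using p * by (intro keys_lin_ext) (auto simp: cubic_ideal_def map_in_monomials)
  moreover have "card (\<sigma> ` I) = card I" using * by (simp add: card_image)
  ultimately show "lin_ext (\<lambda>t. mon (map_monomial \<sigma> t)) p \<in> cubic_ideal \<delta> (\<sigma> ` I)"
    using p by (simp add: cubic_ideal_def eval_at_lin_ext)
next
  fix I a K p and q :: nonassoc_poly
  assume c: "composable I a K" and p: "p \<in> cubic_ideal \<delta> I" and "q \<in> {p. Poly_Mapping.keys p \<subseteq> monomials K}"
  then have q: "Poly_Mapping.keys q \<subseteq> monomials K" by simp
  have "eval_at f (lin_ext (\<lambda>s. lin_ext (\<lambda>t. mon (graft a t s)) q) p) = 0"
    if I: "card (I - {a} \<union> K) \<le> 3" and f: "satisfies_relations \<delta> f" for f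
  \<comment> \<open>Inserting an operation without inputs would lower the arity, so that
    \<open>card I\<close> could be four; but there are no monomials without variables.\<close>
  proof (cases "K = {}")
    case True
    then show ?thesis using q by (simp add: monomials_empty lin_ext_def eval_at_zero)
  next
    case False
    then have "card K > 0" using c by (simp add: composable_def card_gt_0_iff)
    then have "card I \<le> 3" using card_composable[OF c] I by linarith
    moreover have "satisfies_relations \<delta> (\<lambda>s. f (graft a t s))" for t using f by (simp add: satisfies_relations_def)
    ultimately show ?thesis using p by (simp add: eval_at_graft cubic_ideal_def eval_at_zero)
  qed
  then show "lin_ext (\<lambda>s. lin_ext (\<lambda>t. mon (graft a t s)) q) p \<in> cubic_ideal \<delta> (I - {a} \<union> K)"
    using keys_pcomp[OF c _ q, of p] p by (simp add: cubic_ideal_def)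
next
  fix I a K and p q :: nonassoc_poly
  assume c: "composable I a K" and "p \<in> {p. Poly_Mapping.keys p \<subseteq> monomials I}" and q: "q \<in> cubic_ideal \<delta> K"
  then have p: "Poly_Mapping.keys p \<subseteq> monomials I" by simp
  have a: "a \<in> I" "finite I" using c by (auto simp: composable_def)
  have "eval_at f (lin_ext (\<lambda>s. lin_ext (\<lambda>t. mon (graft a t s)) q) p) = 0"
    if I: "card (I - {a} \<union> K) \<le> 3" and f: "satisfies_relations \<delta> f" for f
  proof (cases "I = {a}")
    case True
    have "graft a t s = t" if "s \<in> Poly_Mapping.keys p" for s t
    proof -
      have "s \<in> monomials {a}" using that p True by auto
      then have "s = Var a"
      proof (cases s)
        case (Prod u v)
        then have "card (labels u) + card (labels v) = 1"
          using \<open>s \<in> monomials {a}\<close> labels_card_prod[of u v] by (simp add: monomials_def)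
        then show ?thesis using card_labels_pos[of u] card_labels_pos[of v] by linarith
      qed (auto simp: monomials_def)
      then show ?thesis by simp
    qed
    then have "eval_at f (lin_ext (\<lambda>s. lin_ext (\<lambda>t. mon (graft a t s)) q) p) = eval_at (\<lambda>s. eval_at f q) p"
      by (simp add: eval_at_lin_ext cong: eval_at_cong)
    moreover have "eval_at f q = 0"
      using q I f True by (simp add: cubic_ideal_def)
    ultimately show ?thesis by (simp add: eval_at_zero)
  next
    case False
    then have "card I \<ge> 2" using a by (metis Suc_leI card_gt_0_iff card_1_singletonE empty_iff numeral_2_eq_2 One_nat_def le_neq_implies_less singletonD)
    then have "card K \<le> 2" using card_composable[OF c] I by linarith
    then have "q = 0" using cubic_ideal_small q by blast
    then show ?thesis by (simp add: lin_ext_def eval_at_zero)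
  qed
  then show "lin_ext (\<lambda>s. lin_ext (\<lambda>t. mon (graft a t s)) q) p \<in> cubic_ideal \<delta> (I - {a} \<union> K)"
    using keys_pcomp[OF c p, of q] q by (simp add: cubic_ideal_def)
qed

lemma mn_ideal_cubic: "mn_ideal \<delta> I \<subseteq> cubic_ideal \<delta> I"
proof -
  have "sym_submodule free_binary_operad {1, 2, 3} (cubic_ideal \<delta> {1, 2, 3})"
    using operadic_ideal_cubic[of \<delta>] unfolding sym_submodule_def operadic_ideal_def bij_betw_def
    by (metis finite.emptyI finite_insert)
  moreover have "mock_novikov_identities \<delta> \<subseteq> cubic_ideal \<delta> {1, 2, 3}"
    using mock_novikov_identities_sub[of \<delta>]
    by (auto simp: cubic_ideal_def free_space mock_novikov_identities_def Let_def satisfies_relations_def)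
  ultimately have "mock_novikov_relations \<delta> \<subseteq> cubic_ideal \<delta> {1, 2, 3}"
    unfolding mock_novikov_relations_def sym_submodule_gen_def by blast
  then show ?thesis
    unfolding mn_ideal_def operadic_ideal_gen_def using operadic_ideal_cubic[of \<delta>] by auto
qed

section \<open>Trees with contracted edges\<close>

text \<open>
  The flag of a node is \<open>True\<close> if the edge below it is an edge of the tree (or the node is the root)
  and \<open>False\<close> if that edge is contracted.
\<close>

datatype (leaves: 'a) mtree = Leaf 'a | Node bool "'a mtree" "'a mtree"

primrec separated :: "'a mtree \<Rightarrow> bool" where
  "separated (Leaf a) \<longleftrightarrow> True"
| "separated (Node r s t) \<longleftrightarrow> separated s \<and> separated t \<and> leaves s \<inter> leaves t = {}"

primrec clades :: "'a mtree \<Rightarrow> 'a set set" where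
  "clades (Leaf a) = {}"
| "clades (Node r s t) = (if r then {leaves s \<union> leaves t} else {}) \<union> (clades s \<union> clades t)"

text \<open>As in \<open>inputs\<close>, an input of a vertex is named by the least leaf above it.\<close>

primrec collapse :: "nat mtree \<Rightarrow> nat monomial" where
  "collapse (Leaf a) = Var a"
| "collapse (Node r s t) = (if r then Var (Min (leaves s \<union> leaves t)) else collapse s \<odot> collapse t)"

text \<open>It is meaningful also at the leaf set of a tree whose root is contracted: inductions
  pass to such subtrees, where this monomial is the part of a lower vertex that lies in the subtree.
  The value at a leaf is chosen so that \<open>collapse_local\<close> covers leaves as well.\<close>

primrec local_monomial :: "nat mtree \<Rightarrow> nat set \<Rightarrow> nat monomial" where
  "local_monomial (Leaf a) A = Var a"
| "local_monomial (Node r s t) A = (if A = leaves s \<union> leaves t then collapse s \<odot> collapse t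
     else if A \<subseteq> leaves s then local_monomial s A else local_monomial t A)"

text \<open>Edges are listed in planar postorder, the one below the root last, and
  \<open>contractions\<close> runs parallel to this list. The \<open>inner_\<close> variants drop
  the edge below the root, which is not an internal edge of the tree.\<close>

primrec edges :: "'a mtree \<Rightarrow> 'a set list" where
  "edges (Leaf a) = []"
| "edges (Node r s t) = edges s @ edges t @ (if r then [leaves s \<union> leaves t] else [])"

primrec contractions :: "'a mtree \<Rightarrow> 'a mtree list" where
  "contractions (Leaf a) = []"
| "contractions (Node r s t) = map (\<lambda>s'. Node r s' t) (contractions s)
     @ map (\<lambda>t'. Node r s t') (contractions t) @ (if r then [Node False s t] else [])"

primrec inner_edges :: "'a mtree \<Rightarrow> 'a set list" where
  "inner_edges (Leaf a) = []"
| "inner_edges (Node r s t) = edges s @ edges t"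

primrec inner_contractions :: "'a mtree \<Rightarrow> 'a mtree list" where
  "inner_contractions (Leaf a) = []"
| "inner_contractions (Node r s t) = map (\<lambda>s'. Node r s' t) (contractions s)
     @ map (\<lambda>t'. Node r s t') (contractions t)"

primrec weight :: "'a mtree \<Rightarrow> nat" where
  "weight (Leaf a) = 0"
| "weight (Node r s t) = weight s + weight t + (if r then 1 else 0)"

primrec contracted :: "'a mtree \<Rightarrow> nat" where
  "contracted (Leaf a) = 0"
| "contracted (Node r s t) = contracted s + contracted t + (if r then 0 else 1)"

section \<open>Clades form a laminar family\<close>

lemma finite_leaves [simp]: "finite (leaves \<tau>)"
  by (induction \<tau>) auto

lemma leaves_nonempty [simp]: "leaves \<tau> \<noteq> {}"
  by (induction \<tau>) auto

lemma clades_sub: "B \<in> clades \<tau> \<Longrightarrow> B \<subseteq> leaves \<tau>"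
  by (induction \<tau>) (auto split: if_splits)

lemma clades_nonempty: "B \<in> clades \<tau> \<Longrightarrow> B \<noteq> {}"
  by (induction \<tau>) (auto split: if_splits)

lemma finite_clade: "B \<in> clades \<tau> \<Longrightarrow> finite B"
  using clades_sub finite_leaves finite_subset by blast

lemma clades_card: "separated \<tau> \<Longrightarrow> B \<in> clades \<tau> \<Longrightarrow> 2 \<le> card B"
proof (induction \<tau>)
  case (Node r s t)
  have "card (leaves s) \<ge> 1" "card (leaves t) \<ge> 1" by (simp_all add: Suc_le_eq card_gt_0_iff)
  then have "2 \<le> card (leaves s \<union> leaves t)"
    using Node.prems(1) by (simp add: card_Un_disjoint)
  then show ?case using Node by (auto split: if_splits)
qed simp

lemma clades_proper:
  assumes "separated (Node r s t)"
  shows "B \<in> clades s \<Longrightarrow> B \<subset> leaves s \<union> leaves t" "B \<in> clades t \<Longrightarrow> B \<subset> leaves s \<union> leaves t"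
  using assms clades_sub[of B s] clades_sub[of B t] leaves_nonempty[of s] leaves_nonempty[of t]
  by (auto simp del: leaves_nonempty)

lemma clades_disjoint:
  assumes "leaves s \<inter> leaves t = {}" "B \<in> clades s" "C \<in> clades t"
  shows "B \<inter> C = {}" "B \<noteq> C" "\<not> B \<subseteq> C" "\<not> C \<subseteq> B" "\<not> C \<subseteq> leaves s" "\<not> B \<subseteq> leaves t"
proof -
  have "B \<subseteq> leaves s" "C \<subseteq> leaves t" "B \<noteq> {}" "C \<noteq> {}"
    using assms clades_sub clades_nonempty by blast+
  then show "B \<inter> C = {}" "B \<noteq> C" "\<not> B \<subseteq> C" "\<not> C \<subseteq> B" "\<not> C \<subseteq> leaves s" "\<not> B \<subseteq> leaves t"
    using assms(1) by blast+
qed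

lemma clades_foreign:
  assumes "leaves s \<inter> leaves t = {}"
  shows "x \<in> leaves s \<Longrightarrow> B \<in> clades t \<Longrightarrow> x \<notin> B" "x \<in> leaves t \<Longrightarrow> B \<in> clades s \<Longrightarrow> x \<notin> B"
  using assms clades_sub[of B s] clades_sub[of B t] by blast+

lemma clades_laminar:
  "separated \<tau> \<Longrightarrow> A \<in> clades \<tau> \<Longrightarrow> B \<in> clades \<tau> \<Longrightarrow> A \<subseteq> B \<or> B \<subseteq> A \<or> A \<inter> B = {}"
proof (induction \<tau>)
  case (Node r s t)
  show ?case
  proof (cases "A = leaves s \<union> leaves t \<or> B = leaves s \<union> leaves t")
    case True
    then show ?thesis using clades_sub[of A "Node r s t"] clades_sub[of B "Node r s t"] Node.prems by auto
  next
    case False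
    then have "A \<in> clades s \<union> clades t" "B \<in> clades s \<union> clades t"
      using Node.prems by (auto split: if_splits)
    then consider "A \<in> clades s" "B \<in> clades s" | "A \<in> clades t" "B \<in> clades t"
      | "A \<inter> B = {}"
      using clades_disjoint(1)[of s t A B] clades_disjoint(1)[of s t B A] Node.prems(1) by auto
    then show ?thesis using Node by cases auto
  qed
qed simp

lemma set_edges: "set (edges \<tau>) = clades \<tau>"
  by (induction \<tau>) auto

lemma distinct_edges: "separated \<tau> \<Longrightarrow> distinct (edges \<tau>)"
proof (induction \<tau>)
  case (Node r s t)
  have "clades s \<inter> clades t = {}" using clades_disjoint(2)[of s t] Node.prems by auto
  moreover have "leaves s \<union> leaves t \<notin> clades s" "leaves s \<union> leaves t \<notin> clades t"
    using clades_proper[OF Node.prems] by blast+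
  ultimately show ?case using Node by (auto simp: set_edges)
qed simp

lemma length_edges: "length (edges \<tau>) = weight \<tau>"
  by (induction \<tau>) auto

lemma length_contractions: "length (contractions \<tau>) = weight \<tau>"
  by (induction \<tau>) auto

lemma card_clades: "separated \<tau> \<Longrightarrow> card (clades \<tau>) = weight \<tau>"
  using distinct_card[OF distinct_edges] by (simp add: set_edges length_edges)

lemma weight_contracted: "separated \<tau> \<Longrightarrow> weight \<tau> + contracted \<tau> + 1 = card (leaves \<tau>)"
  by (induction \<tau>) (auto simp: card_Un_disjoint)

section \<open>Inputs of a vertex and the labels of its monomial\<close>

lemma labels_collapse_sub: "labels (collapse \<tau>) \<subseteq> leaves \<tau>"
proof (induction \<tau>)
  case (Node r s t)
  have "Min (leaves s \<union> leaves t) \<in> leaves s \<union> leaves t" by (rule Min_in) auto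
  then show ?case using Node by auto
qed simp

lemma multilinear_collapse: "separated \<tau> \<Longrightarrow> multilinear (collapse \<tau>)"
  by (induction \<tau>) (use labels_collapse_sub in fastforce)+

text \<open>At a real node, every clade above it that contains the overall minimum has this same
  minimum. So the least leaf, and no other one, survives as an input.\<close>

lemma labels_collapse:
  "separated \<tau> \<Longrightarrow> labels (collapse \<tau>) = {x \<in> leaves \<tau>. \<forall>B\<in>clades \<tau>. x \<in> B \<longrightarrow> x = Min B}"
proof (induction \<tau>)
  case (Node r s t)
  show ?case
  proof (cases r)
    case True
    let ?L = "leaves s \<union> leaves t"
    have "Min ?L \<in> ?L" by (rule Min_in) auto
    moreover have "Min ?L = Min B" if "B \<in> clades s \<union> clades t" "Min ?L \<in> B" for B
    proof -
      have "B \<subseteq> ?L" using that clades_sub[of B s] clades_sub[of B t] by auto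
      then show ?thesis using that(2) by (intro Min_eqI[symmetric]) (auto intro: Min_le finite_subset)
    qed
    ultimately show ?thesis using True by auto
  next
    case False
    have "labels (collapse (Node r s t)) = {x \<in> leaves s. \<forall>B\<in>clades s. x \<in> B \<longrightarrow> x = Min B}
        \<union> {x \<in> leaves t. \<forall>B\<in>clades t. x \<in> B \<longrightarrow> x = Min B}"
      using False Node by simp
    also have "\<dots> = {x \<in> leaves s \<union> leaves t. \<forall>B\<in>clades s \<union> clades t. x \<in> B \<longrightarrow> x = Min B}"
      using Node.prems by (auto dest: clades_foreign[of s t])
    finally show ?thesis using False by simp
  qed
qed simp

lemma inputs_cong: "(\<And>B. B \<subset> A \<Longrightarrow> B \<in> H \<longleftrightarrow> B \<in> H') \<Longrightarrow> inputs H A = inputs H' A"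
  by (auto simp: inputs_def)

lemma labels_local:
  "separated \<tau> \<Longrightarrow> A \<in> clades \<tau> \<Longrightarrow> labels (local_monomial \<tau> A) = inputs (clades \<tau>) A"
proof (induction \<tau>)
  case (Node r s t)
  let ?L = "leaves s \<union> leaves t"
  note sep = Node.prems(1)
  consider "A = ?L" | "A \<in> clades s" | "A \<in> clades t" using Node.prems by (auto split: if_splits)
  then show ?case
  proof cases
    case 1
    have "labels (local_monomial (Node r s t) A) = {x \<in> leaves s. \<forall>B\<in>clades s. x \<in> B \<longrightarrow> x = Min B}
        \<union> {x \<in> leaves t. \<forall>B\<in>clades t. x \<in> B \<longrightarrow> x = Min B}"
      using 1 sep by (simp add: labels_collapse)
    also have "\<dots> = {x \<in> ?L. \<forall>B\<in>clades s \<union> clades t. x \<in> B \<longrightarrow> x = Min B}"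
      using sep by (auto dest: clades_foreign[of s t])
    also have "\<dots> = inputs (clades (Node r s t)) A"
    proof -
      have "(\<forall>B\<in>clades s \<union> clades t. x \<in> B \<longrightarrow> x = Min B)
          \<longleftrightarrow> (\<forall>B\<in>clades (Node r s t). B \<subset> ?L \<and> x \<in> B \<longrightarrow> x = Min B)" for x
      proof
        assume "\<forall>B\<in>clades s \<union> clades t. x \<in> B \<longrightarrow> x = Min B"
        then show "\<forall>B\<in>clades (Node r s t). B \<subset> ?L \<and> x \<in> B \<longrightarrow> x = Min B"
          by (auto split: if_splits)
      next
        assume *: "\<forall>B\<in>clades (Node r s t). B \<subset> ?L \<and> x \<in> B \<longrightarrow> x = Min B"
        show "\<forall>B\<in>clades s \<union> clades t. x \<in> B \<longrightarrow> x = Min B"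
        proof (intro ballI impI)
          fix B assume "B \<in> clades s \<union> clades t" "x \<in> B"
          then show "x = Min B" using bspec[OF *, of B] clades_proper[OF sep, of B] by auto
        qed
      qed
      then show ?thesis by (simp add: inputs_def 1)
    qed
    finally show ?thesis .
  next
    case 2
    have "inputs (clades (Node r s t)) A = inputs (clades s) A"
      by (rule inputs_cong) (use 2 clades_proper(1)[OF sep 2] clades_disjoint[of s t A] sep clades_disjoint(5)[of s t]
        clades_sub[OF 2] in \<open>auto split: if_splits\<close>)
    then show ?thesis using 2 Node clades_proper(1)[OF sep 2] clades_sub[OF 2] by auto
  next
    case 3
    have "inputs (clades (Node r s t)) A = inputs (clades t) A"
      by (rule inputs_cong) (use 3 clades_proper(2)[OF sep 3] clades_disjoint(6)[of s t] sep
        clades_sub[OF 3] in \<open>auto split: if_splits\<close>)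
    then show ?thesis
      using 3 Node clades_proper(2)[OF sep 3] clades_disjoint(5)[of s t _ A] sep clades_sub[OF 3]
        clades_nonempty[OF 3] by auto
  qed
qed simp

lemma multilinear_local: "separated \<tau> \<Longrightarrow> multilinear (local_monomial \<tau> A)"
proof (induction \<tau>)
  case (Node r s t)
  then show ?case
    using multilinear_collapse labels_collapse_sub[of s] labels_collapse_sub[of t] by auto
qed simp

lemma local_monomials: "separated \<tau> \<Longrightarrow> A \<in> clades \<tau> \<Longrightarrow> local_monomial \<tau> A \<in> monomials (inputs (clades \<tau>) A)"
  by (simp add: monomials_def labels_local multilinear_local)

section \<open>Contraction of an edge as grafting at the vertex below it\<close>

lemma edges_contractions:
  assumes "separated \<tau>" "(B, \<tau>') \<in> set (zip (edges \<tau>) (contractions \<tau>))"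
  shows "leaves \<tau>' = leaves \<tau>" "separated \<tau>'" "clades \<tau>' = clades \<tau> - {B}" "B \<in> clades \<tau>"
    "weight \<tau>' + 1 = weight \<tau>"
proof -
  have "leaves \<tau>' = leaves \<tau> \<and> separated \<tau>' \<and> clades \<tau>' = clades \<tau> - {B} \<and> B \<in> clades \<tau> \<and> weight \<tau>' + 1 = weight \<tau>"
    using assms
  proof (induction \<tau> arbitrary: \<tau>')
    case (Node r s t)
    note sep = Node.prems(1)
    consider s' where "(B, s') \<in> set (zip (edges s) (contractions s))" "\<tau>' = Node r s' t"
      | t' where "(B, t') \<in> set (zip (edges t) (contractions t))" "\<tau>' = Node r s t'"
      | "r" "B = leaves s \<union> leaves t" "\<tau>' = Node False s t"
      using Node.prems(2) by (auto simp: length_edges length_contractions zip_map2 split: if_splits)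
    then show ?case
    proof cases
      case 1
      then have IH: "leaves s' = leaves s" "separated s'" "clades s' = clades s - {B}" "B \<in> clades s"
        "weight s' + 1 = weight s" using Node.IH(1)[of s'] sep by simp_all
      moreover have "B \<noteq> leaves s \<union> leaves t" "B \<notin> clades t"
        using clades_proper(1)[OF sep IH(4)] clades_disjoint(2)[of s t B B] IH(4) sep by auto
      ultimately show ?thesis using 1 sep by auto
    next
      case 2
      then have IH: "leaves t' = leaves t" "separated t'" "clades t' = clades t - {B}" "B \<in> clades t"
        "weight t' + 1 = weight t" using Node.IH(2)[of t'] sep by simp_all
      moreover have "B \<noteq> leaves s \<union> leaves t" "B \<notin> clades s"
        using clades_proper(2)[OF sep IH(4)] clades_disjoint(2)[of s t B B] IH(4) sep by auto
      ultimately show ?thesis using 2 sep by auto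
    next
      case 3
      then show ?thesis using sep clades_proper[OF sep] by auto
    qed
  qed simp
  then show "leaves \<tau>' = leaves \<tau>" "separated \<tau>'" "clades \<tau>' = clades \<tau> - {B}" "B \<in> clades \<tau>"
    "weight \<tau>' + 1 = weight \<tau>" by auto
qed

lemma leaves_contractions: "\<tau>' \<in> set (contractions \<tau>) \<Longrightarrow> leaves \<tau>' = leaves \<tau>"
  by (induction \<tau> arbitrary: \<tau>') (auto split: if_splits)

lemma leaves_contractions_nth: "j < weight \<tau> \<Longrightarrow> leaves (contractions \<tau> ! j) = leaves \<tau>"
  by (rule leaves_contractions) (simp add: length_contractions)

lemma edges_contractions_nth:
  "j < weight \<tau> \<Longrightarrow> edges (contractions \<tau> ! j) = take j (edges \<tau>) @ drop (Suc j) (edges \<tau>)"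
proof (induction \<tau> arbitrary: j)
  case (Node r s t)
  consider "j < weight s" | i where "j = weight s + i" "i < weight t" | "r" "j = weight s + weight t"
    using Node.prems by (force simp: not_less le_iff_add split: if_splits)
  then show ?case
    by cases (use Node.IH in \<open>simp_all add: nth_append length_edges length_contractions leaves_contractions_nth Suc_diff_le\<close>)
qed simp

lemma inner_contractions_nth:
  "j < length (inner_edges \<tau>) \<Longrightarrow>
    inner_edges (inner_contractions \<tau> ! j) = take j (inner_edges \<tau>) @ drop (Suc j) (inner_edges \<tau>)"
proof (cases \<tau>)
  case (Node r s t)
  assume "j < length (inner_edges \<tau>)"
  then consider "j < weight s" | i where "j = weight s + i" "i < weight t"
    using Node by (force simp: not_less le_iff_add length_edges)
  then show ?thesis
    by cases (use Node in \<open>simp_all add: nth_append length_edges length_contractions edges_contractions_nth Suc_diff_le\<close>)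
qed simp

lemma contraction_root:
  assumes "separated \<tau>" "(leaves \<tau>, \<tau>') \<in> set (zip (edges \<tau>) (contractions \<tau>))"
  obtains s t where "\<tau> = Node True s t" "\<tau>' = Node False s t"
proof (cases \<tau>)
  case (Node r s t)
  have "(leaves \<tau>, x) \<notin> set (zip (edges s) (contractions s))" "(leaves \<tau>, x) \<notin> set (zip (edges t) (contractions t))" for x
    using clades_proper[of r s t "leaves \<tau>"] assms(1) Node set_zip_leftD by (fastforce simp: set_edges)+
  then show ?thesis
    using assms(2) Node that
    by (auto simp: length_edges length_contractions zip_map2 split: if_splits)
qed (use assms in simp)

lemma contraction_cases:
  assumes "(B, \<tau>') \<in> set (zip (edges (Node r s t)) (contractions (Node r s t)))" "B \<noteq> leaves (Node r s t)"
  obtains s' where "(B, s') \<in> set (zip (edges s) (contractions s))" "\<tau>' = Node r s' t"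
  | t' where "(B, t') \<in> set (zip (edges t) (contractions t))" "\<tau>' = Node r s t'"
  using assms by (auto simp: length_edges length_contractions zip_map2 split: if_splits)

lemma contraction_flag:
  assumes "(B, \<tau>') \<in> set (zip (edges \<tau>) (contractions \<tau>))" "B \<noteq> leaves \<tau>"
  obtains q s t s' t' where "\<tau> = Node q s t" "\<tau>' = Node q s' t'"
proof (cases \<tau>)
  case (Node q s t)
  from assms[unfolded Node] show ?thesis
    by (cases rule: contraction_cases) (use Node that in auto)
qed (use assms in simp)

lemma local_flag: "local_monomial (Node r s t) = local_monomial (Node r' s t)"
  by (rule ext) simp

lemma Min_leaves_in: "B \<in> clades \<tau> \<Longrightarrow> Min B \<in> leaves \<tau>"
  using Min_in[OF finite_clade clades_nonempty, of B \<tau> \<tau>] clades_sub by blast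

lemma local_contraction:
  assumes "separated \<tau>" "(B, \<tau>') \<in> set (zip (edges \<tau>) (contractions \<tau>))" "B \<noteq> leaves \<tau>"
  shows "\<exists>A\<in>insert (leaves \<tau>) (clades \<tau>). B \<subset> A \<and> (\<forall>C\<in>clades \<tau>. B \<subset> C \<longrightarrow> A \<subseteq> C)
    \<and> local_monomial \<tau>' A = graft (Min B) (local_monomial \<tau> B) (local_monomial \<tau> A)
    \<and> (\<forall>C\<in>insert (leaves \<tau>) (clades \<tau>) - {A, B}. local_monomial \<tau>' C = local_monomial \<tau> C)"
  using assms
proof (induction \<tau> arbitrary: \<tau>')
  case (Node r s t)
  let ?L = "leaves s \<union> leaves t"
  note sep = Node.prems(1)
  have dis: "leaves s \<inter> leaves t = {}" "separated s" "separated t" using sep by auto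
  have clade_cases: "C = ?L \<or> C \<in> clades s \<or> C \<in> clades t" if "C \<in> clades (Node r s t)" for C
    using that by (auto split: if_splits)
  have loc_s: "local_monomial (Node q s' t') C = local_monomial s' C"
    if "C \<in> clades s" "leaves s' = leaves s" "leaves t' = leaves t" for C q s' t'
    using clades_proper(1)[OF sep that(1)] clades_sub[OF that(1)] that by auto
  have loc_t: "local_monomial (Node q s' t') C = local_monomial t' C"
    if "C \<in> clades t" "leaves s' = leaves s" "leaves t' = leaves t" for C q s' t'
    using clades_proper(2)[OF sep that(1)] clades_sub[OF that(1)] clades_nonempty[OF that(1)] that dis(1) by auto
  have others: "local_monomial (Node r s' t') C = local_monomial (Node r s t) C"
    if C: "C \<in> insert ?L (clades (Node r s t))" and "leaves s' = leaves s" "leaves t' = leaves t"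
      "C = ?L \<Longrightarrow> collapse s' \<odot> collapse t' = collapse s \<odot> collapse t"
      "C \<in> clades s \<Longrightarrow> local_monomial s' C = local_monomial s C"
      "C \<in> clades t \<Longrightarrow> local_monomial t' C = local_monomial t C" for C s' t'
  proof -
    consider "C = ?L" | "C \<in> clades s" | "C \<in> clades t" using clade_cases[of C] C by blast
    then show ?thesis
      by cases (use that loc_s[of C s' t' r] loc_s[of C s t r] loc_t[of C s' t' r] loc_t[of C s t r] in simp_all)
  qed
  from Node.prems(2,3) show ?case
  proof (cases rule: contraction_cases)
    case (1 s')
    note e = edges_contractions[OF dis(2) 1(1)]
    have Bs: "B \<subseteq> leaves s" "B \<subset> ?L" "Min B \<notin> leaves t"
      using clades_sub[OF e(4)] clades_proper(1)[OF sep e(4)] Min_leaves_in[OF e(4)] dis(1) by auto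
    have Bt: "\<not> B \<subseteq> C" if "C \<in> clades t" for C
      using clades_disjoint(3)[OF dis(1) e(4) that] .
    have gr: "graft (Min B) x (collapse t) = collapse t" for x
      using Bs(3) labels_collapse_sub[of t] by (intro graft_absent) auto
    show ?thesis
    \<comment> \<open>Here the edge joins \<open>s\<close> to the node itself, so the vertex below
      it is the one at the node.\<close>
    proof (cases "B = leaves s")
      case True
      then obtain s1 s2 where s12: "s = Node True s1 s2" "s' = Node False s1 s2"
        using contraction_root[OF dis(2)] 1(1) by metis
      have "local_monomial \<tau>' ?L = graft (Min B) (local_monomial (Node r s t) B) (local_monomial (Node r s t) ?L)"
        using 1(2) s12 True Bs(2) gr by auto
      moreover have "?L \<subseteq> C" if "C \<in> clades (Node r s t)" "B \<subset> C" for C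
        using clade_cases[OF that(1)] that(2) True clades_sub[of C s] Bt by auto
      moreover have "local_monomial \<tau>' C = local_monomial (Node r s t) C"
        if "C \<in> insert ?L (clades (Node r s t)) - {?L, B}" for C
      proof -
        have "C \<in> clades s \<or> C \<in> clades t" using clade_cases[of C] that by auto
        then show ?thesis
          using loc_s[of C s t] loc_s[of C s' t] loc_t[of C s t] loc_t[of C s' t] 1(2) e(1) s12
            local_flag[of True s1 s2 False] by metis
      qed
      ultimately show ?thesis using Bs(2) by auto
    next
      case False
      from Node.IH(1)[OF dis(2) 1(1) False] obtain A where A0: "A \<in> insert (leaves s) (clades s)"
        "B \<subset> A" "\<forall>C\<in>clades s. B \<subset> C \<longrightarrow> A \<subseteq> C"
        "local_monomial s' A = graft (Min B) (local_monomial s B) (local_monomial s A)"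
        "\<forall>C\<in>insert (leaves s) (clades s) - {A, B}. local_monomial s' C = local_monomial s C"
        by (elim bexE conjE)
      have A: "A = leaves s \<or> A \<in> clades s" "B \<subset> A" "\<And>C. C \<in> clades s \<Longrightarrow> B \<subset> C \<Longrightarrow> A \<subseteq> C"
        "local_monomial s' A = graft (Min B) (local_monomial s B) (local_monomial s A)"
        "\<And>C. C = leaves s \<or> C \<in> clades s \<Longrightarrow> C \<noteq> A \<Longrightarrow> C \<noteq> B \<Longrightarrow> local_monomial s' C = local_monomial s C"
        using A0(1) apply (simp only: insert_iff)
        using A0(2) apply assumption
        using A0(3) apply blast
        using A0(4) apply assumption
        using A0(5) by blast
      obtain q s1 s2 s1' s2' where s12: "s = Node q s1 s2" "s' = Node q s1' s2'"
        using contraction_flag[OF 1(1) False] by metis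
      have lv: "leaves s1' \<union> leaves s2' = leaves s" using e(1) s12 by simp
      show ?thesis
      \<comment> \<open>Otherwise the root of \<open>s\<close> is contracted and \<open>A\<close> is
        its leaf set: then \<open>A\<close> is not a clade, and the lower vertex extends to the
        node, where its leaf set is \<open>?L\<close>.\<close>
      proof (cases "q \<or> A \<noteq> leaves s")
        case True
        then have A': "A \<in> clades s" using A(1) s12 by auto
        have "collapse s' = collapse s"
        proof (cases q)
          case False
          then have "local_monomial s' (leaves s) = local_monomial s (leaves s)"
            using A(5)[of "leaves s"] True \<open>B \<noteq> leaves s\<close> by auto
          then show ?thesis using s12 False lv by simp
        qed (use s12 lv in auto)
        then have "local_monomial \<tau>' C = local_monomial (Node r s t) C"
          if "C \<in> insert ?L (clades (Node r s t)) - {A, B}" for C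
          unfolding \<open>\<tau>' = Node r s' t\<close> using that e(1)
          by (intro others) (simp_all add: A(5))
        moreover have "local_monomial \<tau>' A
            = graft (Min B) (local_monomial (Node r s t) B) (local_monomial (Node r s t) A)"
          using A(4) loc_s[OF A', of s' t r] loc_s[OF A', of s t r] loc_s[OF e(4), of s t r] e(1) 1(2) by simp
        moreover have "A \<subseteq> C" if "C \<in> clades (Node r s t)" "B \<subset> C" for C
          using clade_cases[OF that(1)] that(2) A(3) Bt[of C] clades_sub[OF A'] by auto
        ultimately show ?thesis using A' A(2) by (intro bexI[of _ A]) auto
      next
        case q: False
        then have cuts: "collapse s' = local_monomial s' (leaves s)" "collapse s = local_monomial s (leaves s)"
          "leaves s \<notin> clades s"
          using s12 lv clades_proper[of q s1 s2] dis(2) by auto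
        have "local_monomial \<tau>' ?L = graft (Min B) (local_monomial (Node r s t) B) (local_monomial (Node r s t) ?L)"
          using A(4) q cuts gr loc_s[OF e(4), of s t r] 1(2) e(1) by auto
        moreover have "?L \<subseteq> C" if "C \<in> clades (Node r s t)" "B \<subset> C" for C
          using clade_cases[OF that(1)] that(2) q A(3)[of C] clades_sub[of C s] cuts(3) Bt[of C] by auto
        moreover have "local_monomial \<tau>' C = local_monomial (Node r s t) C"
          if "C \<in> insert ?L (clades (Node r s t)) - {?L, B}" for C
          unfolding \<open>\<tau>' = Node r s' t\<close> using that e(1) q cuts(3)
          by (intro others) (auto intro!: A(5))
        ultimately show ?thesis using Bs(2) by auto
      qed
    qed
  next
    case (2 t')
    note e = edges_contractions[OF dis(3) 2(1)]
    have Bs: "B \<subseteq> leaves t" "B \<subset> ?L" "Min B \<notin> leaves s" "\<not> B \<subseteq> leaves s"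
      using clades_sub[OF e(4)] clades_proper(2)[OF sep e(4)] Min_leaves_in[OF e(4)] dis(1)
        clades_nonempty[OF e(4)] by auto
    have Bt: "\<not> B \<subseteq> C" if "C \<in> clades s" for C
      using clades_disjoint(4)[OF dis(1) that e(4)] .
    have gr: "graft (Min B) x (collapse s) = collapse s" for x
      using Bs(3) labels_collapse_sub[of s] by (intro graft_absent) auto
    show ?thesis
    proof (cases "B = leaves t")
      case True
      then obtain t1 t2 where t12: "t = Node True t1 t2" "t' = Node False t1 t2"
        using contraction_root[OF dis(3)] 2(1) by metis
      have "local_monomial \<tau>' ?L = graft (Min B) (local_monomial (Node r s t) B) (local_monomial (Node r s t) ?L)"
        using 2(2) t12 True Bs(2,4) gr by auto
      moreover have "?L \<subseteq> C" if "C \<in> clades (Node r s t)" "B \<subset> C" for C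
        using clade_cases[OF that(1)] that(2) True clades_sub[of C t] Bt by auto
      moreover have "local_monomial \<tau>' C = local_monomial (Node r s t) C"
        if "C \<in> insert ?L (clades (Node r s t)) - {?L, B}" for C
      proof -
        have "C \<in> clades s \<or> C \<in> clades t" using clade_cases[of C] that by auto
        then show ?thesis
          using loc_s[of C s t] loc_s[of C s t'] loc_t[of C s t] loc_t[of C s t'] 2(2) e(1) t12
            local_flag[of True t1 t2 False] by metis
      qed
      ultimately show ?thesis using Bs(2) by auto
    next
      case False
      from Node.IH(2)[OF dis(3) 2(1) False] obtain A where A0: "A \<in> insert (leaves t) (clades t)"
        "B \<subset> A" "\<forall>C\<in>clades t. B \<subset> C \<longrightarrow> A \<subseteq> C"
        "local_monomial t' A = graft (Min B) (local_monomial t B) (local_monomial t A)"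
        "\<forall>C\<in>insert (leaves t) (clades t) - {A, B}. local_monomial t' C = local_monomial t C"
        by (elim bexE conjE)
      have A: "A = leaves t \<or> A \<in> clades t" "B \<subset> A" "\<And>C. C \<in> clades t \<Longrightarrow> B \<subset> C \<Longrightarrow> A \<subseteq> C"
        "local_monomial t' A = graft (Min B) (local_monomial t B) (local_monomial t A)"
        "\<And>C. C = leaves t \<or> C \<in> clades t \<Longrightarrow> C \<noteq> A \<Longrightarrow> C \<noteq> B \<Longrightarrow> local_monomial t' C = local_monomial t C"
        using A0(1) apply (simp only: insert_iff)
        using A0(2) apply assumption
        using A0(3) apply blast
        using A0(4) apply assumption
        using A0(5) by blast
      obtain q t1 t2 t1' t2' where t12: "t = Node q t1 t2" "t' = Node q t1' t2'"
        using contraction_flag[OF 2(1) False] by metis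
      have lv: "leaves t1' \<union> leaves t2' = leaves t" using e(1) t12 by simp
      show ?thesis
      proof (cases "q \<or> A \<noteq> leaves t")
        case True
        then have A': "A \<in> clades t" using A(1) t12 by auto
        have "collapse t' = collapse t"
        proof (cases q)
          case False
          then have "local_monomial t' (leaves t) = local_monomial t (leaves t)"
            using A(5)[of "leaves t"] True \<open>B \<noteq> leaves t\<close> by auto
          then show ?thesis using t12 False lv by simp
        qed (use t12 lv in auto)
        then have "local_monomial \<tau>' C = local_monomial (Node r s t) C"
          if "C \<in> insert ?L (clades (Node r s t)) - {A, B}" for C
          unfolding \<open>\<tau>' = Node r s t'\<close> using that e(1)
          by (intro others) (simp_all add: A(5))
        moreover have "local_monomial \<tau>' A
            = graft (Min B) (local_monomial (Node r s t) B) (local_monomial (Node r s t) A)"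
          using A(4) loc_t[OF A', of s t' r] loc_t[OF A', of s t r] loc_t[OF e(4), of s t r] e(1) 2(2) by simp
        moreover have "A \<subseteq> C" if "C \<in> clades (Node r s t)" "B \<subset> C" for C
          using clade_cases[OF that(1)] that(2) A(3) Bt[of C] clades_sub[OF A'] by auto
        ultimately show ?thesis using A' A(2) by (intro bexI[of _ A]) auto
      next
        case q: False
        then have cuts: "collapse t' = local_monomial t' (leaves t)" "collapse t = local_monomial t (leaves t)"
          "leaves t \<notin> clades t"
          using t12 lv clades_proper[of q t1 t2] dis(3) by auto
        have "local_monomial \<tau>' ?L = graft (Min B) (local_monomial (Node r s t) B) (local_monomial (Node r s t) ?L)"
          using A(4) q cuts gr loc_t[OF e(4), of s t r] 2(2) e(1) by auto
        moreover have "?L \<subseteq> C" if "C \<in> clades (Node r s t)" "B \<subset> C" for C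
          using clade_cases[OF that(1)] that(2) q A(3)[of C] clades_sub[of C t] cuts(3) Bt[of C] by auto
        moreover have "local_monomial \<tau>' C = local_monomial (Node r s t) C"
          if "C \<in> insert ?L (clades (Node r s t)) - {?L, B}" for C
          unfolding \<open>\<tau>' = Node r s t'\<close> using that e(1) q cuts(3)
          by (intro others) (auto intro!: A(5))
        ultimately show ?thesis using Bs(2) by auto
      qed
    qed
  qed
qed simp

abbreviation ideal_coset :: "complex \<Rightarrow> nat set \<Rightarrow> nonassoc_poly \<Rightarrow> nonassoc_poly set" where
  "ideal_coset \<delta> \<equiv> op_coset free_binary_operad (mn_ideal \<delta>)"

section \<open>The cobar differential on decorated trees\<close>

definition decor :: "complex \<Rightarrow> nat mtree \<Rightarrow> nat set \<Rightarrow> nonassoc_poly set" where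
  "decor \<delta> \<tau> = restrict (\<lambda>A. ideal_coset \<delta> (inputs (clades \<tau>) A) (mon (local_monomial \<tau> A))) (clades \<tau>)"

definition marked_tree :: "nat \<Rightarrow> nat mtree \<Rightarrow> bool" where
  "marked_tree n \<tau> \<longleftrightarrow> separated \<tau> \<and> leaves \<tau> = {1..n} \<and> (\<exists>s t. \<tau> = Node True s t)"

lemma marked_tree_root: "marked_tree n \<tau> \<Longrightarrow> {1..n} \<in> clades \<tau>"
  by (auto simp: marked_tree_def)

lemma marked_tree_reduced: "marked_tree n \<tau> \<Longrightarrow> reduced_tree n (clades \<tau>)"
  using marked_tree_root clades_sub clades_card clades_laminar
  unfolding reduced_tree_def marked_tree_def by metis

lemma finite_inputs: "A \<in> clades \<tau> \<Longrightarrow> finite (inputs (clades \<tau>) A)"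
  using finite_clade[of A \<tau>] by (simp add: inputs_def)

lemma decor_decorations: "separated \<tau> \<Longrightarrow> decor \<delta> \<tau> \<in> decorations (mock_novikov_operad \<delta>) (clades \<tau>)"
  by (auto simp: decor_def decorations_def mock_novikov_operad_eq M.Q_space mon_space local_monomials)

text \<open>By laminarity and minimality of \<open>A\<close>, every clade properly inside
  \<open>A\<close> that contains \<open>Min B\<close> lies in \<open>B\<close>, and so has the
  minimum \<open>Min B\<close>. Hence \<open>Min B\<close> names an input of \<open>A\<close>, and
  this is the slot into which \<open>contract\<close> composes.\<close>

lemma contraction_lower:
  assumes \<tau>: "marked_tree n \<tau>" and B: "(B, \<tau>') \<in> set (zip (edges \<tau>) (contractions \<tau>))" "B \<noteq> {1..n}"
  obtains A where "A \<in> clades \<tau>" "A \<noteq> B" "lower_vertex (clades \<tau>) B = A"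
    "composable (inputs (clades \<tau>) A) (Min B) (inputs (clades \<tau>) B)"
    "inputs (clades \<tau>') A = inputs (clades \<tau>) A - {Min B} \<union> inputs (clades \<tau>) B"
    "local_monomial \<tau>' A = graft (Min B) (local_monomial \<tau> B) (local_monomial \<tau> A)"
    "\<And>C. C \<in> clades \<tau> - {A, B} \<Longrightarrow> inputs (clades \<tau>') C = inputs (clades \<tau>) C"
    "\<And>C. C \<in> clades \<tau> - {A, B} \<Longrightarrow> local_monomial \<tau>' C = local_monomial \<tau> C"
proof -
  let ?H = "clades \<tau>"
  have sep: "separated \<tau>" and lv: "leaves \<tau> = {1..n}" using \<tau> by (auto simp: marked_tree_def)
  note e = edges_contractions[OF sep B(1)]
  obtain A where A: "A \<in> ?H" "B \<subset> A" "\<forall>C\<in>?H. B \<subset> C \<longrightarrow> A \<subseteq> C"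
    "local_monomial \<tau>' A = graft (Min B) (local_monomial \<tau> B) (local_monomial \<tau> A)"
    "\<forall>C\<in>?H - {A, B}. local_monomial \<tau>' C = local_monomial \<tau> C"
    using local_contraction[OF sep B(1)] B(2) marked_tree_root[OF \<tau>] lv by (auto simp: insert_absorb)
  have lower: "lower_vertex ?H B = A" using A(1-3) by (auto simp: lower_vertex_def)
  have fin: "finite A" "finite B" "B \<noteq> {}"
    using finite_clade clades_nonempty A(1) e(4) by blast+
  have minB: "Min B \<in> B" using fin by simp
  have "Min B = Min C" if "C \<in> ?H" "C \<subset> A" "Min B \<in> C" for C
  proof -
    have "C \<subseteq> B" using clades_laminar[OF sep that(1) e(4)] that A(3) minB by blast
    then show ?thesis using that(3) fin by (intro Min_eqI[symmetric]) (auto intro: finite_subset)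
  qed
  then have in_A: "Min B \<in> inputs ?H A" using minB A(2) by (auto simp: inputs_def)
  have "inputs ?H A \<inter> B \<subseteq> {Min B}" using A(2) e(4) by (auto simp: inputs_def)
  moreover have "inputs ?H B \<subseteq> B" by (auto simp: inputs_def)
  ultimately have comp: "composable (inputs ?H A) (Min B) (inputs ?H B)"
    using in_A finite_inputs A(1) e(4) by (auto simp: composable_def)
  have A': "A \<in> clades \<tau>'" using A(1,2) e(3) by auto
  have "labels (local_monomial \<tau>' A) = inputs ?H A - {Min B} \<union> inputs ?H B"
    using in_A A(1) e(4) sep by (simp add: A(4) labels_graft labels_local multilinear_local)
  then have in_A': "inputs (clades \<tau>') A = inputs ?H A - {Min B} \<union> inputs ?H B"
    using labels_local[OF e(2) A'] by simp
  have "inputs (clades \<tau>') C = inputs ?H C" if "C \<in> ?H - {A, B}" for C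
  proof -
    have "C \<in> clades \<tau>'" using that e(3) by auto
    then show ?thesis using that A(5) labels_local[OF e(2), of C] labels_local[OF sep, of C] by simp
  qed
  moreover have "A \<noteq> B" using A(2) by blast
  ultimately show ?thesis using that[OF A(1) _ lower comp in_A' A(4)] A(5) by blast
qed

lemma contract_decor:
  assumes \<tau>: "marked_tree n \<tau>" and B: "(B, \<tau>') \<in> set (zip (edges \<tau>) (contractions \<tau>))" "B \<noteq> {1..n}"
  shows "contract (mock_novikov_operad \<delta>) (clades \<tau>) B (decor \<delta> \<tau>) = decor \<delta> \<tau>'"
proof -
  let ?H = "clades \<tau>"
  have sep: "separated \<tau>" using \<tau> by (simp add: marked_tree_def)
  note e = edges_contractions[OF sep B(1)]
  obtain A where A: "A \<in> ?H" "A \<noteq> B" "lower_vertex ?H B = A"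
    "composable (inputs ?H A) (Min B) (inputs ?H B)"
    "inputs (clades \<tau>') A = inputs ?H A - {Min B} \<union> inputs ?H B"
    "local_monomial \<tau>' A = graft (Min B) (local_monomial \<tau> B) (local_monomial \<tau> A)"
    "\<And>C. C \<in> ?H - {A, B} \<Longrightarrow> inputs (clades \<tau>') C = inputs ?H C"
    "\<And>C. C \<in> ?H - {A, B} \<Longrightarrow> local_monomial \<tau>' C = local_monomial \<tau> C"
    using contraction_lower[OF \<tau> B] by metis
  have A': "A \<in> clades \<tau>'" using A(1,2) e(3) by auto
  have local_eq: "pcomp (mock_novikov_operad \<delta>) (inputs ?H A) (Min B) (inputs ?H B) (decor \<delta> \<tau> A) (decor \<delta> \<tau> B)
      = decor \<delta> \<tau>' A"
    using A(1,5) A' e(4) sep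
    by (simp add: decor_def mock_novikov_operad_eq M.Q_pcomp[OF A(4)] mon_space local_monomials free_pcomp A(6))
  have other_eq: "decor \<delta> \<tau>' C = decor \<delta> \<tau> C" if "C \<in> ?H - {A, B}" for C
    using that A(7,8)[OF that] e(3) by (simp add: decor_def)
  show ?thesis
  proof (rule ext)
    fix C
    consider "C = A" | "C \<in> ?H - {A, B}" | "C \<notin> ?H - {B}" by blast
    then show "contract (mock_novikov_operad \<delta>) ?H B (decor \<delta> \<tau>) C = decor \<delta> \<tau>' C"
    proof cases
      case 1
      then have "C \<in> ?H - {B}" using A(1,2) by auto
      with 1 show ?thesis unfolding contract_def Let_def A(3)
        by (simp only: restrict_apply' fun_upd_same local_eq)
    next
      case 2
      then have "C \<in> ?H - {B}" "C \<noteq> A" by auto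
      with 2 show ?thesis unfolding contract_def Let_def A(3)
        by (simp only: restrict_apply' fun_upd_apply if_False other_eq)
    next
      case 3
      then show ?thesis unfolding contract_def Let_def decor_def e(3) by (simp only: restrict_apply if_False)
    qed
  qed
qed

section \<open>Planar order of the edges and its sign\<close>

primrec list_sign :: "nat list \<Rightarrow> complex" where
  "list_sign [] = 1"
| "list_sign (x # xs) = (-1) ^ length (filter (\<lambda>y. y < x) xs) * list_sign xs"

text \<open>\<open>list_sign\<close> is the sign of the sorting permutation, computed by inversions.
  Moving \<open>b\<close> to the front takes \<open>length xs\<close> transpositions, and at the
  front it forms one inversion with each smaller entry.\<close>

lemma list_sign_remove:
  "distinct (xs @ b # ys) \<Longrightarrow> list_sign (xs @ b # ys)
    = (-1) ^ (length xs + length (filter (\<lambda>y. y < b) (xs @ ys))) * list_sign (xs @ ys)"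
proof (induction xs)
  case (Cons x xs)
  then have "x < b \<or> b < x" by auto
  then show ?case using Cons by (auto simp: power_add)
qed simp

lemma list_sign_swap1:
  "distinct (p @ xs @ b # q) \<Longrightarrow> list_sign (p @ xs @ b # q) = (-1) ^ length xs * list_sign (p @ b # xs @ q)"
  using list_sign_remove[of "p @ xs" b q] list_sign_remove[of p b "xs @ q"]
  by (auto simp: power_add)

lemma list_sign_swap:
  "distinct (p @ xs @ ys @ q) \<Longrightarrow>
    list_sign (p @ ys @ xs @ q) = (-1) ^ (length xs * length ys) * list_sign (p @ xs @ ys @ q)"
proof (induction ys arbitrary: p)
  case (Cons y ys)
  have "list_sign (p @ (y # ys) @ xs @ q) = list_sign ((p @ [y]) @ ys @ xs @ q)" by simp
  also have "\<dots> = (-1) ^ (length xs * length ys) * list_sign ((p @ [y]) @ xs @ ys @ q)"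
    using Cons.prems by (intro Cons.IH) auto
  also have "list_sign ((p @ [y]) @ xs @ ys @ q) = (-1) ^ length xs * list_sign (p @ xs @ y # ys @ q)"
    using list_sign_swap1[of p xs y "ys @ q"] Cons.prems by (simp flip: mult.assoc power_add)
  finally show ?case by (simp add: power_add)
qed simp

text \<open>This compares two generators of det(T): the edges in planar order and the edges sorted
  by \<open>set_encode\<close>, as in the complex. Only the planar order is preserved by relabelling
  the leaves.\<close>

definition orientation :: "nat mtree \<Rightarrow> complex" where
  "orientation \<tau> = list_sign (map set_encode (inner_edges \<tau>))"

lemma list_sign_square: "list_sign xs * list_sign xs = 1"
  by (induction xs) (auto simp: algebra_simps simp flip: power_add mult_2)

lemma distinct_encode: "separated \<tau> \<Longrightarrow> distinct (map set_encode (edges \<tau>))"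
  using distinct_edges[of \<tau>] finite_clade[of _ \<tau>] inj_on_set_encode
  by (auto simp: distinct_map set_edges intro: inj_on_subset)

context
  fixes n \<tau> assumes \<tau>: "marked_tree n \<tau>"
begin

lemma marked_edges: "edges \<tau> = inner_edges \<tau> @ [{1..n}]" "\<exists>x. contractions \<tau> = inner_contractions \<tau> @ [x]"
  using \<tau> by (auto simp: marked_tree_def)

lemma length_inner_contractions: "length (inner_contractions \<tau>) = length (inner_edges \<tau>)"
  using \<tau> by (auto simp: marked_tree_def length_edges length_contractions)

lemma set_inner_edges: "set (inner_edges \<tau>) = internal_edges n (clades \<tau>)"
  using \<tau> distinct_edges[of \<tau>] marked_edges(1)
  by (auto simp: internal_edges_def marked_tree_def simp flip: set_edges)

lemma inner_zip:
  assumes "j < length (inner_edges \<tau>)"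
  shows "(inner_edges \<tau> ! j, inner_contractions \<tau> ! j) \<in> set (zip (edges \<tau>) (contractions \<tau>))"
    "inner_edges \<tau> ! j \<noteq> {1..n}"
proof -
  obtain x where "contractions \<tau> = inner_contractions \<tau> @ [x]" using marked_edges(2) by blast
  moreover have "(inner_edges \<tau> ! j, inner_contractions \<tau> ! j) \<in> set (zip (inner_edges \<tau>) (inner_contractions \<tau>))"
    using assms length_inner_contractions by (force simp: set_zip)
  ultimately show "(inner_edges \<tau> ! j, inner_contractions \<tau> ! j) \<in> set (zip (edges \<tau>) (contractions \<tau>))"
    by (simp add: marked_edges(1) length_inner_contractions)
  have "inner_edges \<tau> ! j \<in> set (inner_edges \<tau>)" using assms by simp
  then show "inner_edges \<tau> ! j \<noteq> {1..n}" using set_inner_edges by (auto simp: internal_edges_def)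
qed

lemma inner_contraction_props:
  assumes "j < length (inner_edges \<tau>)"
  shows "marked_tree n (inner_contractions \<tau> ! j)"
    "clades (inner_contractions \<tau> ! j) = clades \<tau> - {inner_edges \<tau> ! j}"
    "weight (inner_contractions \<tau> ! j) + 1 = weight \<tau>"
proof -
  note z = inner_zip[OF assms]
  have sep: "separated \<tau>" and lv: "leaves \<tau> = {1..n}" using \<tau> by (auto simp: marked_tree_def)
  note e = edges_contractions[OF sep z(1)]
  obtain q s t s' t' where st: "\<tau> = Node q s t" "inner_contractions \<tau> ! j = Node q s' t'"
    using contraction_flag[OF z(1)] z(2) lv by metis
  moreover have q using \<tau> unfolding marked_tree_def st(1) by (elim conjE exE) simp
  ultimately have "inner_contractions \<tau> ! j = Node True s' t'" by simp
  then show "marked_tree n (inner_contractions \<tau> ! j)"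
    unfolding marked_tree_def using e(1,2) lv by metis
  show "clades (inner_contractions \<tau> ! j) = clades \<tau> - {inner_edges \<tau> ! j}"
    "weight (inner_contractions \<tau> ! j) + 1 = weight \<tau>" by (rule e(3), rule e(5))
qed

text \<open>Removing the edge at position \<open>j\<close> from the planar list costs (-1)^j and one
  sign for each smaller edge; \<open>edge_sign\<close> contains exactly the latter signs, which
  therefore cancel.\<close>

lemma orientation_contraction:
  assumes "j < length (inner_edges \<tau>)"
  shows "orientation \<tau> * edge_sign n (clades \<tau>) (inner_edges \<tau> ! j) = (-1) ^ j * orientation (inner_contractions \<tau> ! j)"
proof -
  let ?L = "inner_edges \<tau>"
  define xs where "xs = take j ?L"
  define B where "B = ?L ! j"
  define ys where "ys = drop (Suc j) ?L"
  let ?e = "map set_encode"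
  have L: "?L = xs @ B # ys" using assms by (simp add: xs_def B_def ys_def id_take_nth_drop)
  have len: "length xs = j" using assms by (simp add: xs_def)
  have "distinct (?e (edges \<tau>))" using distinct_encode \<tau> by (simp add: marked_tree_def)
  then have dist: "distinct (?e xs @ set_encode B # ?e ys)" by (auto simp: marked_edges(1) L)
  have "distinct (?e (xs @ ys))" using dist by simp
  then have inj: "inj_on set_encode (set (xs @ ys))" by (simp only: distinct_map)
  let ?k = "length (filter (\<lambda>y. y < set_encode B) (?e xs @ ?e ys))"
  have "card {C \<in> internal_edges n (clades \<tau>). set_encode C < set_encode B}
      = card {C \<in> set (xs @ ys). set_encode C < set_encode B}"
    by (rule arg_cong[of _ _ card]) (auto simp: set_inner_edges[symmetric] L)
  also have "\<dots> = card (set_encode ` {C \<in> set (xs @ ys). set_encode C < set_encode B})"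
    using inj by (intro card_image[symmetric]) (auto intro: inj_on_subset)
  also have "set_encode ` {C \<in> set (xs @ ys). set_encode C < set_encode B}
      = set (filter (\<lambda>y. y < set_encode B) (?e xs @ ?e ys))" by auto
  also have "card \<dots> = ?k" using dist by (intro distinct_card) auto
  finally have sgn: "edge_sign n (clades \<tau>) B = (-1) ^ ?k" by (simp add: edge_sign_def)
  have "orientation \<tau> = (-1) ^ (j + ?k) * list_sign (?e xs @ ?e ys)"
    using list_sign_remove[OF dist] len by (simp add: orientation_def L)
  moreover have "orientation (inner_contractions \<tau> ! j) = list_sign (?e xs @ ?e ys)"
    using assms by (simp add: orientation_def inner_contractions_nth xs_def ys_def)
  ultimately have "orientation \<tau> * edge_sign n (clades \<tau>) B
      = (-1) ^ j * orientation (inner_contractions \<tau> ! j) * ((-1) ^ ?k * (-1) ^ ?k)"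
    unfolding sgn by (simp only: power_add mult_ac)
  also have "(-1) ^ ?k * (-1) ^ ?k = (1 :: complex)" by (simp flip: power_add mult_2)
  finally show ?thesis by (simp add: B_def)
qed

text \<open>In this form the differential refers to the planar tree alone, so that it can be
  averaged over labellings and evaluated on shapes.\<close>

lemma cobar_diff_decor:
  "orientation \<tau> * cobar_diff (mock_novikov_operad \<delta>) n \<psi> (clades \<tau>) (decor \<delta> \<tau>)
    = (\<Sum>j<length (inner_contractions \<tau>). (-1) ^ j * (orientation (inner_contractions \<tau> ! j)
        * \<psi> (clades (inner_contractions \<tau> ! j)) (decor \<delta> (inner_contractions \<tau> ! j))))"
proof -
  let ?L = "inner_edges \<tau>" and ?P = "mock_novikov_operad \<delta>"
  let ?f = "\<lambda>B. edge_sign n (clades \<tau>) B * \<psi> (clades \<tau> - {B}) (contract ?P (clades \<tau>) B (decor \<delta> \<tau>))"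
  have "distinct ?L" using distinct_edges[of \<tau>] \<tau> marked_edges(1) by (simp add: marked_tree_def)
  then have "cobar_diff ?P n \<psi> (clades \<tau>) (decor \<delta> \<tau>) = (\<Sum>j<length ?L. ?f (?L ! j))"
    unfolding cobar_diff_def set_inner_edges[symmetric]
    by (intro sum.reindex_bij_betw[symmetric] bij_betw_nth) auto
  then have "orientation \<tau> * cobar_diff ?P n \<psi> (clades \<tau>) (decor \<delta> \<tau>)
      = (\<Sum>j<length ?L. orientation \<tau> * ?f (?L ! j))" by (simp add: sum_distrib_left)
  also have "\<dots> = (\<Sum>j<length ?L. (-1) ^ j * (orientation (inner_contractions \<tau> ! j)
        * \<psi> (clades (inner_contractions \<tau> ! j)) (decor \<delta> (inner_contractions \<tau> ! j))))"
  proof (rule sum.cong)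
    fix j assume "j \<in> {..<length ?L}"
    then have j: "j < length ?L" by simp
    show "orientation \<tau> * ?f (?L ! j) = (-1) ^ j * (orientation (inner_contractions \<tau> ! j)
        * \<psi> (clades (inner_contractions \<tau> ! j)) (decor \<delta> (inner_contractions \<tau> ! j)))"
      using orientation_contraction[OF j] inner_contraction_props(2)[OF j] contract_decor[OF \<tau> inner_zip[OF j]]
      by (simp flip: mult.assoc)
  qed simp
  finally show ?thesis by (simp add: length_inner_contractions)
qed

end

section \<open>Relations at the contracted edges\<close>

primrec real_root :: "'a mtree \<Rightarrow> bool" where
  "real_root (Leaf a) \<longleftrightarrow> False"
| "real_root (Node r s t) \<longleftrightarrow> r"

text \<open>Interchanging two adjacent subtrees permutes their edges in the planar order.\<close>

definition swap_sign :: "'a mtree \<Rightarrow> 'a mtree \<Rightarrow> int" where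
  "swap_sign s t = (-1) ^ (weight s * weight t)"

text \<open>
  An entry \<open>(k, e, \<sigma>)\<close> contributes \<open>\<delta> ^ k\<close> times the value at \<open>\<sigma>\<close>; the sign \<open>e\<close> compares the
  orientation of \<open>\<sigma>\<close> with the one of the original tree.
\<close>

primrec tree_relations :: "'a mtree \<Rightarrow> (nat \<times> int \<times> 'a mtree) list list" where
  "tree_relations (Leaf a) = []"
| "tree_relations (Node r s t) =
     map (map (apsnd (apsnd (\<lambda>s'. Node r s' t)))) (tree_relations s) @
     map (map (apsnd (apsnd (\<lambda>t'. Node r s t')))) (tree_relations t) @
     (case s of Leaf a \<Rightarrow> [] | Node q u v \<Rightarrow> if q then [] else
       [[(0, 1, Node r (Node False u v) t), (0, swap_sign v t, Node r (Node False u t) v)]]) @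
     (case t of Leaf a \<Rightarrow> [] | Node q u v \<Rightarrow> if q then [] else
       [[(1, 1, Node r (Node False s u) v), (1, swap_sign s u, Node r (Node False u s) v),
         (0, 1, Node r s (Node False u v)), (0, swap_sign s u, Node r u (Node False s v))]])"

lemma tree_relations_cases:
  assumes "L \<in> set (tree_relations (Node r s t))"
  obtains (left) L' where "L' \<in> set (tree_relations s)" "L = map (apsnd (apsnd (\<lambda>s'. Node r s' t))) L'"
  | (right) L' where "L' \<in> set (tree_relations t)" "L = map (apsnd (apsnd (\<lambda>t'. Node r s t'))) L'"
  | (root_left) u v where "s = Node False u v"
      "L = [(0, 1, Node r (Node False u v) t), (0, swap_sign v t, Node r (Node False u t) v)]"
  | (root_right) u v where "t = Node False u v"
      "L = [(1, 1, Node r (Node False s u) v), (1, swap_sign s u, Node r (Node False u s) v),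
         (0, 1, Node r s (Node False u v)), (0, swap_sign s u, Node r u (Node False s v))]"
  using assms by (auto split: mtree.splits if_splits)

lemma weight_map [simp]: "weight (map_mtree f \<tau>) = weight \<tau>"
  by (induction \<tau>) auto

lemma contracted_map [simp]: "contracted (map_mtree f \<tau>) = contracted \<tau>"
  by (induction \<tau>) auto

lemma contractions_map: "contractions (map_mtree f \<tau>) = map (map_mtree f) (contractions \<tau>)"
  by (induction \<tau>) auto

lemma inner_contractions_map: "inner_contractions (map_mtree f \<tau>) = map (map_mtree f) (inner_contractions \<tau>)"
  by (cases \<tau>) (auto simp: contractions_map)

lemma leaves_map [simp]: "leaves (map_mtree f \<tau>) = f ` leaves \<tau>"
  by (rule mtree.set_map)

lemma tree_relations_map:
  "tree_relations (map_mtree f \<tau>) = map (map (apsnd (apsnd (map_mtree f)))) (tree_relations \<tau>)"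
proof (induction \<tau>)
  case (Node r s t)
  then show ?case
    by (cases s; cases t) (simp_all add: swap_sign_def apsnd_compose o_def)
qed simp

lemma tree_relations_shape:
  assumes "L \<in> set (tree_relations \<tau>)" "(k, e, \<sigma>) \<in> set L"
  shows "leaves \<sigma> = leaves \<tau>" "separated \<tau> \<Longrightarrow> separated \<sigma>" "clades \<sigma> = clades \<tau>"
    "real_root \<sigma> = real_root \<tau>" "weight \<sigma> = weight \<tau>" "contracted \<sigma> = contracted \<tau>" "\<exists>r s t. \<sigma> = Node r s t"
proof -
  have "leaves \<sigma> = leaves \<tau> \<and> (separated \<tau> \<longrightarrow> separated \<sigma>) \<and> clades \<sigma> = clades \<tau> \<and> real_root \<sigma> = real_root \<tau>
    \<and> weight \<sigma> = weight \<tau> \<and> contracted \<sigma> = contracted \<tau> \<and> (\<exists>r s t. \<sigma> = Node r s t)"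
    using assms
  proof (induction \<tau> arbitrary: L \<sigma>)
    case (Node r s t)
    from Node.prems(1) show ?case
    proof (cases rule: tree_relations_cases)
      case (left L')
      then obtain s' where "(k, e, s') \<in> set L'" "\<sigma> = Node r s' t" using Node.prems(2) by auto
      then show ?thesis using Node.IH(1)[OF left(1)] by simp
    next
      case (right L')
      then obtain t' where "(k, e, t') \<in> set L'" "\<sigma> = Node r s t'" using Node.prems(2) by auto
      then show ?thesis using Node.IH(2)[OF right(1)] by simp
    next
      case (root_left u v)
      then show ?thesis using Node.prems(2) by (auto simp: Int_Un_distrib Int_Un_distrib2 Int_commute)
    next
      case (root_right u v)
      then show ?thesis using Node.prems(2) by (auto simp: Int_Un_distrib Int_Un_distrib2 Int_commute)
    qed
  qed simp
  then show "leaves \<sigma> = leaves \<tau>" "separated \<tau> \<Longrightarrow> separated \<sigma>" "clades \<sigma> = clades \<tau>"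
    "real_root \<sigma> = real_root \<tau>" "weight \<sigma> = weight \<tau>" "contracted \<sigma> = contracted \<tau>" "\<exists>r s t. \<sigma> = Node r s t"
    by blast+
qed

lemma tree_relations_marked:
  assumes "L \<in> set (tree_relations \<tau>)" "(k, e, \<sigma>) \<in> set L" "marked_tree n \<tau>"
  shows "marked_tree n \<sigma>"
proof -
  obtain r s t where "\<sigma> = Node r s t" using tree_relations_shape(7)[OF assms(1,2)] by blast
  moreover have "real_root \<tau>" using assms(3) by (auto simp: marked_tree_def)
  ultimately show ?thesis
    using tree_relations_shape(1,2,4)[OF assms(1,2)] assms(3) by (simp add: marked_tree_def)
qed

lemma edges_inner: "edges \<tau> = inner_edges \<tau> @ (if real_root \<tau> then [leaves \<tau>] else [])"
  by (cases \<tau>) auto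

text \<open>The prefix \<open>p\<close> and the suffix \<open>q\<close> carry the induction: the
  inner edges of a subtree form a contiguous block in the planar order of the whole tree, and a
  relation interchanges at most two adjacent blocks.\<close>

lemma list_sign_tree_relations:
  assumes "L \<in> set (tree_relations \<tau>)" "(k, e, \<sigma>) \<in> set L" "distinct (p @ map set_encode (inner_edges \<tau>) @ q)"
  shows "list_sign (p @ map set_encode (inner_edges \<sigma>) @ q) = of_int e * list_sign (p @ map set_encode (inner_edges \<tau>) @ q)"
  using assms
proof (induction \<tau> arbitrary: L \<sigma> p q)
  case (Node r s t)
  from Node.prems(1) show ?case
  proof (cases rule: tree_relations_cases)
    case (left L')
    then obtain s' where s': "(k, e, s') \<in> set L'" "\<sigma> = Node r s' t" using Node.prems(2) by auto
    note sh = tree_relations_shape[OF left(1) s'(1)]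
    let ?q = "(if real_root s then [set_encode (leaves s)] else []) @ map set_encode (edges t) @ q"
    have "list_sign (p @ map set_encode (inner_edges s') @ ?q) = of_int e * list_sign (p @ map set_encode (inner_edges s) @ ?q)"
      using Node.prems(3) by (intro Node.IH(1)[OF left(1) s'(1)]) (auto simp: edges_inner[of s])
    then show ?thesis using s'(2) sh(1,4) by (auto simp: edges_inner[of s] edges_inner[of s'])
  next
    case (right L')
    then obtain t' where t': "(k, e, t') \<in> set L'" "\<sigma> = Node r s t'" using Node.prems(2) by auto
    note sh = tree_relations_shape[OF right(1) t'(1)]
    let ?p = "p @ map set_encode (edges s)"
    let ?q = "(if real_root t then [set_encode (leaves t)] else []) @ q"
    have "list_sign (?p @ map set_encode (inner_edges t') @ ?q) = of_int e * list_sign (?p @ map set_encode (inner_edges t) @ ?q)"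
      using Node.prems(3) by (intro Node.IH(2)[OF right(1) t'(1)]) (auto simp: edges_inner[of t])
    then show ?thesis using t'(2) sh(1,4) by (auto simp: edges_inner[of t] edges_inner[of t'])
  next
    case (root_left u v)
    have "list_sign ((p @ map set_encode (edges u)) @ map set_encode (edges t) @ map set_encode (edges v) @ q)
        = (-1) ^ (weight v * weight t) * list_sign ((p @ map set_encode (edges u)) @ map set_encode (edges v) @ map set_encode (edges t) @ q)"
      using Node.prems(3) root_left(1) by (subst list_sign_swap) (auto simp: length_edges)
    then show ?thesis using Node.prems(2) root_left by (auto simp: swap_sign_def)
  next
    case (root_right u v)
    have "list_sign (p @ map set_encode (edges u) @ map set_encode (edges s) @ map set_encode (edges v) @ q)
        = (-1) ^ (weight s * weight u) * list_sign (p @ map set_encode (edges s) @ map set_encode (edges u) @ map set_encode (edges v) @ q)"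
      using Node.prems(3) root_right(1) by (subst list_sign_swap) (auto simp: length_edges)
    then show ?thesis using Node.prems(2) root_right by (auto simp: swap_sign_def)
  qed
qed simp

lemma tree_relations_sign:
  assumes "L \<in> set (tree_relations \<tau>)" "(k, e, \<sigma>) \<in> set L"
  shows "of_int e * of_int e = (1 :: complex)"
  using assms
proof (induction \<tau> arbitrary: L \<sigma>)
  case (Node r s t)
  from Node.prems(1) show ?case
    by (cases rule: tree_relations_cases)
      (use Node in \<open>auto simp: swap_sign_def simp flip: power_add mult_2\<close>)
qed simp

lemma orientation_tree_relations:
  assumes "L \<in> set (tree_relations \<tau>)" "(k, e, \<sigma>) \<in> set L" "separated \<tau>"
  shows "orientation \<sigma> = of_int e * orientation \<tau>"
proof -
  have "distinct ([] @ map set_encode (inner_edges \<tau>) @ [])"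
    using distinct_encode[OF assms(3)] by (simp add: edges_inner)
  from list_sign_tree_relations[OF assms(1,2) this] show ?thesis by (simp add: orientation_def)
qed

section \<open>A relation affects a single vertex\<close>

definition same_except :: "nat set \<Rightarrow> nat mtree \<Rightarrow> nat mtree \<Rightarrow> bool" where
  "same_except A \<tau> \<sigma> \<longleftrightarrow> (\<forall>C\<in>insert (leaves \<tau>) (clades \<tau>) - {A}. local_monomial \<sigma> C = local_monomial \<tau> C)"

lemma local_left:
  assumes "separated (Node r s t)" "C \<in> clades s" "leaves s' = leaves s" "leaves t' = leaves t"
  shows "local_monomial (Node q s' t') C = local_monomial s' C"
  using clades_proper(1)[OF assms(1,2)] clades_sub[OF assms(2)] assms(3,4) by auto

lemma local_right:
  assumes "separated (Node r s t)" "C \<in> clades t" "leaves s' = leaves s" "leaves t' = leaves t"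
  shows "local_monomial (Node q s' t') C = local_monomial t' C"
  using clades_proper(2)[OF assms(1,2)] clades_sub[OF assms(2)] clades_nonempty[OF assms(2)] assms by auto

lemma collapse_local: "collapse \<tau> = (if real_root \<tau> then Var (Min (leaves \<tau>)) else local_monomial \<tau> (leaves \<tau>))"
  by (cases \<tau>) auto

lemma clade_cases:
  assumes "C \<in> insert (leaves (Node r s t)) (clades (Node r s t))"
  obtains "C = leaves s \<union> leaves t" | "C \<in> clades s" | "C \<in> clades t"
  using assms by (auto split: if_splits)

lemma same_except_left:
  assumes sep: "separated (Node r s t)" and s': "leaves s' = leaves s" "real_root s' = real_root s"
    "same_except A s s'" and A: "A \<in> clades s"  
  shows "same_except A (Node r s t) (Node r s' t)" "local_monomial (Node r s' t) A = local_monomial s' A"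
proof -
  \<comment> \<open>\<open>collapse\<close> of a subtree with contracted root reads the monomial at
    its leaf set. This set is not a clade, hence differs from \<open>A\<close>, and so the node
    below sees no change.\<close>
  have "leaves s \<noteq> A" if "\<not> real_root s"
  proof (cases s)
    case (Node q u v)
    then have "leaves s \<notin> clades s" using that sep clades_proper[of q u v "leaves s"] by auto
    then show ?thesis using A by blast
  qed (use A in simp)
  then have collapse: "collapse s' = collapse s" using s' by (auto simp: collapse_local same_except_def)
  show "same_except A (Node r s t) (Node r s' t)"
    unfolding same_except_def
  proof
    fix C assume C: "C \<in> insert (leaves (Node r s t)) (clades (Node r s t)) - {A}"
    then have "C \<in> insert (leaves (Node r s t)) (clades (Node r s t))" by blast
    then show "local_monomial (Node r s' t) C = local_monomial (Node r s t) C"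
    proof (cases rule: clade_cases)
      case 2
      then have "local_monomial s' C = local_monomial s C" using C s'(3) by (auto simp: same_except_def)
      then show ?thesis
        using local_left[OF sep 2 s'(1) refl, of r] local_left[OF sep 2 refl refl, of r] by simp
    next
      case 3
      then show ?thesis
        using local_right[OF sep 3 s'(1) refl, of r] local_right[OF sep 3 refl refl, of r] by simp
    qed (use collapse s'(1) in simp)
  qed
  show "local_monomial (Node r s' t) A = local_monomial s' A" by (rule local_left[OF sep A s'(1) refl])
qed

lemma same_except_right:
  assumes sep: "separated (Node r s t)" and t': "leaves t' = leaves t" "real_root t' = real_root t"
    "same_except A t t'" and A: "A \<in> clades t"  
  shows "same_except A (Node r s t) (Node r s t')" "local_monomial (Node r s t') A = local_monomial t' A"
proof -
  have "leaves t \<noteq> A" if "\<not> real_root t"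
  proof (cases t)
    case (Node q u v)
    then have "leaves t \<notin> clades t" using that sep clades_proper[of q u v "leaves t"] by auto
    then show ?thesis using A by blast
  qed (use A in simp)
  then have collapse: "collapse t' = collapse t" using t' by (auto simp: collapse_local same_except_def)
  show "same_except A (Node r s t) (Node r s t')"
    unfolding same_except_def
  proof
    fix C assume C: "C \<in> insert (leaves (Node r s t)) (clades (Node r s t)) - {A}"
    then have "C \<in> insert (leaves (Node r s t)) (clades (Node r s t))" by blast
    then show "local_monomial (Node r s t') C = local_monomial (Node r s t) C"
    proof (cases rule: clade_cases)
      case 2
      then show ?thesis
        using local_left[OF sep 2 refl t'(1), of r] local_left[OF sep 2 refl refl, of r] by simp
    next
      case 3
      then have "local_monomial t' C = local_monomial t C" using C t'(3) by (auto simp: same_except_def)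
      then show ?thesis
        using local_right[OF sep 3 refl t'(1), of r] local_right[OF sep 3 refl refl, of r] by simp
    qed (use collapse t'(1) in simp)
  qed
  show "local_monomial (Node r s t') A = local_monomial t' A" by (rule local_right[OF sep A refl t'(1)])
qed

lemma same_except_root:
  assumes sep: "separated (Node r s t)" and s': "leaves s' = leaves s" "\<And>C. C \<in> clades s \<Longrightarrow> local_monomial s' C = local_monomial s C"
    and t': "leaves t' = leaves t" "\<And>C. C \<in> clades t \<Longrightarrow> local_monomial t' C = local_monomial t C"
  shows "same_except (leaves s \<union> leaves t) (Node r s t) (Node r s' t')"
  unfolding same_except_def
proof
  fix C assume C: "C \<in> insert (leaves (Node r s t)) (clades (Node r s t)) - {leaves s \<union> leaves t}"
  then have "C \<in> insert (leaves (Node r s t)) (clades (Node r s t))" by blast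
  then show "local_monomial (Node r s' t') C = local_monomial (Node r s t) C"
  proof (cases rule: clade_cases)
    case 2
    then show ?thesis
      using local_left[OF sep 2 s'(1) t'(1), of r] local_left[OF sep 2 refl refl, of r] s'(2) by simp
  next
    case 3
    then show ?thesis
      using local_right[OF sep 3 s'(1) t'(1), of r] local_right[OF sep 3 refl refl, of r] t'(2) by simp
  qed (use C in simp)
qed

lemma local_nested_left:
  assumes "separated (Node r (Node False a b) c)"
  shows "C \<in> clades a \<Longrightarrow> local_monomial (Node r (Node False a b) c) C = local_monomial a C"
    "C \<in> clades b \<Longrightarrow> local_monomial (Node r (Node False a b) c) C = local_monomial b C"
    "C \<in> clades c \<Longrightarrow> local_monomial (Node r (Node False a b) c) C = local_monomial c C"
  using local_left[OF assms _ refl refl, of C r] local_right[OF assms _ refl refl, of C r]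
    local_left[of False a b C a b False] local_right[of False a b C a b False] assms
  by simp_all

lemma local_nested_right:
  assumes "separated (Node r a (Node False b c))"
  shows "C \<in> clades a \<Longrightarrow> local_monomial (Node r a (Node False b c)) C = local_monomial a C"
    "C \<in> clades b \<Longrightarrow> local_monomial (Node r a (Node False b c)) C = local_monomial b C"
    "C \<in> clades c \<Longrightarrow> local_monomial (Node r a (Node False b c)) C = local_monomial c C"
  using local_left[OF assms _ refl refl, of C r] local_right[OF assms _ refl refl, of C r]
    local_left[of False b c C b c False] local_right[of False b c C b c False] assms
  by simp_all

lemma root_left_local:
  assumes sep: "separated (Node r (Node False u v) t)"
  shows "same_except (leaves u \<union> leaves v \<union> leaves t) (Node r (Node False u v) t) (Node r (Node False u t) v)"
    "local_monomial (Node r (Node False u t) v) (leaves u \<union> leaves v \<union> leaves t) = (collapse u \<odot> collapse t) \<odot> collapse v"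
proof -
  have sep': "separated (Node r (Node False u t) v)" using sep by (auto simp: Int_Un_distrib Int_Un_distrib2)
  have "local_monomial (Node r (Node False u t) v) C = local_monomial (Node r (Node False u v) t) C"
    if "C \<in> clades u \<or> C \<in> clades v \<or> C \<in> clades t" for C
    using that local_nested_left[OF sep, of C] local_nested_left[OF sep', of C] by metis
  moreover have "C \<in> clades u \<or> C \<in> clades v \<or> C \<in> clades t"
    if "C \<in> insert (leaves (Node r (Node False u v) t)) (clades (Node r (Node False u v) t)) - {leaves u \<union> leaves v \<union> leaves t}" for C
    using that by (auto split: if_splits)
  ultimately show "same_except (leaves u \<union> leaves v \<union> leaves t) (Node r (Node False u v) t) (Node r (Node False u t) v)"
    unfolding same_except_def by blast
  show "local_monomial (Node r (Node False u t) v) (leaves u \<union> leaves v \<union> leaves t) = (collapse u \<odot> collapse t) \<odot> collapse v"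
    by (simp add: Un_ac)
qed

lemma root_right_local:
  fixes r s u v defines "L \<equiv> leaves s \<union> leaves u \<union> leaves v"
  assumes sep: "separated (Node r s (Node False u v))"
  shows "same_except L (Node r s (Node False u v)) (Node r (Node False s u) v)"
    "same_except L (Node r s (Node False u v)) (Node r (Node False u s) v)"
    "same_except L (Node r s (Node False u v)) (Node r u (Node False s v))"
    "local_monomial (Node r (Node False s u) v) L = (collapse s \<odot> collapse u) \<odot> collapse v"
    "local_monomial (Node r (Node False u s) v) L = (collapse u \<odot> collapse s) \<odot> collapse v"
    "local_monomial (Node r u (Node False s v)) L = collapse u \<odot> (collapse s \<odot> collapse v)"
    "local_monomial (Node r s (Node False u v)) L = collapse s \<odot> (collapse u \<odot> collapse v)"
proof -
  let ?T = "Node r s (Node False u v)" and ?T1 = "Node r (Node False s u) v"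
    and ?T2 = "Node r (Node False u s) v" and ?T3 = "Node r u (Node False s v)"
  have sep': "separated ?T1" "separated ?T2" "separated ?T3"
    using sep by (auto simp: Int_Un_distrib Int_Un_distrib2)
  have "local_monomial ?T1 C = local_monomial ?T C" "local_monomial ?T2 C = local_monomial ?T C"
    "local_monomial ?T3 C = local_monomial ?T C" if "C \<in> clades s \<or> C \<in> clades u \<or> C \<in> clades v" for C
    using that local_nested_right[OF sep, of C] local_nested_left[OF sep'(1), of C]
      local_nested_left[OF sep'(2), of C] local_nested_right[OF sep'(3), of C] by metis+
  moreover have "C \<in> clades s \<or> C \<in> clades u \<or> C \<in> clades v"
    if "C \<in> insert (leaves ?T) (clades ?T) - {L}" for C
    using that by (auto simp: L_def Un_ac split: if_splits)
  ultimately show "same_except L ?T ?T1" "same_except L ?T ?T2" "same_except L ?T ?T3"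
    unfolding same_except_def by blast+
  show "local_monomial ?T1 L = (collapse s \<odot> collapse u) \<odot> collapse v" "local_monomial ?T2 L = (collapse u \<odot> collapse s) \<odot> collapse v"
    "local_monomial ?T3 L = collapse u \<odot> (collapse s \<odot> collapse v)" "local_monomial ?T L = collapse s \<odot> (collapse u \<odot> collapse v)"
    by (simp_all add: L_def Un_ac)
qed

lemma same_except_refl [simp]: "same_except A \<tau> \<tau>"
  by (simp add: same_except_def)

lemma relations_prod:
  "L \<in> set (relations s) \<Longrightarrow> map (apsnd (\<lambda>x. x \<odot> t)) L \<in> set (relations (s \<odot> t))"
  "L \<in> set (relations t) \<Longrightarrow> map (apsnd (\<lambda>x. s \<odot> x)) L \<in> set (relations (s \<odot> t))"
  by simp_all

text \<open>A relation at a contracted node changes only the monomial of the vertex that contains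
  this node. If this vertex reaches through a contracted root of a subtree, it acquires a further
  factor from the node below; this is why \<open>relations\<close> is closed under products.\<close>

lemma tree_relations_local:
  assumes "L \<in> set (tree_relations \<tau>)" "separated \<tau>"
  shows "\<exists>A\<in>insert (leaves \<tau>) (clades \<tau>).
    map (\<lambda>(k, e, \<sigma>). (k, local_monomial \<sigma> A)) L \<in> set (relations (local_monomial \<tau> A)) \<and>
    (\<forall>k e \<sigma>. (k, e, \<sigma>) \<in> set L \<longrightarrow> same_except A \<tau> \<sigma>)"
  using assms
proof (induction \<tau> arbitrary: L)
  case (Node r s t)
  note sep = Node.prems(2)
  have seps: "separated s" "separated t" using sep by auto
  let ?V = "leaves s \<union> leaves t"
  from Node.prems(1) show ?case
  proof (cases rule: tree_relations_cases)
    case (left L')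
    obtain A where A: "A \<in> insert (leaves s) (clades s)"
      "map (\<lambda>(k, e, \<sigma>). (k, local_monomial \<sigma> A)) L' \<in> set (relations (local_monomial s A))"
      "\<forall>k e \<sigma>. (k, e, \<sigma>) \<in> set L' \<longrightarrow> same_except A s \<sigma>"
      using Node.IH(1)[OF left(1) seps(1)] by (elim bexE conjE)
    note sh = tree_relations_shape[OF left(1)]
    show ?thesis
    proof (cases "A \<in> clades s")
      case True
      have *: "same_except A (Node r s t) (Node r s' t)" "local_monomial (Node r s' t) A = local_monomial s' A"
        if "(k, e, s') \<in> set L'" for k e s'
        using same_except_left[OF sep sh(1,4)[OF that] A(3)[rule_format, OF that] True] by blast+
      then have "map (\<lambda>(k, e, \<sigma>). (k, local_monomial \<sigma> A)) L = map (\<lambda>(k, e, \<sigma>). (k, local_monomial \<sigma> A)) L'"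
        using left(2) by (auto simp del: local_monomial.simps)
      then have 1: "map (\<lambda>(k, e, \<sigma>). (k, local_monomial \<sigma> A)) L \<in> set (relations (local_monomial (Node r s t) A))"
        unfolding local_left[OF sep True refl refl] using A(2) by (simp only:)
      have 2: "\<forall>k e \<sigma>. (k, e, \<sigma>) \<in> set L \<longrightarrow> same_except A (Node r s t) \<sigma>"
        using *(1) left(2) by auto
      have "A \<in> insert (leaves (Node r s t)) (clades (Node r s t))" using True by simp
      with conjI[OF 1 2] show ?thesis by (rule bexI)
    next
      case False
      then have A': "A = leaves s" using A(1) by blast
      have ns: "\<not> real_root s" using False A' by (cases s) auto
      have *: "same_except ?V (Node r s t) (Node r s' t)"
        "local_monomial (Node r s' t) ?V = local_monomial s' A \<odot> collapse t" if "(k, e, s') \<in> set L'" for k e s'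
      proof -
        have "local_monomial s' C = local_monomial s C" if "C \<in> clades s" for C
          using A(3)[rule_format, OF \<open>(k, e, s') \<in> set L'\<close>] that False A' by (auto simp: same_except_def)
        then show "same_except ?V (Node r s t) (Node r s' t)"
          using same_except_root[OF sep sh(1)[OF that] _ refl] by blast
        show "local_monomial (Node r s' t) ?V = local_monomial s' A \<odot> collapse t"
          using ns sh(1,4)[OF that] A' by (simp add: collapse_local[of s'])
      qed
      then have "map (\<lambda>(k, e, \<sigma>). (k, local_monomial \<sigma> ?V)) L
          = map (apsnd (\<lambda>x. x \<odot> collapse t)) (map (\<lambda>(k, e, \<sigma>). (k, local_monomial \<sigma> A)) L')"
        using left(2) by (auto simp del: local_monomial.simps)
      moreover have "local_monomial (Node r s t) ?V = local_monomial s A \<odot> collapse t"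
        using ns A' by (simp add: collapse_local[of s])
      ultimately have 1: "map (\<lambda>(k, e, \<sigma>). (k, local_monomial \<sigma> ?V)) L \<in> set (relations (local_monomial (Node r s t) ?V))"
        by (simp only: relations_prod(1)[OF A(2)])
      have 2: "\<forall>k e \<sigma>. (k, e, \<sigma>) \<in> set L \<longrightarrow> same_except ?V (Node r s t) \<sigma>"
        using *(1) left(2) by auto
      have "?V \<in> insert (leaves (Node r s t)) (clades (Node r s t))" by simp
      with conjI[OF 1 2] show ?thesis by (rule bexI)
    qed
  next
    case (right L')
    obtain A where A: "A \<in> insert (leaves t) (clades t)"
      "map (\<lambda>(k, e, \<sigma>). (k, local_monomial \<sigma> A)) L' \<in> set (relations (local_monomial t A))"
      "\<forall>k e \<sigma>. (k, e, \<sigma>) \<in> set L' \<longrightarrow> same_except A t \<sigma>"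
      using Node.IH(2)[OF right(1) seps(2)] by (elim bexE conjE)
    note sh = tree_relations_shape[OF right(1)]
    show ?thesis
    proof (cases "A \<in> clades t")
      case True
      have *: "same_except A (Node r s t) (Node r s t')" "local_monomial (Node r s t') A = local_monomial t' A"
        if "(k, e, t') \<in> set L'" for k e t'
        using same_except_right[OF sep sh(1,4)[OF that] A(3)[rule_format, OF that] True] by blast+
      then have "map (\<lambda>(k, e, \<sigma>). (k, local_monomial \<sigma> A)) L = map (\<lambda>(k, e, \<sigma>). (k, local_monomial \<sigma> A)) L'"
        using right(2) by (auto simp del: local_monomial.simps)
      then have 1: "map (\<lambda>(k, e, \<sigma>). (k, local_monomial \<sigma> A)) L \<in> set (relations (local_monomial (Node r s t) A))"
        unfolding local_right[OF sep True refl refl] using A(2) by (simp only:)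
      have 2: "\<forall>k e \<sigma>. (k, e, \<sigma>) \<in> set L \<longrightarrow> same_except A (Node r s t) \<sigma>"
        using *(1) right(2) by auto
      have "A \<in> insert (leaves (Node r s t)) (clades (Node r s t))" using True by simp
      with conjI[OF 1 2] show ?thesis by (rule bexI)
    next
      case False
      then have A': "A = leaves t" using A(1) by blast
      have ns: "\<not> real_root t" using False A' by (cases t) auto
      have *: "same_except ?V (Node r s t) (Node r s t')"
        "local_monomial (Node r s t') ?V = collapse s \<odot> local_monomial t' A" if "(k, e, t') \<in> set L'" for k e t'
      proof -
        have "local_monomial t' C = local_monomial t C" if "C \<in> clades t" for C
          using A(3)[rule_format, OF \<open>(k, e, t') \<in> set L'\<close>] that False A' by (auto simp: same_except_def)
        then show "same_except ?V (Node r s t) (Node r s t')"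
          using same_except_root[OF sep refl _ sh(1)[OF that]] by blast
        show "local_monomial (Node r s t') ?V = collapse s \<odot> local_monomial t' A"
          using ns sh(1,4)[OF that] A' by (simp add: collapse_local[of t'])
      qed
      then have "map (\<lambda>(k, e, \<sigma>). (k, local_monomial \<sigma> ?V)) L
          = map (apsnd (\<lambda>x. collapse s \<odot> x)) (map (\<lambda>(k, e, \<sigma>). (k, local_monomial \<sigma> A)) L')"
        using right(2) by (auto simp del: local_monomial.simps)
      moreover have "local_monomial (Node r s t) ?V = collapse s \<odot> local_monomial t A"
        using ns A' by (simp add: collapse_local[of t])
      ultimately have 1: "map (\<lambda>(k, e, \<sigma>). (k, local_monomial \<sigma> ?V)) L \<in> set (relations (local_monomial (Node r s t) ?V))"
        by (simp only: relations_prod(2)[OF A(2)])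
      have 2: "\<forall>k e \<sigma>. (k, e, \<sigma>) \<in> set L \<longrightarrow> same_except ?V (Node r s t) \<sigma>"
        using *(1) right(2) by auto
      have "?V \<in> insert (leaves (Node r s t)) (clades (Node r s t))" by simp
      with conjI[OF 1 2] show ?thesis by (rule bexI)
    qed
  next
    case (root_left u v)
    then show ?thesis using root_left_local[of r u v t] sep
      by (intro bexI[of _ ?V]) auto
  next
    case (root_right u v)
    then show ?thesis using root_right_local[of r s u v] sep
      by (intro bexI[of _ "leaves s \<union> leaves u \<union> leaves v"]) (auto simp: Un_assoc simp del: local_monomial.simps)
  qed
qed simp

section \<open>Lifting relations from a vertex to the tree\<close>

lemma collapse_prod:
  assumes "collapse \<tau> = s \<odot> t"
  obtains u v where "\<tau> = Node False u v" "collapse u = s" "collapse v = t"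
  using assms by (cases \<tau>) (auto split: if_splits)

text \<open>A converse to \<open>tree_relations_local\<close> at a vertex with three inputs: such a
  vertex consists of two nodes joined by one contracted edge, and the relation is the one at that
  edge. The sign \<open>e\<close> depends on the subtrees above the vertex and is left open.\<close>

lemma relation_left_lift:
  assumes "A \<in> clades \<tau>" "separated \<tau>" "local_monomial \<tau> A = (Var x \<odot> Var y) \<odot> Var z"
  shows "\<exists>e \<sigma>. [(0, 1, \<tau>), (0, e, \<sigma>)] \<in> set (tree_relations \<tau>) \<and> same_except A \<tau> \<sigma>
    \<and> local_monomial \<sigma> A = (Var x \<odot> Var z) \<odot> Var y"
  using assms
proof (induction \<tau>)
  case (Node r s t)
  note sep = Node.prems(2)
  have "A \<in> insert (leaves (Node r s t)) (clades (Node r s t))" using Node.prems(1) by blast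
  then show ?case
  proof (cases rule: clade_cases)
    case 1
    then have "collapse s \<odot> collapse t = (Var x \<odot> Var y) \<odot> Var z" using Node.prems(3) by simp
    then obtain u v where uv: "s = Node False u v" "collapse u = Var x" "collapse v = Var y" "collapse t = Var z"
      by (auto elim: collapse_prod)
    have "[(0, 1, Node r s t), (0, swap_sign v t, Node r (Node False u t) v)] \<in> set (tree_relations (Node r s t))"
      using uv(1) by simp
    moreover have "same_except A (Node r s t) (Node r (Node False u t) v)"
      "local_monomial (Node r (Node False u t) v) A = (Var x \<odot> Var z) \<odot> Var y"
      using root_left_local[of r u v t] sep uv 1 by (simp_all del: local_monomial.simps)
    ultimately show ?thesis by blast
  next
    case 2
    have "local_monomial s A = (Var x \<odot> Var y) \<odot> Var z"
      using Node.prems(3) local_left[OF sep 2 refl refl, of r] by simp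
    then obtain e s' where s': "[(0, 1, s), (0, e, s')] \<in> set (tree_relations s)" "same_except A s s'"
      "local_monomial s' A = (Var x \<odot> Var z) \<odot> Var y" using Node.IH(1)[OF 2] sep by auto
    then have "[(0, 1, Node r s t), (0, e, Node r s' t)] \<in> set (tree_relations (Node r s t))"
      by (force intro: rev_image_eqI)
    moreover have "leaves s' = leaves s" "real_root s' = real_root s"
      using tree_relations_shape(1,4)[OF s'(1), of 0 e s'] by auto
    ultimately show ?thesis using same_except_left[OF sep _ _ s'(2) 2] s'(3) by metis
  next
    case 3
    have "local_monomial t A = (Var x \<odot> Var y) \<odot> Var z"
      using Node.prems(3) local_right[OF sep 3 refl refl, of r] by simp
    then obtain e t' where t': "[(0, 1, t), (0, e, t')] \<in> set (tree_relations t)" "same_except A t t'"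
      "local_monomial t' A = (Var x \<odot> Var z) \<odot> Var y" using Node.IH(2)[OF 3] sep by auto
    then have "[(0, 1, Node r s t), (0, e, Node r s t')] \<in> set (tree_relations (Node r s t))"
      by (force intro: rev_image_eqI)
    moreover have "leaves t' = leaves t" "real_root t' = real_root t"
      using tree_relations_shape(1,4)[OF t'(1), of 0 e t'] by auto
    ultimately show ?thesis using same_except_right[OF sep _ _ t'(2) 3] t'(3) by metis
  qed
qed simp

text \<open>The second relation is listed at right-nested products only, where the given tree itself
  is the third entry, with sign 1. Lifting it from there suffices to treat all four terms.\<close>

lemma relation_right_lift:
  assumes "A \<in> clades \<tau>" "separated \<tau>" "local_monomial \<tau> A = Var x \<odot> (Var y \<odot> Var z)"
  shows "\<exists>e1 e2 e3 \<sigma>1 \<sigma>2 \<sigma>3. [(1, e1, \<sigma>1), (1, e2, \<sigma>2), (0, 1, \<tau>), (0, e3, \<sigma>3)] \<in> set (tree_relations \<tau>)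
    \<and> same_except A \<tau> \<sigma>1 \<and> same_except A \<tau> \<sigma>2 \<and> same_except A \<tau> \<sigma>3
    \<and> local_monomial \<sigma>1 A = (Var x \<odot> Var y) \<odot> Var z \<and> local_monomial \<sigma>2 A = (Var y \<odot> Var x) \<odot> Var z
    \<and> local_monomial \<sigma>3 A = Var y \<odot> (Var x \<odot> Var z)"
  using assms
proof (induction \<tau>)
  case (Node r s t)
  note sep = Node.prems(2)
  have "A \<in> insert (leaves (Node r s t)) (clades (Node r s t))" using Node.prems(1) by blast
  then show ?case
  proof (cases rule: clade_cases)
    case 1
    then have "collapse s \<odot> collapse t = Var x \<odot> (Var y \<odot> Var z)" using Node.prems(3) by simp
    then obtain u v where uv: "t = Node False u v" "collapse s = Var x" "collapse u = Var y" "collapse v = Var z"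
      by (auto elim: collapse_prod)
    have "[(1, 1, Node r (Node False s u) v), (1, swap_sign s u, Node r (Node False u s) v),
         (0, 1, Node r s t), (0, swap_sign s u, Node r u (Node False s v))] \<in> set (tree_relations (Node r s t))"
      using uv(1) by simp
    moreover have "A = leaves s \<union> leaves u \<union> leaves v" using 1 uv(1) by auto
    ultimately show ?thesis
      using root_right_local[of r s u v] sep uv by (metis (no_types, lifting))
  next
    case 2
    have "local_monomial s A = Var x \<odot> (Var y \<odot> Var z)"
      using Node.prems(3) local_left[OF sep 2 refl refl, of r] by simp
    then obtain e1 e2 e3 s1 s2 s3 where s': "[(1, e1, s1), (1, e2, s2), (0, 1, s), (0, e3, s3)] \<in> set (tree_relations s)"
      "same_except A s s1" "same_except A s s2" "same_except A s s3" "local_monomial s1 A = (Var x \<odot> Var y) \<odot> Var z"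
      "local_monomial s2 A = (Var y \<odot> Var x) \<odot> Var z" "local_monomial s3 A = Var y \<odot> (Var x \<odot> Var z)"
      using Node.IH(1)[OF 2] sep by auto
    then have "[(1, e1, Node r s1 t), (1, e2, Node r s2 t), (0, 1, Node r s t), (0, e3, Node r s3 t)]
      \<in> set (tree_relations (Node r s t))" by (force intro: rev_image_eqI)
    moreover have "leaves s1 = leaves s" "real_root s1 = real_root s" "leaves s2 = leaves s" "real_root s2 = real_root s"
       "leaves s3 = leaves s" "real_root s3 = real_root s"
      using tree_relations_shape(1,4)[OF s'(1), of 1 e1 s1] tree_relations_shape(1,4)[OF s'(1), of 1 e2 s2]
        tree_relations_shape(1,4)[OF s'(1), of 0 e3 s3] by auto
    ultimately show ?thesis using same_except_left[OF sep _ _ s'(2) 2] same_except_left[OF sep _ _ s'(3) 2]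
      same_except_left[OF sep _ _ s'(4) 2] s'(5-7) by (metis (no_types, lifting))
  next
    case 3
    have "local_monomial t A = Var x \<odot> (Var y \<odot> Var z)"
      using Node.prems(3) local_right[OF sep 3 refl refl, of r] by simp
    then obtain e1 e2 e3 t1 t2 t3 where t': "[(1, e1, t1), (1, e2, t2), (0, 1, t), (0, e3, t3)] \<in> set (tree_relations t)"
      "same_except A t t1" "same_except A t t2" "same_except A t t3" "local_monomial t1 A = (Var x \<odot> Var y) \<odot> Var z"
      "local_monomial t2 A = (Var y \<odot> Var x) \<odot> Var z" "local_monomial t3 A = Var y \<odot> (Var x \<odot> Var z)"
      using Node.IH(2)[OF 3] sep by auto
    then have "[(1, e1, Node r s t1), (1, e2, Node r s t2), (0, 1, Node r s t), (0, e3, Node r s t3)]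
      \<in> set (tree_relations (Node r s t))" by (force intro: rev_image_eqI)
    moreover have "leaves t1 = leaves t" "real_root t1 = real_root t" "leaves t2 = leaves t" "real_root t2 = real_root t"
       "leaves t3 = leaves t" "real_root t3 = real_root t"
      using tree_relations_shape(1,4)[OF t'(1), of 1 e1 t1] tree_relations_shape(1,4)[OF t'(1), of 1 e2 t2]
        tree_relations_shape(1,4)[OF t'(1), of 0 e3 t3] by auto
    ultimately show ?thesis using same_except_right[OF sep _ _ t'(2) 3] same_except_right[OF sep _ _ t'(3) 3]
      same_except_right[OF sep _ _ t'(4) 3] t'(5-7) by (metis (no_types, lifting))
  qed
qed simp

section \<open>Multilinear functionals on decorations\<close>

lemma coset_zero:
  assumes "finite I" "p \<in> mn_ideal \<delta> I"
  shows "ideal_coset \<delta> I p = ideal_coset \<delta> I 0"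
  using assms by (intro M.coset_eq) (auto simp: free_space M.mem_coset free_vadd)

context
  fixes \<delta> :: complex and H :: "nat set set" and f :: "(nat set \<Rightarrow> nonassoc_poly set) \<Rightarrow> complex"
    and d :: "nat set \<Rightarrow> nonassoc_poly set" and A :: "nat set" and g :: "nonassoc_poly \<Rightarrow> complex"
  assumes ml: "multilinear_functional (mock_novikov_operad \<delta>) H f"
    and d: "d \<in> decorations (mock_novikov_operad \<delta>) H" and A: "A \<in> H" "finite (inputs H A)"
  defines "g \<equiv> \<lambda>p. f (d(A := ideal_coset \<delta> (inputs H A) p))"
begin

lemma multilinear_slot:
  assumes "Poly_Mapping.keys p \<subseteq> monomials (inputs H A)"
  shows "Poly_Mapping.keys q \<subseteq> monomials (inputs H A) \<Longrightarrow> g (p + q) = g p + g q"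
    and "g (cscale c p) = c * g p"
proof -
  let ?Q = "mock_novikov_operad \<delta>" and ?I = "inputs H A"
  have p: "p \<in> op_space free_binary_operad ?I" using assms by (simp add: free_space)
  then have P: "ideal_coset \<delta> ?I p \<in> op_space ?Q ?I"
    by (simp add: mock_novikov_operad_eq M.Q_space)
  have "f (d(A := vscale ?Q ?I c (ideal_coset \<delta> ?I p))) = c * g p"
    using ml d A(1) P unfolding multilinear_functional_def g_def by blast
  then show "g (cscale c p) = c * g p"
    using M.Q_vscale[OF A(2) p, of \<delta> c] by (simp only: g_def mock_novikov_operad_eq free_vscale)
  assume "Poly_Mapping.keys q \<subseteq> monomials (inputs H A)"
  then have q: "q \<in> op_space free_binary_operad ?I" by (simp add: free_space)
  then have "ideal_coset \<delta> ?I q \<in> op_space ?Q ?I"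
    by (simp add: mock_novikov_operad_eq M.Q_space)
  then have "f (d(A := vadd ?Q ?I (ideal_coset \<delta> ?I p) (ideal_coset \<delta> ?I q))) = g p + g q"
    using ml d A(1) P unfolding multilinear_functional_def g_def by blast
  then show "g (p + q) = g p + g q"
    using M.Q_vadd[OF A(2) p q, of \<delta>] by (simp only: g_def mock_novikov_operad_eq free_vadd)
qed

lemma multilinear_slot_ideal:
  assumes "p \<in> mn_ideal \<delta> (inputs H A)"
  shows "g p = 0"
proof -
  have "g p = g (cscale 0 0)" using coset_zero[OF A(2) assms] by (simp add: g_def)
  also have "\<dots> = 0" by (subst multilinear_slot(2)) simp_all
  finally show ?thesis .
qed

lemma multilinear_slot_relation_poly:
  assumes "\<And>k t. (k, t) \<in> set L \<Longrightarrow> t \<in> monomials (inputs H A)"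
  shows "g (relation_poly \<delta> L) = (\<Sum>(k, t)\<leftarrow>L. \<delta> ^ k * g (mon t))
    \<and> Poly_Mapping.keys (relation_poly \<delta> L) \<subseteq> monomials (inputs H A)"
  using assms
proof (induction L)
  case Nil
  have "g 0 = 0" using multilinear_slot(2)[of 0 0] by simp
  then show ?case by (simp add: relation_poly_def)
next
  case (Cons x L)
  obtain k t where x: "x = (k, t)" by force
  have t: "Poly_Mapping.keys (cscale (\<delta> ^ k) (mon t)) \<subseteq> monomials (inputs H A)"
    using Cons.prems[of k t] x keys_cscale[of "\<delta> ^ k" "mon t"] by auto
  have eq: "relation_poly \<delta> (x # L) = cscale (\<delta> ^ k) (mon t) + relation_poly \<delta> L"
    by (simp add: relation_poly_def x)
  have IH: "g (relation_poly \<delta> L) = (\<Sum>(k, t)\<leftarrow>L. \<delta> ^ k * g (mon t))"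
    "Poly_Mapping.keys (relation_poly \<delta> L) \<subseteq> monomials (inputs H A)" using Cons by auto
  have "g (cscale (\<delta> ^ k) (mon t)) = \<delta> ^ k * g (mon t)"
    using Cons.prems[of k t] x by (intro multilinear_slot(2)) auto
  then show ?case
    using multilinear_slot(1)[OF t IH(2)] IH keys_add[of "cscale (\<delta> ^ k) (mon t)" "relation_poly \<delta> L"] t
    unfolding eq by (auto simp: x)
qed

lemma multilinear_slot_sum:
  assumes "finite S" "\<And>s. s \<in> S \<Longrightarrow> s \<in> monomials (inputs H A)"
  shows "g (\<Sum>s\<in>S. cscale (c s) (mon s)) = (\<Sum>s\<in>S. c s * g (mon s))
    \<and> Poly_Mapping.keys (\<Sum>s\<in>S. cscale (c s) (mon s)) \<subseteq> monomials (inputs H A)"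
  using assms
proof (induction S)
  case empty
  have "g 0 = 0" using multilinear_slot(2)[of 0 0] by simp
  then show ?case by simp
next
  case (insert s S)
  have s: "Poly_Mapping.keys (cscale (c s) (mon s)) \<subseteq> monomials (inputs H A)"
    using insert.prems[of s] keys_cscale[of "c s" "mon s"] by auto
  have IH: "g (\<Sum>s\<in>S. cscale (c s) (mon s)) = (\<Sum>s\<in>S. c s * g (mon s))"
    "Poly_Mapping.keys (\<Sum>s\<in>S. cscale (c s) (mon s)) \<subseteq> monomials (inputs H A)" using insert by auto
  have "g (cscale (c s) (mon s)) = c s * g (mon s)"
    using insert.prems[of s] by (intro multilinear_slot(2)) auto
  then show ?case
    using multilinear_slot(1)[OF s IH(2)] IH s insert.hyps
      keys_add[of "cscale (c s) (mon s)" "\<Sum>s\<in>S. cscale (c s) (mon s)"] by auto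
qed

lemma multilinear_slot_expand:
  assumes "Poly_Mapping.keys p \<subseteq> monomials (inputs H A)" "\<And>s. s \<in> monomials (inputs H A) \<Longrightarrow> g (mon s) = 0"
  shows "g p = 0"
proof -
  have "p = (\<Sum>s\<in>Poly_Mapping.keys p. cscale (Poly_Mapping.lookup p s) (mon s))"
    by (subst lin_ext_mon_id[symmetric], rule lin_ext_def)
  then have "g p = (\<Sum>s\<in>Poly_Mapping.keys p. Poly_Mapping.lookup p s * g (mon s))"
    using multilinear_slot_sum[of "Poly_Mapping.keys p" "Poly_Mapping.lookup p"] assms(1) by auto
  then show ?thesis using assms by (auto intro!: sum.neutral)
qed

end

lemma decor_same_except:
  assumes "clades \<sigma> = clades \<tau>" "same_except A \<tau> \<sigma>" "A \<in> clades \<tau>"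
  shows "decor \<delta> \<sigma> = (decor \<delta> \<tau>)(A := ideal_coset \<delta> (inputs (clades \<tau>) A) (mon (local_monomial \<sigma> A)))"
  using assms by (auto simp: decor_def same_except_def fun_eq_iff)

text \<open>No sign \<open>e\<close> occurs here: the trees in a relation have the same clades, so
  one functional \<open>f\<close> with one order of edges evaluates them all. The signs come in with
  \<open>orientation\<close>.\<close>

lemma functional_tree_relations:
  assumes ml: "multilinear_functional (mock_novikov_operad \<delta>) (clades \<tau>) f"
    and L: "L \<in> set (tree_relations \<tau>)" and \<tau>: "marked_tree n \<tau>"
  shows "(\<Sum>(k, e, \<sigma>)\<leftarrow>L. \<delta> ^ k * f (decor \<delta> \<sigma>)) = 0"
proof -
  have sep: "separated \<tau>" "leaves \<tau> \<in> clades \<tau>" using \<tau> by (auto simp: marked_tree_def)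
  obtain A where A: "A \<in> insert (leaves \<tau>) (clades \<tau>)"
    and rel: "map (\<lambda>(k, e, \<sigma>). (k, local_monomial \<sigma> A)) L \<in> set (relations (local_monomial \<tau> A))"
    and same: "\<forall>k e \<sigma>. (k, e, \<sigma>) \<in> set L \<longrightarrow> same_except A \<tau> \<sigma>"
    using tree_relations_local[OF L sep(1)] by (elim bexE conjE)
  have A: "A \<in> clades \<tau>" using A sep(2) by blast
  let ?I = "inputs (clades \<tau>) A" and ?L = "map (\<lambda>(k, e, \<sigma>). (k, local_monomial \<sigma> A)) L"
  let ?g = "\<lambda>p. f ((decor \<delta> \<tau>)(A := ideal_coset \<delta> ?I p))"
  note slot = ml decor_decorations[OF sep(1)] A finite_inputs[OF A]
  have mem: "t \<in> monomials ?I" if kt: "(k, t) \<in> set ?L" for k t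
  proof -
    obtain e \<sigma> where "(k, e, \<sigma>) \<in> set L" "t = local_monomial \<sigma> A" using kt by auto
    then show ?thesis
      using local_monomials[of \<sigma> A] tree_relations_shape(2,3)[OF L, of k e \<sigma>] sep(1) A by simp
  qed
  have "relation_poly \<delta> ?L \<in> mn_ideal \<delta> ?I"
    using relations_in_ideal[OF rel multilinear_local[OF sep(1)]] labels_local[OF sep(1) A] by simp
  then have "?g (relation_poly \<delta> ?L) = 0" by (rule multilinear_slot_ideal[OF slot])
  then have "(\<Sum>(k, t)\<leftarrow>?L. \<delta> ^ k * ?g (mon t)) = 0"
    using multilinear_slot_relation_poly[OF slot, of ?L] mem by (simp only:)
  moreover have "decor \<delta> \<sigma> = (decor \<delta> \<tau>)(A := ideal_coset \<delta> ?I (mon (local_monomial \<sigma> A)))"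
    if "(k, e, \<sigma>) \<in> set L" for k e \<sigma>
    using decor_same_except[OF _ _ A] tree_relations_shape(3)[OF L that] same that by blast
  then have "(\<Sum>(k, e, \<sigma>)\<leftarrow>L. \<delta> ^ k * f (decor \<delta> \<sigma>)) = (\<Sum>(k, t)\<leftarrow>?L. \<delta> ^ k * ?g (mon t))"
    by (auto intro!: arg_cong[of _ _ sum_list] simp: o_def)
  ultimately show ?thesis by simp
qed

text \<open>The decorations are expanded into monomials at one vertex after another;
  \<open>S\<close> collects the vertices still to be expanded.\<close>

lemma functional_zero:
  assumes ml: "multilinear_functional (mock_novikov_operad \<delta>) H f"
    and fin: "finite H" "\<And>A. A \<in> H \<Longrightarrow> finite (inputs H A)"
    and zero: "\<And>t. t \<in> (\<Pi>\<^sub>E A\<in>H. monomials (inputs H A))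
      \<Longrightarrow> f (restrict (\<lambda>A. ideal_coset \<delta> (inputs H A) (mon (t A))) H) = 0"
    and d: "d \<in> decorations (mock_novikov_operad \<delta>) H"
  shows "f d = 0"
proof -
  have "f d = 0" if "S \<subseteq> H" "d \<in> decorations (mock_novikov_operad \<delta>) H"
    "\<And>A. A \<in> H - S \<Longrightarrow> \<exists>t\<in>monomials (inputs H A). d A = ideal_coset \<delta> (inputs H A) (mon t)" for S d
    using finite_subset[OF that(1) fin(1)] that
  proof (induction S arbitrary: d)
    case empty
    then obtain t where t: "\<And>A. A \<in> H \<Longrightarrow> t A \<in> monomials (inputs H A) \<and> d A = ideal_coset \<delta> (inputs H A) (mon (t A))"
      by (metis Diff_empty)
    have eq: "d = restrict (\<lambda>A. ideal_coset \<delta> (inputs H A) (mon (restrict t H A))) H"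
    proof
      fix A
      show "d A = restrict (\<lambda>A. ideal_coset \<delta> (inputs H A) (mon (restrict t H A))) H A"
        using t[of A] empty.prems(2) by (cases "A \<in> H") (auto simp: decorations_def PiE_def extensional_def)
    qed
    show ?case unfolding eq by (rule zero) (use t in auto)
  next
    case (insert A S)
    have A: "A \<in> H" and "d A \<in> op_space (mock_novikov_operad \<delta>) (inputs H A)"
      using insert.prems(1,2) by (auto simp: decorations_def)
    then obtain p where p: "Poly_Mapping.keys p \<subseteq> monomials (inputs H A)" "d A = ideal_coset \<delta> (inputs H A) p"
      by (auto simp: mock_novikov_operad_eq M.Q_space free_space)
    have "f (d(A := ideal_coset \<delta> (inputs H A) (mon s))) = 0" if s: "s \<in> monomials (inputs H A)" for s
    proof (rule insert.IH)
      show "d(A := ideal_coset \<delta> (inputs H A) (mon s)) \<in> decorations (mock_novikov_operad \<delta>) H"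
        using PiE_fun_upd[of "ideal_coset \<delta> (inputs H A) (mon s)" "\<lambda>A. op_space (mock_novikov_operad \<delta>) (inputs H A)" A d H]
          insert.prems(2) insert_absorb[OF A] mon_space[OF s]
        by (simp add: decorations_def mock_novikov_operad_eq M.Q_space)
      fix B assume B: "B \<in> H - S"
      show "\<exists>t\<in>monomials (inputs H B). (d(A := ideal_coset \<delta> (inputs H A) (mon s))) B = ideal_coset \<delta> (inputs H B) (mon t)"
        using s insert.prems(3)[of B] B by (cases "B = A") auto
    qed (use insert.prems in auto)
    then have "f (d(A := ideal_coset \<delta> (inputs H A) p)) = 0"
      by (rule multilinear_slot_expand[OF ml insert.prems(2) A fin(2)[OF A] p(1)])
    then show ?case using p(2) by (metis fun_upd_triv)
  qed
  from this[of H d] show ?thesis using d by blast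
qed

section \<open>Assembling a tree from the monomials at its vertices\<close>

primrec plug :: "('a \<Rightarrow> 'b mtree) \<Rightarrow> 'a monomial \<Rightarrow> 'b mtree" where
  "plug f (Var x) = f x"
| "plug f (s \<odot> t) = Node False (plug f s) (plug f t)"

lemma plug_props:
  assumes "multilinear m" "\<And>x. x \<in> labels m \<Longrightarrow> separated (f x)" "\<And>x. x \<in> labels m \<Longrightarrow> collapse (f x) = Var x"
    "\<And>x y. x \<in> labels m \<Longrightarrow> y \<in> labels m \<Longrightarrow> x \<noteq> y \<Longrightarrow> leaves (f x) \<inter> leaves (f y) = {}"
  shows "separated (plug f m)" "leaves (plug f m) = (\<Union>x\<in>labels m. leaves (f x))"
    "clades (plug f m) = (\<Union>x\<in>labels m. clades (f x))" "collapse (plug f m) = m"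
    "\<And>x B. x \<in> labels m \<Longrightarrow> B \<in> clades (f x) \<Longrightarrow> local_monomial (plug f m) B = local_monomial (f x) B"
proof -
  have "separated (plug f m) \<and> leaves (plug f m) = (\<Union>x\<in>labels m. leaves (f x))
    \<and> clades (plug f m) = (\<Union>x\<in>labels m. clades (f x)) \<and> collapse (plug f m) = m
    \<and> (\<forall>x\<in>labels m. \<forall>B\<in>clades (f x). local_monomial (plug f m) B = local_monomial (f x) B)"
    using assms
  proof (induction m)
    case (Prod s t)
    have IHs: "separated (plug f s)" "leaves (plug f s) = (\<Union>x\<in>labels s. leaves (f x))"
      "clades (plug f s) = (\<Union>x\<in>labels s. clades (f x))" "collapse (plug f s) = s"
      "\<forall>x\<in>labels s. \<forall>B\<in>clades (f x). local_monomial (plug f s) B = local_monomial (f x) B"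
      using Prod.IH(1) Prod.prems by simp_all
    have IHt: "separated (plug f t)" "leaves (plug f t) = (\<Union>x\<in>labels t. leaves (f x))"
      "clades (plug f t) = (\<Union>x\<in>labels t. clades (f x))" "collapse (plug f t) = t"
      "\<forall>x\<in>labels t. \<forall>B\<in>clades (f x). local_monomial (plug f t) B = local_monomial (f x) B"
      using Prod.IH(2) Prod.prems by simp_all
    have "leaves (f x) \<inter> leaves (f y) = {}" if "x \<in> labels s" "y \<in> labels t" for x y
      using Prod.prems(4)[of x y] Prod.prems(1) that by auto
    then have "leaves (plug f s) \<inter> leaves (plug f t) = {}" unfolding IHs(2) IHt(2) by blast
    then have sep: "separated (plug f (s \<odot> t))" using IHs(1) IHt(1) by simp
    have "local_monomial (plug f (s \<odot> t)) B = local_monomial (f x) B"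
      if "x \<in> labels (s \<odot> t)" "B \<in> clades (f x)" for x B
    proof (cases "x \<in> labels s")
      case True
      then have B: "B \<in> clades (plug f s)" using that(2) IHs(3) by blast
      show ?thesis
        unfolding plug.simps using local_left[OF sep[unfolded plug.simps] B refl refl, of False] IHs(5) True that(2) by simp
    next
      case False
      then have x: "x \<in> labels t" using that(1) by simp
      then have B: "B \<in> clades (plug f t)" using that(2) IHt(3) by blast
      show ?thesis
        unfolding plug.simps using local_right[OF sep[unfolded plug.simps] B refl refl, of False] IHt(5) x that(2) by simp
    qed
    then show ?case using sep IHs(2-4) IHt(2-4) by (simp add: Un_ac)
  qed simp
  then show "separated (plug f m)" "leaves (plug f m) = (\<Union>x\<in>labels m. leaves (f x))"
    "clades (plug f m) = (\<Union>x\<in>labels m. clades (f x))" "collapse (plug f m) = m"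
    "\<And>x B. x \<in> labels m \<Longrightarrow> B \<in> clades (f x) \<Longrightarrow> local_monomial (plug f m) B = local_monomial (f x) B"
    by blast+
qed

text \<open>An input of \<open>A\<close> is either a leaf or the minimum of a maximal member of
  \<open>H\<close> properly inside \<open>A\<close>. The trees over these members exist by
  induction, and they are plugged into the monomial \<open>t A\<close>.\<close>

lemma assemble:
  assumes H: "reduced_tree n H" and t: "\<And>A. A \<in> H \<Longrightarrow> t A \<in> monomials (inputs H A)"
  shows "A \<in> H \<Longrightarrow> \<exists>\<tau>. separated \<tau> \<and> real_root \<tau> \<and> leaves \<tau> = A \<and> clades \<tau> = {B \<in> H. B \<subseteq> A}
    \<and> (\<forall>B\<in>clades \<tau>. local_monomial \<tau> B = t B)"
proof (induction "card A" arbitrary: A rule: less_induct)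
  case less
  note A = less.prems
  have H1: "B \<subseteq> {1..n}" "2 \<le> card B" if "B \<in> H" for B using H that by (auto simp: reduced_tree_def)
  have H2: "B \<subseteq> C \<or> C \<subseteq> B \<or> B \<inter> C = {}" if "B \<in> H" "C \<in> H" for B C
    using H that by (simp add: reduced_tree_def)
  have fin: "finite B" if "B \<in> H" for B using H1(1)[OF that] finite_subset by blast
  have finH: "finite H" by (rule finite_subset[of _ "Pow {1..n}"]) (use H1(1) in auto)
  define I where "I = inputs H A"
  have maximal: "\<exists>M\<in>H. M \<subset> A \<and> x \<in> M \<and> (\<forall>B\<in>H. B \<subset> A \<and> B \<inter> M \<noteq> {} \<longrightarrow> B \<subseteq> M)"
    if "B \<in> H" "B \<subset> A" "x \<in> B" for x B
  proof -
    have "finite {B \<in> H. B \<subset> A \<and> x \<in> B}" "{B \<in> H. B \<subset> A \<and> x \<in> B} \<noteq> {}" using finH that by auto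
    from finite_has_maximal[OF this] obtain M where
      M: "M \<in> {B \<in> H. B \<subset> A \<and> x \<in> B}" "\<forall>C\<in>{B \<in> H. B \<subset> A \<and> x \<in> B}. M \<subseteq> C \<longrightarrow> M = C"
      by (elim bexE)
    have "C \<subseteq> M" if C: "C \<in> H" "C \<subset> A" "C \<inter> M \<noteq> {}" for C
    proof (rule ccontr)
      assume "\<not> C \<subseteq> M"
      then have "M \<subseteq> C" using H2[of C M] C M(1) by blast
      then show False using M C \<open>\<not> C \<subseteq> M\<close> by blast
    qed
    then show ?thesis using M(1) by blast
  qed
  have Min_I: "Min M \<in> I" if "M \<in> H" "M \<subset> A" "\<forall>B\<in>H. B \<subset> A \<and> B \<inter> M \<noteq> {} \<longrightarrow> B \<subseteq> M" for M
  proof -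
    have M: "Min M \<in> M" using that(1) fin H1(2) by (metis Min_in card.empty not_numeral_le_zero)
    have "Min M = Min B" if "B \<in> H" "B \<subset> A" "Min M \<in> B" for B
    proof -
      have "B \<subseteq> M" using that \<open>\<forall>B\<in>H. _\<close> M by blast
      then show ?thesis using that(3) fin[OF \<open>M \<in> H\<close>] by (intro Min_eqI[symmetric]) (auto intro: finite_subset)
    qed
    then show ?thesis using M that(2) by (auto simp: I_def inputs_def)
  qed
  \<comment> \<open>\<open>T\<close> is what gets attached at the input \<open>x\<close>. The last
    conjunct expresses maximality; it makes the attached leaf sets disjoint and exhaustive, and it
    places every smaller member of \<open>H\<close> inside one of them.\<close>
  define good where "good x T \<longleftrightarrow> separated T \<and> collapse T = Var x \<and> x \<in> leaves T \<and> leaves T \<subset> A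
    \<and> clades T = {B \<in> H. B \<subseteq> leaves T} \<and> (\<forall>B\<in>clades T. local_monomial T B = t B)
    \<and> (leaves T = {x} \<or> leaves T \<in> H) \<and> (\<forall>B\<in>H. B \<subset> A \<and> B \<inter> leaves T \<noteq> {} \<longrightarrow> B \<subseteq> leaves T)" for x T
  have "\<exists>T. good x T" if x: "x \<in> I" for x
  proof (cases "\<exists>B\<in>H. B \<subset> A \<and> x \<in> B")
    case True
    then obtain M where M: "M \<in> H" "M \<subset> A" "x \<in> M" "\<forall>B\<in>H. B \<subset> A \<and> B \<inter> M \<noteq> {} \<longrightarrow> B \<subseteq> M"
      using maximal by metis
    have "card M < card A" using M(2) fin[OF A] by (rule psubset_card_mono[rotated])
    then obtain T where T: "separated T" "real_root T" "leaves T = M" "clades T = {B \<in> H. B \<subseteq> M}"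
      "\<forall>B\<in>clades T. local_monomial T B = t B" using less.hyps[OF _ M(1)] by blast
    have "x = Min M" using x M(1-3) by (auto simp: I_def inputs_def)
    then have "collapse T = Var x" using T(2,3) by (simp add: collapse_local)
    then have "good x T" unfolding good_def using T M by simp
    then show ?thesis by blast
  next
    case False
    have "x \<in> A" using x by (simp add: I_def inputs_def)
    moreover have "A \<noteq> {x}" using H1(2)[OF A] by auto
    moreover have "\<not> B \<subseteq> {x}" if "B \<in> H" for B
      using H1(2)[OF that] card_mono[of "{x}" B] by auto
    ultimately have "good x (Leaf x)" unfolding good_def using False by auto
    then show ?thesis by blast
  qed
  then obtain T where T: "\<And>x. x \<in> I \<Longrightarrow> good x (T x)" by metis
  have T1: "separated (T x)" "collapse (T x) = Var x" "x \<in> leaves (T x)" "leaves (T x) \<subset> A"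
    "clades (T x) = {B \<in> H. B \<subseteq> leaves (T x)}" "\<forall>B\<in>clades (T x). local_monomial (T x) B = t B"
    "leaves (T x) = {x} \<or> leaves (T x) \<in> H" if "x \<in> I" for x
    using T[OF that] unfolding good_def by - ((elim conjE, assumption)+)
  have T8: "B \<subseteq> leaves (T x)" if "x \<in> I" "B \<in> H" "B \<subset> A" "B \<inter> leaves (T x) \<noteq> {}" for x B
  proof -
    have "\<forall>B\<in>H. B \<subset> A \<and> B \<inter> leaves (T x) \<noteq> {} \<longrightarrow> B \<subseteq> leaves (T x)"
      using T[OF that(1)] unfolding good_def by (elim conjE) assumption
    then show ?thesis using that(2-4) by blast
  qed
  have I_eq: "x = Min B" if "x \<in> I" "B \<in> H" "B \<subset> A" "x \<in> B" for x B
    using that by (auto simp: I_def inputs_def)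
  have dis: "leaves (T x) \<inter> leaves (T y) = {}" if xy: "x \<in> I" "y \<in> I" "x \<noteq> y" for x y
  proof (rule ccontr)
    assume ne: "leaves (T x) \<inter> leaves (T y) \<noteq> {}"
    \<comment> \<open>If two attached leaf sets meet, one of them is a member of \<open>H\<close>
      that contains both input names. Each name is then its minimum, so the names agree.\<close>
    have "y \<in> leaves (T x) \<and> leaves (T x) \<in> H \<or> x \<in> leaves (T y) \<and> leaves (T y) \<in> H"
    proof (cases "leaves (T y) \<in> H")
      case True
      then have "leaves (T y) \<subseteq> leaves (T x)" using T8[OF xy(1)] T1(4)[OF xy(2)] ne by (simp add: Int_commute)
      then show ?thesis using T1(3,7)[OF xy(1)] T1(3)[OF xy(2)] xy(3) by auto
    next
      case False
      then have "leaves (T y) = {y}" using T1(7)[OF xy(2)] by blast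
      then show ?thesis using ne T1(7)[OF xy(1)] xy(3) by auto
    qed
    then show False
      using I_eq[OF xy(1)] I_eq[OF xy(2)] T1(3,4)[OF xy(1)] T1(3,4)[OF xy(2)] xy(3) by metis
  qed
  have union: "(\<Union>x\<in>I. leaves (T x)) = A"
  proof
    show "(\<Union>x\<in>I. leaves (T x)) \<subseteq> A" using T1(4) by blast
    show "A \<subseteq> (\<Union>x\<in>I. leaves (T x))"
    proof
      fix a assume a: "a \<in> A"
      show "a \<in> (\<Union>x\<in>I. leaves (T x))"
      proof (cases "\<exists>B\<in>H. B \<subset> A \<and> a \<in> B")
        case True
        then obtain M where M: "M \<in> H" "M \<subset> A" "a \<in> M" "\<forall>B\<in>H. B \<subset> A \<and> B \<inter> M \<noteq> {} \<longrightarrow> B \<subseteq> M"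
          using maximal by metis
        have I: "Min M \<in> I" using Min_I[OF M(1,2,4)] .
        moreover have "Min M \<in> M" using M(1,3) fin by (metis Min_in empty_iff)
        then have "M \<subseteq> leaves (T (Min M))" using T8[OF I M(1,2)] T1(3)[OF I] by blast
        ultimately show ?thesis using M(3) by blast
      next
        case False
        then have "a \<in> I" using a by (auto simp: I_def inputs_def)
        then show ?thesis using T1(3) by blast
      qed
    qed
  qed
  have m: "multilinear (t A)" "labels (t A) = I" using t[OF A] by (simp_all add: monomials_def I_def)
  \<comment> \<open>A single variable would mean a single input whose leaves fill \<open>A\<close>,
    whereas attached leaf sets are proper.\<close>
  obtain s u where su: "t A = s \<odot> u"
  proof (cases "t A")
    case (Var x)
    then have "I = {x}" using m(2) by simp
    then show ?thesis using union T1(4)[of x] by simp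
  qed
  note pp = plug_props[OF m(1), of T, unfolded m(2), OF T1(1) T1(2) dis, simplified]
  define \<tau> where "\<tau> = Node True (plug T s) (plug T u)"
  have plug: "plug T (t A) = Node False (plug T s) (plug T u)" by (simp add: su)
  have lv: "leaves \<tau> = A" using pp(2) union unfolding plug by (simp add: \<tau>_def)
  have sep: "separated \<tau>" using pp(1) unfolding plug by (simp add: \<tau>_def)
  have cl: "clades \<tau> = insert A (\<Union>x\<in>I. clades (T x))"
    using pp(3) lv unfolding plug by (auto simp: \<tau>_def)
  have "(\<Union>x\<in>I. clades (T x)) = {B \<in> H. B \<subset> A}"
  proof (intro equalityI subsetI)
    fix B assume "B \<in> (\<Union>x\<in>I. clades (T x))"
    then show "B \<in> {B \<in> H. B \<subset> A}" using T1(4,5) by blast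
  next
    fix B assume B: "B \<in> {B \<in> H. B \<subset> A}"
    then obtain b where "b \<in> B" using H1(2) by fastforce
    then obtain x where x: "x \<in> I" "b \<in> leaves (T x)" using B union by blast
    then have "B \<subseteq> leaves (T x)" using T8[OF x(1)] B \<open>b \<in> B\<close> by blast
    then show "B \<in> (\<Union>x\<in>I. clades (T x))" using T1(5)[OF x(1)] B x(1) by blast
  qed
  then have cl': "clades \<tau> = {B \<in> H. B \<subseteq> A}" using cl A by auto
  have "local_monomial \<tau> B = t B" if B: "B \<in> clades \<tau>" for B
  proof (cases "B = A")
    case True
    then have "local_monomial \<tau> B = collapse (plug T s) \<odot> collapse (plug T u)" using lv by (simp add: \<tau>_def)
    also have "\<dots> = collapse (plug T (t A))" unfolding plug by simp
    finally show ?thesis using pp(4) True by simp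
  next
    case False
    then have "B \<in> (\<Union>x\<in>I. clades (T x))" using B cl by simp
    then obtain x where x: "x \<in> I" "B \<in> clades (T x)" by (elim UN_E)
    have "local_monomial \<tau> B = local_monomial (plug T (t A)) B"
      unfolding plug \<tau>_def using local_flag by metis
    then show ?thesis using pp(5)[OF x] T1(6)[OF x(1)] x(2) by simp
  qed
  moreover have "real_root \<tau>" by (simp add: \<tau>_def)
  ultimately show ?case using sep lv cl' by blast
qed

lemma assemble_marked:
  assumes H: "reduced_tree n H" and t: "\<And>A. A \<in> H \<Longrightarrow> t A \<in> monomials (inputs H A)"
  obtains \<tau> where "marked_tree n \<tau>" "clades \<tau> = H" "\<And>A. A \<in> H \<Longrightarrow> local_monomial \<tau> A = t A"
proof -
  have "{1..n} \<in> H" "\<forall>B\<in>H. B \<subseteq> {1..n}" using H by (auto simp: reduced_tree_def)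
  then have "{B \<in> H. B \<subseteq> {1..n}} = H" "{1..n} \<in> H" by blast+
  with assemble[OF H t, of "{1..n}"] obtain \<tau> where \<tau>: "separated \<tau>" "real_root \<tau>" "leaves \<tau> = {1..n}"
    "clades \<tau> = H" "\<forall>B\<in>clades \<tau>. local_monomial \<tau> B = t B" by metis
  then have "marked_tree n \<tau>" by (cases \<tau>) (auto simp: marked_tree_def)
  then show ?thesis using that \<tau> by blast
qed

text \<open>A leaf is an input itself or shares a clade with the input that names its edge. Thus
  inputs and clades determine the leaf set, which is how the leaf sets of the two children are
  recovered in the uniqueness proof.\<close>

lemma leaves_from_collapse:
  "leaves \<tau> = {y. \<exists>x\<in>labels (collapse \<tau>). y = x \<or> (\<exists>C\<in>clades \<tau>. x \<in> C \<and> y \<in> C)}" (is "_ = ?R \<tau>")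
proof
  show "?R \<tau> \<subseteq> leaves \<tau>" using labels_collapse_sub[of \<tau>] clades_sub[of _ \<tau>] by auto
  show "leaves \<tau> \<subseteq> ?R \<tau>"
  proof (induction \<tau>)
    case (Node r s t)
    show ?case
    proof (cases r)
      case True
      have "Min (leaves s \<union> leaves t) \<in> leaves s \<union> leaves t" by (rule Min_in) auto
      then show ?thesis using True by auto
    next
      case False
      have "?R s \<subseteq> ?R (Node r s t)" "?R t \<subseteq> ?R (Node r s t)" using False by auto
      from order_trans[OF Node.IH(1) this(1)] order_trans[OF Node.IH(2) this(2)]
      show ?thesis unfolding mtree.set by (rule Un_least)
    qed
  qed simp
qed

lemma leaves_child:
  assumes "separated (Node r s t)"
  shows "leaves s = {y. \<exists>x\<in>labels (collapse s). y = x \<or>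
      (\<exists>C\<in>clades (Node r s t) - {leaves (Node r s t)}. x \<in> C \<and> y \<in> C)}"
    "leaves t = {y. \<exists>x\<in>labels (collapse t). y = x \<or>
      (\<exists>C\<in>clades (Node r s t) - {leaves (Node r s t)}. x \<in> C \<and> y \<in> C)}"
    "clades s = {C \<in> clades (Node r s t) - {leaves (Node r s t)}. C \<subseteq> leaves s}"
    "clades t = {C \<in> clades (Node r s t) - {leaves (Node r s t)}. C \<subseteq> leaves t}"
proof -
  have cl: "clades (Node r s t) - {leaves (Node r s t)} = clades s \<union> clades t"
    using clades_proper[OF assms] by auto
  have s: "C \<in> clades s" if "C \<in> clades s \<union> clades t" "x \<in> C" "x \<in> labels (collapse s)" for x C
    using that labels_collapse_sub[of s] clades_foreign(1)[of s t x C] assms by auto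
  have t: "C \<in> clades t" if "C \<in> clades s \<union> clades t" "x \<in> C" "x \<in> labels (collapse t)" for x C
    using that labels_collapse_sub[of t] clades_foreign(2)[of s t x C] assms by auto
  show "leaves s = {y. \<exists>x\<in>labels (collapse s). y = x \<or>
      (\<exists>C\<in>clades (Node r s t) - {leaves (Node r s t)}. x \<in> C \<and> y \<in> C)}"
    unfolding cl by (subst leaves_from_collapse) (use s in blast)
  show "leaves t = {y. \<exists>x\<in>labels (collapse t). y = x \<or>
      (\<exists>C\<in>clades (Node r s t) - {leaves (Node r s t)}. x \<in> C \<and> y \<in> C)}"
    unfolding cl by (subst leaves_from_collapse) (use t in blast)
  have "\<not> C \<subseteq> leaves s" if "C \<in> clades t" for C
    using clades_sub[OF that] clades_nonempty[OF that] assms by auto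
  then show "clades s = {C \<in> clades (Node r s t) - {leaves (Node r s t)}. C \<subseteq> leaves s}"
    unfolding cl using clades_sub[of _ s] by blast
  have "\<not> C \<subseteq> leaves t" if "C \<in> clades s" for C
    using clades_sub[OF that] clades_nonempty[OF that] assms by auto
  then show "clades t = {C \<in> clades (Node r s t) - {leaves (Node r s t)}. C \<subseteq> leaves t}"
    unfolding cl using clades_sub[of _ t] by blast
qed

lemma real_root_iff: "separated \<tau> \<Longrightarrow> real_root \<tau> \<longleftrightarrow> leaves \<tau> \<in> clades \<tau>"
  using clades_proper[of _ _ _ "leaves \<tau>"] by (cases \<tau>) auto

text \<open>The monomial at the root splits into the collapses of the two children;
  \<open>leaves_child\<close> then recovers their leaf sets and clades. At a contracted root that
  monomial is \<open>collapse\<close>, at a real one it is the local monomial of the clade at the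
  root.\<close>

lemma tree_eqI:
  assumes "separated \<tau>" "separated \<sigma>" "leaves \<sigma> = leaves \<tau>" "clades \<sigma> = clades \<tau>" "collapse \<sigma> = collapse \<tau>"
    "\<And>A. A \<in> clades \<tau> \<Longrightarrow> local_monomial \<sigma> A = local_monomial \<tau> A"
  shows "\<sigma> = \<tau>"
  using assms
proof (induction \<tau> arbitrary: \<sigma>)
  case (Leaf a)
  show ?case
  proof (cases \<sigma>)
    case (Node r s t)
    then have "leaves s = {a}" "leaves t = {a}" using Leaf.prems(3) by (auto simp: Un_singleton_iff)
    then show ?thesis using Leaf.prems(2) Node by simp
  qed (use Leaf in simp)
next
  case (Node r s t)
  have loc: "local_monomial \<sigma> (leaves \<sigma>) = local_monomial (Node r s t) (leaves (Node r s t))"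
    using Node.prems(3,5,6) real_root_iff[OF Node.prems(1)] real_root_iff[OF Node.prems(2)] Node.prems(4)
    unfolding collapse_local[of \<sigma>] collapse_local[of "Node r s t"] by (auto split: if_splits)
  obtain r' s' t' where \<sigma>: "\<sigma> = Node r' s' t'"
    using loc by (cases \<sigma>) auto
  have "real_root \<sigma> = real_root (Node r s t)"
    unfolding real_root_iff[OF Node.prems(1)] real_root_iff[OF Node.prems(2)] Node.prems(3,4) ..
  then have r: "r' = r" using \<sigma> by simp
  have col: "collapse s' = collapse s" "collapse t' = collapse t" using loc \<sigma> by simp_all
  have sep: "separated (Node r s t)" "separated (Node r' s' t')" using Node.prems \<sigma> by simp_all
  have L: "leaves (Node r' s' t') = leaves (Node r s t)" "clades (Node r' s' t') = clades (Node r s t)"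
    using Node.prems \<sigma> by simp_all
  have lv: "leaves s' = leaves s" "leaves t' = leaves t"
    by (rule trans[OF leaves_child(1)[OF sep(2), unfolded L col] leaves_child(1)[OF sep(1), symmetric]],
        rule trans[OF leaves_child(2)[OF sep(2), unfolded L col] leaves_child(2)[OF sep(1), symmetric]])
  have cl: "clades s' = clades s" "clades t' = clades t"
    by (rule trans[OF leaves_child(3)[OF sep(2), unfolded L lv] leaves_child(3)[OF sep(1), symmetric]],
        rule trans[OF leaves_child(4)[OF sep(2), unfolded L lv] leaves_child(4)[OF sep(1), symmetric]])
  have "s' = s"
  proof (rule Node.IH(1))
    fix A assume A: "A \<in> clades s"
    have "A \<in> clades (Node r s t)" using A by simp
    from Node.prems(6)[OF this] show "local_monomial s' A = local_monomial s A"
      unfolding \<sigma> using local_left[OF sep(1) A lv, of r'] local_left[OF sep(1) A refl refl, of r] by simp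
  qed (use sep lv cl col in simp_all)
  moreover have "t' = t"
  proof (rule Node.IH(2))
    fix A assume A: "A \<in> clades t"
    have "A \<in> clades (Node r s t)" using A by simp
    from Node.prems(6)[OF this] show "local_monomial t' A = local_monomial t A"
      unfolding \<sigma> using local_right[OF sep(1) A lv, of r'] local_right[OF sep(1) A refl refl, of r] by simp
  qed (use sep lv cl col in simp_all)
  ultimately show ?case using \<sigma> r by simp
qed

lemma marked_tree_eqI:
  assumes "marked_tree n \<tau>" "marked_tree n \<sigma>" "clades \<sigma> = clades \<tau>"
    "\<And>A. A \<in> clades \<tau> \<Longrightarrow> local_monomial \<sigma> A = local_monomial \<tau> A"
  shows "\<sigma> = \<tau>"
proof (rule tree_eqI)
  have "real_root \<tau>" "real_root \<sigma>" "leaves \<sigma> = leaves \<tau>" using assms(1,2) by (auto simp: marked_tree_def)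
  then show "collapse \<sigma> = collapse \<tau>" "leaves \<sigma> = leaves \<tau>" by (simp_all add: collapse_local)
qed (use assms in \<open>auto simp: marked_tree_def\<close>)

lemma card_labels_collapse: "card (labels (collapse \<tau>)) \<le> contracted \<tau> + 1"
proof (induction \<tau>)
  case (Node r s t)
  then show ?case using card_Un_le[of "labels (collapse s)" "labels (collapse t)"] by auto
qed simp

lemma card_labels_local: "card (labels (local_monomial \<tau> A)) \<le> contracted \<tau> + 2"
proof (induction \<tau>)
  case (Node r s t)
  then show ?case
    using card_Un_le[of "labels (collapse s)" "labels (collapse t)"] card_labels_collapse[of s] card_labels_collapse[of t]
    by auto
qed simp

section \<open>Cochains from functions on trees\<close>

lemma finite_monomials: "finite I \<Longrightarrow> finite (monomials I)"
proof (induction "card I" arbitrary: I rule: less_induct)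
  case less
  let ?P = "{K. K \<subset> I}"
  have "monomials I \<subseteq> Var ` I \<union> (\<lambda>(s, t). s \<odot> t) ` ((\<Union>K\<in>?P. monomials K) \<times> (\<Union>K\<in>?P. monomials K))"
  proof
    fix m assume m: "m \<in> monomials I"
    show "m \<in> Var ` I \<union> (\<lambda>(s, t). s \<odot> t) ` ((\<Union>K\<in>?P. monomials K) \<times> (\<Union>K\<in>?P. monomials K))"
    proof (cases m)
      case (Prod s t)
      then have "labels s \<subset> I" "labels t \<subset> I" "s \<in> monomials (labels s)" "t \<in> monomials (labels t)"
        using m labels_nonempty[of s] labels_nonempty[of t] by (auto simp: monomials_def simp del: labels_nonempty)
      then show ?thesis using Prod by blast
    qed (use m in \<open>auto simp: monomials_def\<close>)
  qed
  moreover have "finite ?P" using less.prems by (auto intro: finite_subset[of _ "Pow I"])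
  moreover have "finite (monomials K)" if "K \<in> ?P" for K
    using less.hyps[of K] psubset_card_mono[of I K] finite_subset[of K I] less.prems that by blast
  ultimately show ?case using less.prems by (auto intro: finite_subset)
qed

section \<open>Multilinear extension from trees to decorations\<close>

definition assembled :: "nat \<Rightarrow> nat set set \<Rightarrow> (nat set \<Rightarrow> nat monomial) \<Rightarrow> nat mtree" where
  "assembled n H t = (THE \<tau>. marked_tree n \<tau> \<and> clades \<tau> = H \<and> (\<forall>A\<in>H. local_monomial \<tau> A = t A))"

lemma assembledI:
  assumes "marked_tree n \<tau>" "clades \<tau> = H" "\<And>A. A \<in> H \<Longrightarrow> local_monomial \<tau> A = t A"
  shows "assembled n H t = \<tau>"
  unfolding assembled_def
proof (rule the_equality)
  fix \<sigma> assume "marked_tree n \<sigma> \<and> clades \<sigma> = H \<and> (\<forall>A\<in>H. local_monomial \<sigma> A = t A)"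
  then show "\<sigma> = \<tau>" using assms by (intro marked_tree_eqI) auto
qed (use assms in auto)

text \<open>The multilinear extension of \<Theta> in the free operad: each vertex carries a
  polynomial, and every choice of monomials from them spells out a tree. Passing to cosets is a
  separate step.\<close>

definition tree_functional ::
    "nat \<Rightarrow> (nat mtree \<Rightarrow> complex) \<Rightarrow> nat set set \<Rightarrow> (nat set \<Rightarrow> nonassoc_poly) \<Rightarrow> complex" where
  "tree_functional n \<Theta> H e = (\<Sum>t\<in>(\<Pi>\<^sub>E A\<in>H. monomials (inputs H A)).
     (\<Prod>A\<in>H. Poly_Mapping.lookup (e A) (t A)) * \<Theta> (assembled n H t))"

text \<open>The functional of the polynomial at \<open>A\<close> with all other polynomials held
  fixed. It is zero at monomials that do not fit the slot, because
  \<open>satisfies_relations\<close> quantifies over all monomials.\<close>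

definition slot_function ::
    "nat \<Rightarrow> (nat mtree \<Rightarrow> complex) \<Rightarrow> nat set set \<Rightarrow> nat set \<Rightarrow> (nat set \<Rightarrow> nonassoc_poly) \<Rightarrow> nat monomial \<Rightarrow> complex" where
  "slot_function n \<Theta> H A e s = (\<Sum>t\<in>(\<Pi>\<^sub>E B\<in>H - {A}. monomials (inputs H B)).
     (\<Prod>B\<in>H - {A}. Poly_Mapping.lookup (e B) (t B)) *
     (if s \<in> monomials (inputs H A) then \<Theta> (assembled n H (t(A := s))) else 0))"

lemma reduced_tree_finite:
  assumes "reduced_tree n H"
  shows "finite H" "A \<in> H \<Longrightarrow> finite (inputs H A)"
proof -
  have H: "B \<subseteq> {1..n}" if "B \<in> H" for B using assms that by (auto simp: reduced_tree_def)
  show "finite H" by (rule finite_subset[of _ "Pow {1..n}"]) (use H in auto)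
  show "finite (inputs H A)" if "A \<in> H"
    by (rule finite_subset[of _ "{1..n}"]) (use H[OF that] in \<open>auto simp: inputs_def\<close>)
qed

lemma tree_functional_slot:
  assumes H: "reduced_tree n H" and A: "A \<in> H" and p: "Poly_Mapping.keys p \<subseteq> monomials (inputs H A)"
  shows "tree_functional n \<Theta> H (e(A := p)) = eval_at (slot_function n \<Theta> H A e) p"
proof -
  let ?M = "\<lambda>B. monomials (inputs H B)" and ?H = "H - {A}"
  let ?w = "\<lambda>t. \<Prod>B\<in>?H. Poly_Mapping.lookup (e B) (t B)"
  note fin = reduced_tree_finite[OF H]
  have eq: "PiE H ?M = (\<lambda>(y, g). g(A := y)) ` (?M A \<times> PiE ?H ?M)"
    using PiE_insert_eq[of A ?H ?M] A by (simp add: insert_absorb)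
  have inj: "inj_on (\<lambda>(y, g). g(A := y)) (?M A \<times> PiE ?H ?M)"
    by (rule inj_combinator) simp
  have "tree_functional n \<Theta> H (e(A := p))
      = (\<Sum>(s, t)\<in>?M A \<times> PiE ?H ?M. (\<Prod>B\<in>H. Poly_Mapping.lookup ((e(A := p)) B) ((t(A := s)) B)) * \<Theta> (assembled n H (t(A := s))))"
    unfolding tree_functional_def eq sum.reindex[OF inj] by (simp add: case_prod_beta)
  also have "\<dots> = (\<Sum>(s, t)\<in>?M A \<times> PiE ?H ?M. Poly_Mapping.lookup p s * (?w t * \<Theta> (assembled n H (t(A := s)))))"
  proof -
    have "(\<Prod>B\<in>H. Poly_Mapping.lookup ((e(A := p)) B) ((t(A := s)) B)) = Poly_Mapping.lookup p s * ?w t" for s t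
      unfolding prod.remove[OF fin(1) A] by (auto intro!: prod.cong)
    then show ?thesis by (simp only: mult.assoc)
  qed
  also have "\<dots> = (\<Sum>s\<in>?M A. Poly_Mapping.lookup p s * slot_function n \<Theta> H A e s)"
    by (simp add: sum.cartesian_product[symmetric] sum_distrib_left slot_function_def)
  also have "\<dots> = eval_at (slot_function n \<Theta> H A e) p"
    using finite_monomials[OF fin(2)[OF A]] p by (intro eval_at_superset[symmetric])
  finally show ?thesis .
qed

lemma monomials_three:
  assumes "card I \<le> 3" "(u \<odot> v) \<odot> w \<in> monomials I \<or> u \<odot> (v \<odot> w) \<in> monomials I"
  obtains x y z where "u = Var x" "v = Var y" "w = Var z"
proof -
  have "card I = card (labels u) + card (labels v) + card (labels w)"
    using assms(2) labels_card_prod[of "u \<odot> v" w] labels_card_prod[of u v]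
      labels_card_prod[of u "v \<odot> w"] labels_card_prod[of v w] by (auto simp: monomials_def)
  then have c: "card (labels u) \<le> 1" "card (labels v) \<le> 1" "card (labels w) \<le> 1"
    using assms(1) card_labels_pos[of u] card_labels_pos[of v] card_labels_pos[of w] by linarith+
  have ml: "multilinear u" "multilinear v" "multilinear w" using assms(2) by (auto simp: monomials_def)
  have "\<exists>x. t = Var x" if "card (labels t) \<le> 1" "multilinear t" for t :: "'a monomial"
  proof (cases t)
    case (Prod a b)
    then show ?thesis using that labels_card_prod[of a b] card_labels_pos[of a] card_labels_pos[of b] by simp
  qed simp
  then show ?thesis using that c ml by metis
qed

section \<open>Descent to cosets when one edge is contracted\<close>

context
  fixes n :: nat and \<delta> :: complex and \<Theta> :: "nat mtree \<Rightarrow> complex"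
  assumes rel: "\<And>\<tau> L. marked_tree n \<tau> \<Longrightarrow> contracted \<tau> = 1 \<Longrightarrow> L \<in> set (tree_relations \<tau>)
    \<Longrightarrow> (\<Sum>(k, e, \<sigma>)\<leftarrow>L. \<delta> ^ k * \<Theta> \<sigma>) = 0"
begin

context
  fixes H assumes H: "reduced_tree n H" "card H = n - 2" "2 \<le> n"
begin

lemma assembled_props:
  assumes "\<And>A. A \<in> H \<Longrightarrow> t A \<in> monomials (inputs H A)"
  shows "marked_tree n (assembled n H t)" "clades (assembled n H t) = H"
    "A \<in> H \<Longrightarrow> local_monomial (assembled n H t) A = t A" "contracted (assembled n H t) = 1"
proof -
  obtain \<tau> where \<tau>: "marked_tree n \<tau>" "clades \<tau> = H" "\<And>A. A \<in> H \<Longrightarrow> local_monomial \<tau> A = t A"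
    using assemble_marked[OF H(1), of t] assms by blast
  have eq: "assembled n H t = \<tau>" by (rule assembledI) (use \<tau> in auto)
  show "marked_tree n (assembled n H t)" "clades (assembled n H t) = H"
    "A \<in> H \<Longrightarrow> local_monomial (assembled n H t) A = t A" using \<tau> eq by simp_all
  have sep: "separated \<tau>" "leaves \<tau> = {1..n}" using \<tau>(1) by (auto simp: marked_tree_def)
  have "n \<noteq> 2"
  proof
    assume "n = 2"
    then have "card H = 0" using H(2) by simp
    then show False using reduced_tree_finite(1)[OF H(1)] marked_tree_root[OF \<tau>(1)] \<tau>(2) by simp
  qed
  then show "contracted (assembled n H t) = 1"
    using card_clades[OF sep(1)] weight_contracted[OF sep(1)] sep(2) \<tau>(2) H(2,3) eq by simp
qed

text \<open>There is one contracted edge in the whole tree, so no vertex contains more than two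
  nodes. The family \<open>t\<close> provides a tree on which to count.\<close>

lemma card_inputs:
  assumes A: "A \<in> H" and t: "\<And>B. B \<in> H \<Longrightarrow> t B \<in> monomials (inputs H B)"
  shows "card (inputs H A) \<le> 3"
proof -
  note p = assembled_props[of t, OF t]
  have "labels (local_monomial (assembled n H t) A) = inputs H A"
    using p(3)[OF _ A] t A by (simp add: monomials_def)
  then show ?thesis using card_labels_local[of "assembled n H t" A] p(4) by simp
qed

lemma assembled_move:
  assumes A: "A \<in> H" and t: "\<And>B. B \<in> H \<Longrightarrow> t B \<in> monomials (inputs H B)"
    and \<sigma>: "L \<in> set (tree_relations (assembled n H t))" "(k, e, \<sigma>) \<in> set L"
      "same_except A (assembled n H t) \<sigma>" "local_monomial \<sigma> A = s"
  shows "assembled n H (t(A := s)) = \<sigma>"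
proof (rule assembledI)
  note p = assembled_props[of t, OF t]
  show "marked_tree n \<sigma>" using tree_relations_marked[OF \<sigma>(1,2)] p(1) by blast
  show "clades \<sigma> = H" using tree_relations_shape(3)[OF \<sigma>(1,2)] p(2) by blast
  fix B assume B: "B \<in> H"
  show "local_monomial \<sigma> B = (t(A := s)) B"
    using \<sigma>(3,4) p(2) p(3)[OF _ B] B by (cases "B = A") (auto simp: same_except_def)
qed

text \<open>With the other vertices fixed, a cubic monomial at \<open>A\<close> spells out a tree;
  the relation at \<open>A\<close> lifts to a tree relation, which \<Theta> satisfies by assumption.
  All terms of a relation involve the same labels, so if one of them does not fit the slot, then
  none does.\<close>

lemma slot_relations:
  assumes A: "A \<in> H" and t: "\<And>B. B \<in> H - {A} \<Longrightarrow> t B \<in> monomials (inputs H B)"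
  shows "satisfies_relations \<delta> (\<lambda>s. if s \<in> monomials (inputs H A) then \<Theta> (assembled n H (t(A := s))) else 0)"
    (is "satisfies_relations \<delta> ?f")
proof -
  let ?M = "monomials (inputs H A)"
  have left: "?f ((u \<odot> v) \<odot> w) + ?f ((u \<odot> w) \<odot> v) = 0" for u v w
  proof (cases "(u \<odot> v) \<odot> w \<in> ?M")
    case True
    define t' where "t' = t(A := (u \<odot> v) \<odot> w)"
    have t': "t' B \<in> monomials (inputs H B)" if "B \<in> H" for B using t True that by (auto simp: t'_def)
    note p = assembled_props[of t', OF t']
    have sep: "separated (assembled n H t')" using p(1) by (simp add: marked_tree_def)
    obtain x y z where xyz: "u = Var x" "v = Var y" "w = Var z"
      using monomials_three[OF card_inputs[OF A t']] True by metis
    have "local_monomial (assembled n H t') A = (Var x \<odot> Var y) \<odot> Var z"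
      using p(3)[OF _ A] xyz by (simp add: t'_def)
    then obtain e \<sigma> where \<sigma>: "[(0, 1, assembled n H t'), (0, e, \<sigma>)] \<in> set (tree_relations (assembled n H t'))"
      "same_except A (assembled n H t') \<sigma>" "local_monomial \<sigma> A = (Var x \<odot> Var z) \<odot> Var y"
      using relation_left_lift[of A "assembled n H t'" x y z] A p(2) sep by auto
    have "assembled n H (t'(A := (u \<odot> w) \<odot> v)) = \<sigma>"
      by (rule assembled_move[OF A t' \<sigma>(1), of 0 e]) (use \<sigma> xyz in auto)
    moreover have "\<Theta> (assembled n H t') + \<Theta> \<sigma> = 0" using rel[OF p(1,4) \<sigma>(1)] by simp
    moreover have "(u \<odot> w) \<odot> v \<in> ?M" using True by (auto simp: monomials_def)
    ultimately show ?thesis using True by (simp add: t'_def)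
  next
    case False
    moreover from this have "(u \<odot> w) \<odot> v \<notin> ?M" by (auto simp: monomials_def)
    ultimately show ?thesis by simp
  qed
  have right: "\<delta> * ?f ((u \<odot> v) \<odot> w) + \<delta> * ?f ((v \<odot> u) \<odot> w) + ?f (u \<odot> (v \<odot> w)) + ?f (v \<odot> (u \<odot> w)) = 0" for u v w
  proof (cases "u \<odot> (v \<odot> w) \<in> ?M")
    case True
    define t' where "t' = t(A := u \<odot> (v \<odot> w))"
    have t': "t' B \<in> monomials (inputs H B)" if "B \<in> H" for B using t True that by (auto simp: t'_def)
    note p = assembled_props[of t', OF t']
    have sep: "separated (assembled n H t')" using p(1) by (simp add: marked_tree_def)
    obtain x y z where xyz: "u = Var x" "v = Var y" "w = Var z"
      using monomials_three[OF card_inputs[OF A t']] True by metis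
    have "local_monomial (assembled n H t') A = Var x \<odot> (Var y \<odot> Var z)"
      using p(3)[OF _ A] xyz by (simp add: t'_def)
    then obtain e1 e2 e3 \<sigma>1 \<sigma>2 \<sigma>3 where \<sigma>: "[(1, e1, \<sigma>1), (1, e2, \<sigma>2), (0, 1, assembled n H t'), (0, e3, \<sigma>3)]
        \<in> set (tree_relations (assembled n H t'))"
      "same_except A (assembled n H t') \<sigma>1" "same_except A (assembled n H t') \<sigma>2" "same_except A (assembled n H t') \<sigma>3"
      "local_monomial \<sigma>1 A = (Var x \<odot> Var y) \<odot> Var z" "local_monomial \<sigma>2 A = (Var y \<odot> Var x) \<odot> Var z"
      "local_monomial \<sigma>3 A = Var y \<odot> (Var x \<odot> Var z)"
      using relation_right_lift[of A "assembled n H t'" x y z] A p(2) sep by auto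
    have "assembled n H (t'(A := (u \<odot> v) \<odot> w)) = \<sigma>1"
      by (rule assembled_move[OF A t' \<sigma>(1), of 1 e1]) (use \<sigma> xyz in auto)
    moreover have "assembled n H (t'(A := (v \<odot> u) \<odot> w)) = \<sigma>2"
      by (rule assembled_move[OF A t' \<sigma>(1), of 1 e2]) (use \<sigma> xyz in auto)
    moreover have "assembled n H (t'(A := v \<odot> (u \<odot> w))) = \<sigma>3"
      by (rule assembled_move[OF A t' \<sigma>(1), of 0 e3]) (use \<sigma> xyz in auto)
    moreover have "\<delta> * \<Theta> \<sigma>1 + \<delta> * \<Theta> \<sigma>2 + \<Theta> (assembled n H t') + \<Theta> \<sigma>3 = 0"
      using rel[OF p(1,4) \<sigma>(1)] by (simp add: add.assoc)
    moreover have "(u \<odot> v) \<odot> w \<in> ?M" "(v \<odot> u) \<odot> w \<in> ?M" "v \<odot> (u \<odot> w) \<in> ?M"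
      using True by (auto simp: monomials_def)
    ultimately show ?thesis using True by (simp add: t'_def)
  next
    case False
    moreover from this have "(u \<odot> v) \<odot> w \<notin> ?M" "(v \<odot> u) \<odot> w \<notin> ?M" "v \<odot> (u \<odot> w) \<notin> ?M"
      by (auto simp: monomials_def)
    ultimately show ?thesis by simp
  qed
  show ?thesis unfolding satisfies_relations_def using left right by blast
qed

text \<open>The upper bound on the ideal enters here: the slot has at most three inputs, so elements
  of the ideal are killed by every function that satisfies the relations.\<close>

lemma tree_functional_ideal:
  assumes A: "A \<in> H" and p: "p \<in> mn_ideal \<delta> (inputs H A)"
  shows "tree_functional n \<Theta> H (e(A := p)) = 0"
proof -
  note fin = reduced_tree_finite[OF H(1)]
  have keys: "Poly_Mapping.keys p \<subseteq> monomials (inputs H A)"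
    using M.J_sub[OF fin(2)[OF A] p] by (simp add: free_space)
  show ?thesis
  proof (cases "(\<Pi>\<^sub>E B\<in>H. monomials (inputs H B)) = {}")
    case True
    then show ?thesis by (simp add: tree_functional_def)
  next
    case False
    then obtain t0 where "t0 \<in> (\<Pi>\<^sub>E B\<in>H. monomials (inputs H B))" by blast
    then have t0: "card (inputs H A) \<le> 3" by (intro card_inputs[OF A, of t0]) auto
    let ?T = "\<Pi>\<^sub>E B\<in>H - {A}. monomials (inputs H B)"
    let ?f = "\<lambda>t s. if s \<in> monomials (inputs H A) then \<Theta> (assembled n H (t(A := s))) else 0"
    have r: "satisfies_relations \<delta> (?f t)" if "t \<in> ?T" for t
      using slot_relations[OF A, of t] that by (auto simp: PiE_def Pi_def)
    have "satisfies_relations \<delta> (slot_function n \<Theta> H A e)"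
      unfolding satisfies_relations_def
    proof (intro allI conjI)
      fix u v w
      let ?w = "\<lambda>t. \<Prod>B\<in>H - {A}. Poly_Mapping.lookup (e B) (t B)"
      have 1: "?f t ((u \<odot> v) \<odot> w) + ?f t ((u \<odot> w) \<odot> v) = 0"
        "\<delta> * ?f t ((u \<odot> v) \<odot> w) + \<delta> * ?f t ((v \<odot> u) \<odot> w) + ?f t (u \<odot> (v \<odot> w)) + ?f t (v \<odot> (u \<odot> w)) = 0"
        if "t \<in> ?T" for t
        using r[OF that] unfolding satisfies_relations_def by blast+
      have "slot_function n \<Theta> H A e ((u \<odot> v) \<odot> w) + slot_function n \<Theta> H A e ((u \<odot> w) \<odot> v)
          = (\<Sum>t\<in>?T. ?w t * (?f t ((u \<odot> v) \<odot> w) + ?f t ((u \<odot> w) \<odot> v)))"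
        unfolding slot_function_def by (simp only: sum.distrib[symmetric] distrib_left)
      also have "\<dots> = 0" by (intro sum.neutral ballI) (simp only: 1(1) mult_zero_right)
      finally show "slot_function n \<Theta> H A e ((u \<odot> v) \<odot> w) + slot_function n \<Theta> H A e ((u \<odot> w) \<odot> v) = 0" .
      have "\<delta> * slot_function n \<Theta> H A e ((u \<odot> v) \<odot> w) + \<delta> * slot_function n \<Theta> H A e ((v \<odot> u) \<odot> w)
          + slot_function n \<Theta> H A e (u \<odot> (v \<odot> w)) + slot_function n \<Theta> H A e (v \<odot> (u \<odot> w))
          = (\<Sum>t\<in>?T. ?w t * (\<delta> * ?f t ((u \<odot> v) \<odot> w) + \<delta> * ?f t ((v \<odot> u) \<odot> w)
              + ?f t (u \<odot> (v \<odot> w)) + ?f t (v \<odot> (u \<odot> w))))"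
        unfolding slot_function_def
        by (simp only: sum.distrib[symmetric] sum_distrib_left distrib_left mult.left_commute)
      also have "\<dots> = 0" by (intro sum.neutral ballI) (simp only: 1(2) mult_zero_right)
      finally show "\<delta> * slot_function n \<Theta> H A e ((u \<odot> v) \<odot> w) + \<delta> * slot_function n \<Theta> H A e ((v \<odot> u) \<odot> w)
          + slot_function n \<Theta> H A e (u \<odot> (v \<odot> w)) + slot_function n \<Theta> H A e (v \<odot> (u \<odot> w)) = 0" .
    qed
    then have "eval_at (slot_function n \<Theta> H A e) p = 0"
      using mn_ideal_cubic[of \<delta> "inputs H A"] p t0 by (auto simp: cubic_ideal_def)
    then show ?thesis by (simp add: tree_functional_slot[OF H(1) A keys])
  qed
qed

lemma tree_functional_cong: "(\<And>A. A \<in> H \<Longrightarrow> e A = e' A) \<Longrightarrow> tree_functional n \<Theta> H e = tree_functional n \<Theta> H e'"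
  by (simp add: tree_functional_def)

text \<open>Representatives are exchanged at one vertex after another, \<open>S\<close> being the
  set of vertices already treated; each exchange adds a term with an element of the ideal in one
  slot.\<close>

lemma tree_functional_coset:
  assumes e: "\<And>A. A \<in> H \<Longrightarrow> Poly_Mapping.keys (e A) \<subseteq> monomials (inputs H A)"
    and e': "\<And>A. A \<in> H \<Longrightarrow> e' A \<in> ideal_coset \<delta> (inputs H A) (e A)"
  shows "tree_functional n \<Theta> H e' = tree_functional n \<Theta> H e"
proof -
  note fin = reduced_tree_finite[OF H(1)]
  have "tree_functional n \<Theta> H (\<lambda>A. if A \<in> S then e' A else e A) = tree_functional n \<Theta> H e" if "S \<subseteq> H" for S
    using finite_subset[OF that fin(1)] that
  proof (induction S)
    case (insert A S)
    let ?e = "\<lambda>A. if A \<in> S then e' A else e A"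
    have A: "A \<in> H" using insert.prems by simp
    obtain j where j: "j \<in> mn_ideal \<delta> (inputs H A)" "e' A = e A + j"
      using e'[OF A] by (auto simp: M.mem_coset free_vadd)
    have jk: "Poly_Mapping.keys j \<subseteq> monomials (inputs H A)"
      using M.J_sub[OF fin(2)[OF A] j(1)] by (simp add: free_space)
    have "Poly_Mapping.keys (e A + j) \<subseteq> monomials (inputs H A)" using keys_add[of "e A" j] e[OF A] jk by auto
    then have "tree_functional n \<Theta> H (?e(A := e A + j)) = tree_functional n \<Theta> H (?e(A := e A)) + tree_functional n \<Theta> H (?e(A := j))"
      using tree_functional_slot[OF H(1) A] jk e[OF A] by simp
    also have "tree_functional n \<Theta> H (?e(A := j)) = 0" by (rule tree_functional_ideal[OF A j(1)])
    also have "?e(A := e A) = ?e" using insert.hyps by (auto simp: fun_eq_iff)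
    also have "?e(A := e A + j) = (\<lambda>B. if B \<in> insert A S then e' B else e B)" using j(2) by (auto simp: fun_eq_iff)
    finally show ?case using insert by simp
  qed simp
  from this[of H] show ?thesis using tree_functional_cong[of "\<lambda>A. if A \<in> H then e' A else e A" e'] by simp
qed

definition coset_functional :: "(nat set \<Rightarrow> nonassoc_poly set) \<Rightarrow> complex" where
  "coset_functional d = tree_functional n \<Theta> H (\<lambda>A. SOME p. p \<in> d A)"

lemma coset_functional_eq:
  assumes "\<And>A. A \<in> H \<Longrightarrow> Poly_Mapping.keys (e A) \<subseteq> monomials (inputs H A)"
    "\<And>A. A \<in> H \<Longrightarrow> d A = ideal_coset \<delta> (inputs H A) (e A)"
  shows "coset_functional d = tree_functional n \<Theta> H e"
  unfolding coset_functional_def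
proof (rule tree_functional_coset)
  fix A assume A: "A \<in> H"
  have "e A \<in> d A" using M.coset_self[OF reduced_tree_finite(2)[OF H(1) A]] assms A by (simp add: free_space)
  then show "(SOME p. p \<in> d A) \<in> ideal_coset \<delta> (inputs H A) (e A)"
    using assms(2)[OF A] by (metis someI)
qed (use assms in simp)

lemma multilinear_coset_functional: "multilinear_functional (mock_novikov_operad \<delta>) H coset_functional"
  unfolding multilinear_functional_def
proof (intro ballI conjI allI)
  fix d A x c
  assume d: "d \<in> decorations (mock_novikov_operad \<delta>) H" and A: "A \<in> H"
    and x: "x \<in> op_space (mock_novikov_operad \<delta>) (inputs H A)"
  note fin = reduced_tree_finite(2)[OF H(1) A]
  have "\<exists>p. Poly_Mapping.keys p \<subseteq> monomials (inputs H B) \<and> d B = ideal_coset \<delta> (inputs H B) p" if "B \<in> H" for B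
    using PiE_mem[OF d[unfolded decorations_def] that]
    by (auto simp: mock_novikov_operad_eq M.Q_space free_space)
  then obtain e where e: "\<And>B. B \<in> H \<Longrightarrow> Poly_Mapping.keys (e B) \<subseteq> monomials (inputs H B)"
    "\<And>B. B \<in> H \<Longrightarrow> d B = ideal_coset \<delta> (inputs H B) (e B)" by metis
  have upd: "coset_functional (d(A := ideal_coset \<delta> (inputs H A) p)) = eval_at (slot_function n \<Theta> H A e) p"
    if p: "Poly_Mapping.keys p \<subseteq> monomials (inputs H A)" for p
    unfolding tree_functional_slot[OF H(1) A p, symmetric]
    by (rule coset_functional_eq) (use e p in auto)
  obtain p where p: "Poly_Mapping.keys p \<subseteq> monomials (inputs H A)" "x = ideal_coset \<delta> (inputs H A) p"
    using x by (auto simp: mock_novikov_operad_eq M.Q_space free_space)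
  have P: "p \<in> op_space free_binary_operad (inputs H A)" using p(1) by (simp add: free_space)
  have "Poly_Mapping.keys (cscale c p) \<subseteq> monomials (inputs H A)" using keys_cscale[of c p] p(1) by auto
  then show "coset_functional (d(A := vscale (mock_novikov_operad \<delta>) (inputs H A) c x)) = c * coset_functional (d(A := x))"
    using upd p M.Q_vscale[OF fin P, of \<delta> c] by (simp add: mock_novikov_operad_eq free_vscale)
  fix y assume y: "y \<in> op_space (mock_novikov_operad \<delta>) (inputs H A)"
  obtain q where q: "Poly_Mapping.keys q \<subseteq> monomials (inputs H A)" "y = ideal_coset \<delta> (inputs H A) q"
    using y by (auto simp: mock_novikov_operad_eq M.Q_space free_space)
  have Q: "q \<in> op_space free_binary_operad (inputs H A)" using q(1) by (simp add: free_space)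
  have "Poly_Mapping.keys (p + q) \<subseteq> monomials (inputs H A)" using keys_add[of p q] p(1) q(1) by auto
  then show "coset_functional (d(A := vadd (mock_novikov_operad \<delta>) (inputs H A) x y))
      = coset_functional (d(A := x)) + coset_functional (d(A := y))"
    using upd p q M.Q_vadd[OF fin P Q, of \<delta>] by (simp add: mock_novikov_operad_eq free_vadd)
qed

lemma coset_functional_decor:
  assumes "marked_tree n \<tau>" "clades \<tau> = H"
  shows "coset_functional (decor \<delta> \<tau>) = \<Theta> \<tau>"
proof -
  note fin = reduced_tree_finite[OF H(1)]
  have sep: "separated \<tau>" using assms(1) by (simp add: marked_tree_def)
  have loc: "local_monomial \<tau> A \<in> monomials (inputs H A)" if "A \<in> H" for A
    using local_monomials[OF sep, of A] that assms(2) by simp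
  let ?t0 = "restrict (local_monomial \<tau>) H" and ?T = "\<Pi>\<^sub>E A\<in>H. monomials (inputs H A)"
  let ?w = "\<lambda>t. \<Prod>A\<in>H. Poly_Mapping.lookup (mon (local_monomial \<tau> A)) (t A)"
  have "coset_functional (decor \<delta> \<tau>) = tree_functional n \<Theta> H (\<lambda>A. mon (local_monomial \<tau> A))"
    by (rule coset_functional_eq) (use loc assms(2) in \<open>auto simp: decor_def\<close>)
  also have "\<dots> = (\<Sum>t\<in>?T. if t = ?t0 then \<Theta> \<tau> else 0)"
    unfolding tree_functional_def
  proof (rule sum.cong)
    fix t assume t: "t \<in> ?T"
    show "?w t * \<Theta> (assembled n H t) = (if t = ?t0 then \<Theta> \<tau> else 0)"
    proof (cases "t = ?t0")
      case True
      then have "assembled n H t = \<tau>" by (intro assembledI) (use assms in auto)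
      then show ?thesis using True by simp
    next
      case False
      then obtain A where "A \<in> H" "t A \<noteq> local_monomial \<tau> A"
        using t by (metis PiE_E PiE_restrict restrict_ext)
      then have "\<exists>A\<in>H. Poly_Mapping.lookup (mon (local_monomial \<tau> A)) (t A) = 0"
        by (intro bexI[of _ A]) (auto simp: lookup_single when_def)
      then have "?w t = 0" using fin(1) by (intro prod_zero)
      then show ?thesis using False by simp
    qed
  qed simp
  also have "\<dots> = \<Theta> \<tau>"
  proof -
    have "finite ?T" using fin finite_monomials by (intro finite_PiE) auto
    moreover have "?t0 \<in> ?T" using loc by auto
    ultimately show ?thesis by simp
  qed
  finally show ?thesis .
qed

end

end

section \<open>Multilinearity of the differential\<close>

lemma monomials_nonempty: "finite I \<Longrightarrow> I \<noteq> {} \<Longrightarrow> monomials I \<noteq> {}"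
proof (induction I rule: finite_ne_induct)
  case (singleton x)
  have "Var x \<in> monomials {x}" by (simp add: monomials_def)
  then show ?case by blast
next
  case (insert x I)
  then obtain t where "t \<in> monomials I" by blast
  then have "Var x \<odot> t \<in> monomials (insert x I)" using insert.hyps by (auto simp: monomials_def)
  then show ?case by blast
qed

lemma inputs_nonempty:
  assumes "reduced_tree n H" "A \<in> H"
  shows "inputs H A \<noteq> {}"
proof -
  have A: "finite A" "A \<noteq> {}" using assms finite_subset[of A "{1..n}"] by (auto simp: reduced_tree_def)
  have "Min A = Min B" if "B \<subset> A" "Min A \<in> B" for B
    using that A(1) by (intro Min_eqI[symmetric]) (auto intro: finite_subset)
  then have "Min A \<in> inputs H A" using A by (auto simp: inputs_def)
  then show ?thesis by blast
qed

lemma reduced_tree_marked: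
  assumes "reduced_tree n H"
  obtains \<tau> where "marked_tree n \<tau>" "clades \<tau> = H"
proof -
  have "\<forall>A\<in>H. \<exists>t. t \<in> monomials (inputs H A)"
    using monomials_nonempty[OF reduced_tree_finite(2)[OF assms] inputs_nonempty[OF assms]] by blast
  then obtain t where "\<And>A. A \<in> H \<Longrightarrow> t A \<in> monomials (inputs H A)" by metis
  from assemble_marked[OF assms this] show ?thesis using that by metis
qed

text \<open>Partial composition is bilinear, so the slots \<open>A\<close> and \<open>B\<close> both
  act linearly on the merged vertex. A tree with clades \<open>H\<close> is chosen because the facts
  on lower vertices and inputs were proved for trees, although they concern \<open>H\<close>
  alone.\<close>

lemma multilinear_contract:
  assumes H: "reduced_tree n H" and B: "B \<in> internal_edges n H"
    and g: "multilinear_functional (mock_novikov_operad \<delta>) (H - {B}) g"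
  shows "multilinear_functional (mock_novikov_operad \<delta>) H (\<lambda>d. g (contract (mock_novikov_operad \<delta>) H B d))"
proof -
  let ?P = "mock_novikov_operad \<delta>"
  interpret Q: symmetric_operad ?P by (rule symmetric_operad_mock_novikov)
  obtain \<tau> where \<tau>: "marked_tree n \<tau>" "clades \<tau> = H" using reduced_tree_marked[OF H] .
  have sep: "separated \<tau>" using \<tau>(1) by (simp add: marked_tree_def)
  have "B \<in> set (inner_edges \<tau>)" using set_inner_edges[OF \<tau>(1)] B \<tau>(2) by simp
  then obtain j where j: "j < length (inner_edges \<tau>)" "B = inner_edges \<tau> ! j" by (auto simp: in_set_conv_nth)
  define \<tau>' where "\<tau>' = inner_contractions \<tau> ! j"
  have z: "(B, \<tau>') \<in> set (zip (edges \<tau>) (contractions \<tau>))" "B \<noteq> {1..n}"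
    using inner_zip[OF \<tau>(1) j(1)] j(2) by (simp_all add: \<tau>'_def)
  have cl: "clades \<tau>' = H - {B}" "B \<in> H" using edges_contractions(3,4)[OF sep z(1)] \<tau>(2) by simp_all
  obtain A where A: "A \<in> H" "A \<noteq> B" "lower_vertex H B = A"
    "composable (inputs H A) (Min B) (inputs H B)"
    "inputs (H - {B}) A = inputs H A - {Min B} \<union> inputs H B"
    "\<And>C. C \<in> H - {A, B} \<Longrightarrow> inputs (H - {B}) C = inputs H C"
    using contraction_lower[OF \<tau>(1) z] unfolding \<tau>(2) cl(1) by metis
  let ?c = "contract ?P H B" and ?pc = "pcomp ?P (inputs H A) (Min B) (inputs H B)"
  have c_eq: "?c d = restrict (d(A := ?pc (d A) (d B))) (H - {B})" for d
    by (simp add: contract_def A(3))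
  have c_A: "?c (d(A := x)) = (?c d)(A := ?pc x (d B))" for d x
    using A(1,2) by (auto simp: c_eq fun_eq_iff)
  have c_B: "?c (d(B := x)) = (?c d)(A := ?pc (d A) x)" for d x
    using A(1,2) by (auto simp: c_eq fun_eq_iff)
  have c_other: "?c (d(C := x)) = (?c d)(C := x)" if "C \<in> H - {A, B}" for d C x
    using A(1,2) that by (auto simp: c_eq fun_eq_iff)
  have add: "g (d(C := vadd ?P (inputs (H - {B}) C) x y)) = g (d(C := x)) + g (d(C := y))"
    and scale: "g (d(C := vscale ?P (inputs (H - {B}) C) c x)) = c * g (d(C := x))"
    if "d \<in> decorations ?P (H - {B})" "C \<in> H - {B}" "x \<in> op_space ?P (inputs (H - {B}) C)"
      "y \<in> op_space ?P (inputs (H - {B}) C)" for d C x y c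
    using g that unfolding multilinear_functional_def by blast+
  have A': "A \<in> H - {B}" using A(1,2) by simp
  show ?thesis
    unfolding multilinear_functional_def
  proof (intro ballI conjI allI)
    fix d C x c
    assume d: "d \<in> decorations ?P H" and C: "C \<in> H" and x: "x \<in> op_space ?P (inputs H C)"
    have dA: "d A \<in> op_space ?P (inputs H A)" and dB: "d B \<in> op_space ?P (inputs H B)"
      using PiE_mem[OF d[unfolded decorations_def]] A(1) cl(2) by simp_all
    have cd: "?c d \<in> decorations ?P (H - {B})"
      unfolding decorations_def
    proof (rule PiE_I)
      fix C assume "C \<in> H - {B}"
      then show "?c d C \<in> op_space ?P (inputs (H - {B}) C)"
        using PiE_mem[OF d[unfolded decorations_def], of C] A(5) A(6)[of C] Q.pcomp_closed[OF A(4) dA dB]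
        by (cases "C = A") (simp_all add: c_eq)
    qed (simp only: c_eq restrict_apply if_False)
    consider "C = A" | "C = B" | "C \<in> H - {A, B}" using C by blast
    note cases = this
    show "g (?c (d(C := vscale ?P (inputs H C) c x))) = c * g (?c (d(C := x)))"
      using cases
    proof cases
      case 1
      have x: "x \<in> op_space ?P (inputs H A)" using x 1 by simp
      show ?thesis unfolding 1 c_A Q.pcomp_vscale_left[OF A(4) x dB] A(5)[symmetric]
        by (rule scale[OF cd A' _ _]) (use Q.pcomp_closed[OF A(4) x dB] A(5) in simp_all)
    next
      case 2
      have x: "x \<in> op_space ?P (inputs H B)" using x 2 by simp
      show ?thesis unfolding 2 c_B Q.pcomp_vscale_right[OF A(4) dA x] A(5)[symmetric]
        by (rule scale[OF cd A' _ _]) (use Q.pcomp_closed[OF A(4) dA x] A(5) in simp_all)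
    next
      case 3
      then show ?thesis unfolding c_other[OF 3] A(6)[OF 3, symmetric]
        by (intro scale[OF cd]) (use x A(6)[OF 3] in auto)
    qed
    fix y assume y: "y \<in> op_space ?P (inputs H C)"
    show "g (?c (d(C := vadd ?P (inputs H C) x y))) = g (?c (d(C := x))) + g (?c (d(C := y)))"
      using cases
    proof cases
      case 1
      have x: "x \<in> op_space ?P (inputs H A)" and y: "y \<in> op_space ?P (inputs H A)" using x y 1 by simp_all
      show ?thesis unfolding 1 c_A Q.pcomp_vadd_left[OF A(4) x y dB] A(5)[symmetric]
        by (rule add[OF cd A']) (use Q.pcomp_closed[OF A(4) x dB] Q.pcomp_closed[OF A(4) y dB] A(5) in simp_all)
    next
      case 2
      have x: "x \<in> op_space ?P (inputs H B)" and y: "y \<in> op_space ?P (inputs H B)" using x y 2 by simp_all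
      show ?thesis unfolding 2 c_B Q.pcomp_vadd_right[OF A(4) dA x y] A(5)[symmetric]
        by (rule add[OF cd A']) (use Q.pcomp_closed[OF A(4) dA x] Q.pcomp_closed[OF A(4) dA y] A(5) in simp_all)
    next
      case 3
      then show ?thesis unfolding c_other[OF 3] A(6)[OF 3, symmetric]
        by (intro add[OF cd]) (use x y A(6)[OF 3] in auto)
    qed
  qed
qed

lemma multilinear_cobar:
  assumes H: "reduced_tree n H"
    and \<phi>: "\<And>B. B \<in> internal_edges n H \<Longrightarrow> multilinear_functional (mock_novikov_operad \<delta>) (H - {B}) (\<phi> (H - {B}))"
  shows "multilinear_functional (mock_novikov_operad \<delta>) H (cobar_diff (mock_novikov_operad \<delta>) n \<phi> H)"
proof -
  let ?P = "mock_novikov_operad \<delta>"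
  let ?f = "\<lambda>B d. \<phi> (H - {B}) (contract ?P H B d)"
  have f: "?f B (d(A := vadd ?P (inputs H A) x y)) = ?f B (d(A := x)) + ?f B (d(A := y))"
    "?f B (d(A := vscale ?P (inputs H A) c x)) = c * ?f B (d(A := x))"
    if "B \<in> internal_edges n H" "d \<in> decorations ?P H" "A \<in> H" "x \<in> op_space ?P (inputs H A)"
      "y \<in> op_space ?P (inputs H A)" for B d A x y c
    using multilinear_contract[OF H that(1) \<phi>[OF that(1)]] that unfolding multilinear_functional_def by blast+
  show ?thesis
    unfolding multilinear_functional_def cobar_diff_def
  proof (intro ballI conjI allI)
    fix d A x c
    assume d: "d \<in> decorations ?P H" and A: "A \<in> H" and x: "x \<in> op_space ?P (inputs H A)"
    show "(\<Sum>B\<in>internal_edges n H. edge_sign n H B * ?f B (d(A := vscale ?P (inputs H A) c x)))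
        = c * (\<Sum>B\<in>internal_edges n H. edge_sign n H B * ?f B (d(A := x)))"
      unfolding sum_distrib_left by (rule sum.cong) (simp_all add: f(2)[OF _ d A x x])
    fix y assume y: "y \<in> op_space ?P (inputs H A)"
    show "(\<Sum>B\<in>internal_edges n H. edge_sign n H B * ?f B (d(A := vadd ?P (inputs H A) x y)))
        = (\<Sum>B\<in>internal_edges n H. edge_sign n H B * ?f B (d(A := x)))
          + (\<Sum>B\<in>internal_edges n H. edge_sign n H B * ?f B (d(A := y)))"
      unfolding sum.distrib[symmetric] by (rule sum.cong) (simp_all add: f(1)[OF _ d A x y] distrib_left)
  qed
qed

lemma inner_contraction_contracted:
  assumes "marked_tree n \<tau>" "j < length (inner_contractions \<tau>)"
  shows "marked_tree n (inner_contractions \<tau> ! j)" "contracted (inner_contractions \<tau> ! j) = Suc (contracted \<tau>)"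
proof -
  have j: "j < length (inner_edges \<tau>)" using assms length_inner_contractions by simp
  note p = inner_contraction_props[OF assms(1) j]
  show "marked_tree n (inner_contractions \<tau> ! j)" by (rule p(1))
  then show "contracted (inner_contractions \<tau> ! j) = Suc (contracted \<tau>)"
    using weight_contracted[of \<tau>] weight_contracted[of "inner_contractions \<tau> ! j"] p(3) assms(1)
    by (simp add: marked_tree_def)
qed

lemma marked_tree_card: "marked_tree n \<tau> \<Longrightarrow> card (clades \<tau>) + contracted \<tau> + 1 = n"
  using card_clades[of \<tau>] weight_contracted[of \<tau>] by (simp add: marked_tree_def)

text \<open>By multilinearity of the differential, closedness need only be tested on monomial
  decorations. On \<open>n - 1\<close> vertices these are the trees without contracted edges, for
  which it is the alternating sum in \<open>coc\<close>.\<close>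

lemma cocycle_from_trees:
  assumes rel: "\<And>\<tau> L. marked_tree n \<tau> \<Longrightarrow> contracted \<tau> = 1 \<Longrightarrow> L \<in> set (tree_relations \<tau>)
      \<Longrightarrow> (\<Sum>(k, e, \<sigma>)\<leftarrow>L. \<delta> ^ k * \<Theta> \<sigma>) = 0"
    and coc: "\<And>\<tau>. marked_tree n \<tau> \<Longrightarrow> contracted \<tau> = 0 \<Longrightarrow> (\<Sum>j<length (inner_contractions \<tau>).
      (-1) ^ j * (orientation (inner_contractions \<tau> ! j) * \<Theta> (inner_contractions \<tau> ! j))) = 0"
    and n: "3 \<le> n"
  defines "\<phi> \<equiv> coset_functional n \<Theta>"
  shows "cochain (mock_novikov_operad \<delta>) n (n - 2) \<phi>"
    and "H \<in> trees_with n (n - 1) \<Longrightarrow> d \<in> decorations (mock_novikov_operad \<delta>) H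
      \<Longrightarrow> cobar_diff (mock_novikov_operad \<delta>) n \<phi> H d = 0"
    and "marked_tree n \<tau> \<Longrightarrow> contracted \<tau> = 1 \<Longrightarrow> \<phi> (clades \<tau>) (decor \<delta> \<tau>) = \<Theta> \<tau>"
proof -
  let ?P = "mock_novikov_operad \<delta>"
  have n2: "2 \<le> n" using n by simp
  have ml: "multilinear_functional ?P H (\<phi> H)" if "H \<in> trees_with n (n - 2)" for H
    unfolding \<phi>_def using that n2
    by (intro multilinear_coset_functional[of n \<delta> \<Theta>, OF rel]) (simp_all add: trees_with_def)
  then show "cochain ?P n (n - 2) \<phi>" by (simp add: cochain_def)
  have val: "\<phi> (clades \<tau>) (decor \<delta> \<tau>) = \<Theta> \<tau>" if \<tau>: "marked_tree n \<tau>" "contracted \<tau> = 1" for \<tau>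
    unfolding \<phi>_def using n2 marked_tree_card[OF \<tau>(1)] \<tau> marked_tree_reduced[OF \<tau>(1)]
    by (intro coset_functional_decor[of n \<delta> \<Theta>, OF rel]) simp_all
  then show "marked_tree n \<tau> \<Longrightarrow> contracted \<tau> = 1 \<Longrightarrow> \<phi> (clades \<tau>) (decor \<delta> \<tau>) = \<Theta> \<tau>" .
  assume H: "H \<in> trees_with n (n - 1)" and d: "d \<in> decorations ?P H"
  have H': "reduced_tree n H" "card H = n - 1" using H by (simp_all add: trees_with_def)
  note fin = reduced_tree_finite[OF H'(1)]
  show "cobar_diff ?P n \<phi> H d = 0"
  proof (rule functional_zero[OF _ fin _ d])
    show "multilinear_functional ?P H (cobar_diff ?P n \<phi> H)"
    proof (rule multilinear_cobar[OF H'(1)])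
      fix B assume "B \<in> internal_edges n H"
      then have "reduced_tree n (H - {B})" "card (H - {B}) = n - 2"
        using H' fin(1) by (auto simp: reduced_tree_def internal_edges_def)
      then show "multilinear_functional ?P (H - {B}) (\<phi> (H - {B}))" by (intro ml) (simp add: trees_with_def)
    qed
    fix t assume t: "t \<in> (\<Pi>\<^sub>E A\<in>H. monomials (inputs H A))"
    then have tA: "t A \<in> monomials (inputs H A)" if "A \<in> H" for A using that by auto
    obtain \<tau> where \<tau>: "marked_tree n \<tau>" "clades \<tau> = H" "\<And>A. A \<in> H \<Longrightarrow> local_monomial \<tau> A = t A"
      using assemble_marked[OF H'(1) tA] by metis
    have c: "contracted \<tau> = 0" using marked_tree_card[OF \<tau>(1)] \<tau>(2) H'(2) n by simp
    have "restrict (\<lambda>A. ideal_coset \<delta> (inputs H A) (mon (t A))) H = decor \<delta> \<tau>"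
      using \<tau>(2,3) by (auto simp: decor_def fun_eq_iff)
    moreover have "orientation \<tau> * cobar_diff ?P n \<phi> (clades \<tau>) (decor \<delta> \<tau>) = 0"
      unfolding cobar_diff_decor[OF \<tau>(1)] coc[OF \<tau>(1) c, symmetric]
    proof (rule sum.cong)
      fix j assume "j \<in> {..<length (inner_contractions \<tau>)}"
      then show "(- 1) ^ j * (orientation (inner_contractions \<tau> ! j) *
            \<phi> (clades (inner_contractions \<tau> ! j)) (decor \<delta> (inner_contractions \<tau> ! j))) =
          (- 1) ^ j * (orientation (inner_contractions \<tau> ! j) * \<Theta> (inner_contractions \<tau> ! j))"
        using inner_contraction_contracted[OF \<tau>(1), of j] val c by simp
    qed simp
    moreover have "orientation \<tau> \<noteq> 0" using list_sign_square[of "map set_encode (inner_edges \<tau>)"]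
      by (auto simp: orientation_def)
    ultimately show "cobar_diff ?P n \<phi> H (restrict (\<lambda>A. ideal_coset \<delta> (inputs H A) (mon (t A))) H) = 0"
      using \<tau>(2) by simp
  qed
qed

section \<open>Averaging over the labels\<close>

lemma separated_map: "inj_on f (leaves \<tau>) \<Longrightarrow> separated \<tau> \<Longrightarrow> separated (map_mtree f \<tau>)"
proof (induction \<tau>)
  case (Node r s t)
  have "f ` leaves s \<inter> f ` leaves t = f ` (leaves s \<inter> leaves t)"
    by (rule inj_on_image_Int[symmetric, OF Node.prems(1)]) auto
  then show ?case using Node by (auto intro: inj_on_subset)
qed simp

lemma same_shape_relabel:
  assumes "separated \<tau>" "map_mtree f \<sigma> = map_mtree f \<tau>"
  shows "\<exists>\<pi>. \<sigma> = map_mtree \<pi> \<tau> \<and> (\<forall>a\<in>leaves \<tau>. f (\<pi> a) = f a)"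
  using assms
proof (induction \<tau> arbitrary: \<sigma>)
  case (Leaf a)
  then obtain b where "\<sigma> = Leaf b" "f b = f a" by (cases \<sigma>) auto
  then show ?case by (intro exI[of _ "\<lambda>_. b"]) simp
next
  case (Node r s t)
  then obtain s' t' where \<sigma>: "\<sigma> = Node r s' t'" "map_mtree f s' = map_mtree f s" "map_mtree f t' = map_mtree f t"
    by (cases \<sigma>) auto
  obtain p where p: "s' = map_mtree p s" "\<forall>a\<in>leaves s. f (p a) = f a"
    using Node.IH(1)[OF _ \<sigma>(2)] Node.prems(1) by auto
  obtain q where q: "t' = map_mtree q t" "\<forall>a\<in>leaves t. f (q a) = f a"
    using Node.IH(2)[OF _ \<sigma>(3)] Node.prems(1) by auto
  let ?\<pi> = "\<lambda>a. if a \<in> leaves s then p a else q a"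
  have "map_mtree ?\<pi> s = s'" unfolding p(1) by (rule mtree.map_cong) auto
  moreover have "map_mtree ?\<pi> t = t'" unfolding q(1)
    by (rule mtree.map_cong) (use Node.prems(1) in auto)
  ultimately have "\<sigma> = map_mtree ?\<pi> (Node r s t)" using \<sigma>(1) by simp
  moreover have "\<forall>a\<in>leaves (Node r s t). f (?\<pi> a) = f a" using p(2) q(2) by auto
  ultimately show ?case by blast
qed

text \<open>
  Averaging over the permutations that fix the label \<open>1\<close> leaves only the position of that label.
\<close>

abbreviation shape :: "nat mtree \<Rightarrow> bool mtree" where
  "shape \<equiv> map_mtree (\<lambda>a. a = 1)"

lemma same_shape_permutes:
  assumes "marked_tree n \<tau>" "marked_tree n \<sigma>" "shape \<sigma> = shape \<tau>"
  obtains \<pi> where "\<pi> permutes {2..n}" "\<sigma> = map_mtree \<pi> \<tau>"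
proof -
  have \<tau>: "separated \<tau>" "leaves \<tau> = {1..n}" "leaves \<sigma> = {1..n}" using assms by (auto simp: marked_tree_def)
  obtain p where p: "\<sigma> = map_mtree p \<tau>" "\<forall>a\<in>{1..n}. (p a = 1) = (a = 1)"
    using same_shape_relabel[OF \<tau>(1) assms(3)] \<tau>(2) by auto
  have img: "p ` {1..n} = {1..n}" using \<tau>(2,3) p(1) by simp
  have inj: "inj_on p {1..n}" by (rule eq_card_imp_inj_on) (simp_all only: img finite_atLeastAtMost)
  define \<pi> where "\<pi> = (\<lambda>a. if a \<in> {1..n} then p a else a)"
  have "bij_betw \<pi> {1..n} {1..n}"
    using img inj inj_on_cong[of "{1..n}" \<pi> p] image_cong[of "{1..n}" "{1..n}" \<pi> p]
    by (simp add: bij_betw_def \<pi>_def)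
  then have "\<pi> permutes {1..n}" by (rule bij_imp_permutes) (auto simp: \<pi>_def)
  moreover have "\<pi> x = x" if "x \<in> {1..n} - {2..n}" for x
  proof -
    have "x = 1" "1 \<in> {1..n}" using that by auto
    then show ?thesis using p(2) by (simp add: \<pi>_def)
  qed
  ultimately have "\<pi> permutes {2..n}" by (rule permutes_superset) 
  moreover have "\<sigma> = map_mtree \<pi> \<tau>" unfolding p(1) by (rule mtree.map_cong) (simp_all add: \<tau>(2) \<pi>_def)
  ultimately show ?thesis by (rule that)
qed

lemma marked_tree_permute:
  assumes "marked_tree n \<tau>" "\<pi> permutes {2..n}"
  shows "marked_tree n (map_mtree \<pi> \<tau>)" "shape (map_mtree \<pi> \<tau>) = shape \<tau>"
proof -
  have p: "\<pi> permutes {1..n}" using assms(2) by (rule permutes_subset) auto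
  have "inj \<pi>" using assms(2) by (rule permutes_inj)
  then have "separated (map_mtree \<pi> \<tau>)"
    using assms(1) separated_map[of \<pi> \<tau>] by (auto simp: marked_tree_def intro: inj_on_subset)
  then show "marked_tree n (map_mtree \<pi> \<tau>)"
    using assms(1) permutes_image[OF p] by (auto simp: marked_tree_def)
  have one: "\<pi> 1 = 1" using assms(2) by (rule permutes_not_in) simp
  then have "\<pi> a = 1 \<longleftrightarrow> a = 1" for a using \<open>inj \<pi>\<close> by (metis injD)
  then show "shape (map_mtree \<pi> \<tau>) = shape \<tau>"
    by (simp add: mtree.map_comp o_def)
qed

text \<open>The sum is not divided by the number of permutations; the factor reappears as
  \<open>fact (n - 1)\<close> in front of the cocycle.\<close>

definition average :: "nat \<Rightarrow> (nat mtree \<Rightarrow> complex) \<Rightarrow> nat mtree \<Rightarrow> complex" where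
  "average n f \<tau> = (\<Sum>\<pi> | \<pi> permutes {2..n}. f (map_mtree \<pi> \<tau>))"

lemma average_permute:
  assumes "\<pi> permutes {2..n}"
  shows "average n f (map_mtree \<pi> \<tau>) = average n f \<tau>"
  unfolding average_def
  using sum_permutations_compose_right[OF assms, of "\<lambda>p. f (map_mtree p \<tau>)"]
  by (simp add: mtree.map_comp)

lemma average_shape:
  assumes "marked_tree n \<tau>" "marked_tree n \<sigma>" "shape \<sigma> = shape \<tau>"
  shows "average n f \<sigma> = average n f \<tau>"
  using same_shape_permutes[OF assms] average_permute by metis

section \<open>Averages as functions on shapes\<close>

primrec leaf_count :: "bool \<Rightarrow> bool mtree \<Rightarrow> nat" where
  "leaf_count b (Leaf a) = (if a = b then 1 else 0)"
| "leaf_count b (Node r s t) = leaf_count b s + leaf_count b t"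

lemma leaf_count_map: "separated \<tau> \<Longrightarrow> leaf_count b (map_mtree f \<tau>) = card {a \<in> leaves \<tau>. f a = b}"
proof (induction \<tau>)
  case (Leaf a)
  have "{x. x = a \<and> f x = b} = (if f a = b then {a} else {})" by auto
  then show ?case by simp
next
  case (Node r s t)
  have "{a \<in> leaves s \<union> leaves t. f a = b} = {a \<in> leaves s. f a = b} \<union> {a \<in> leaves t. f a = b}" by blast
  moreover have "{a \<in> leaves s. f a = b} \<inter> {a \<in> leaves t. f a = b} = {}" using Node.prems by auto
  ultimately show ?case using Node by (simp add: card_Un_disjoint)
qed

lemma leaf_count_relations:
  assumes "L \<in> set (tree_relations \<tau>)" "(k, e, \<sigma>) \<in> set L"
  shows "leaf_count b \<sigma> = leaf_count b \<tau>"
  using assms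
proof (induction \<tau> arbitrary: L \<sigma>)
  case (Node r s t)
  from Node.prems(1) show ?case
    by (cases rule: tree_relations_cases) (use Node in auto)
qed simp

text \<open>Every shape with at most one marked leaf comes from a labelled tree, so that facts about
  labelled trees transfer to shapes. The induction distributes the labels \<open>A\<close> over the
  two subtrees.\<close>

lemma labelling_exists:
  assumes "finite A" "card A = leaf_count False s" "1 \<notin> A" "leaf_count True s \<le> 1"
  shows "\<exists>\<tau>. separated \<tau> \<and> shape \<tau> = s \<and> leaves \<tau> = A \<union> (if leaf_count True s = 1 then {1} else {})"
  using assms
proof (induction s arbitrary: A)
  case (Leaf b)
  show ?case
  proof (cases b)
    case True
    then show ?thesis using Leaf by (intro exI[of _ "Leaf 1"]) simp
  next
    case False
    then obtain a where "A = {a}" using Leaf.prems(2) by (auto simp: card_1_singleton_iff)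
    then show ?thesis using False Leaf.prems(3) by (intro exI[of _ "Leaf a"]) auto
  qed
next
  case (Node r s t)
  have "leaf_count False s \<le> card A" using Node.prems(2) by simp
  then obtain B where B: "B \<subseteq> A" "card B = leaf_count False s" by (metis obtain_subset_with_card_n)
  have fB: "finite B" using B(1) Node.prems(1) finite_subset by blast
  have C: "card (A - B) = leaf_count False t" using Node.prems(1,2) B fB by (simp add: card_Diff_subset)
  have "1 \<notin> B" "1 \<notin> A - B" using Node.prems(3) B(1) by auto
  obtain u where u: "separated u" "shape u = s" "leaves u = B \<union> (if leaf_count True s = 1 then {1} else {})"
    using Node.IH(1)[OF fB B(2) \<open>1 \<notin> B\<close>] Node.prems(4) by auto
  obtain v where v: "separated v" "shape v = t" "leaves v = (A - B) \<union> (if leaf_count True t = 1 then {1} else {})"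
    using Node.IH(2)[OF _ C \<open>1 \<notin> A - B\<close>] Node.prems(1,4) by auto
  have "leaves u \<inter> leaves v = {}" unfolding u(3) v(3) using \<open>1 \<notin> B\<close> \<open>1 \<notin> A - B\<close> Node.prems(4) by auto
  moreover have "leaves u \<union> leaves v = A \<union> (if leaf_count True (Node r s t) = 1 then {1} else {})"
    unfolding u(3) v(3) using B(1) Node.prems(4) by auto
  ultimately show ?case using u(1,2) v(1,2) by (intro exI[of _ "Node r u v"]) simp
qed

definition shape_of_marked :: "nat \<Rightarrow> nat \<Rightarrow> bool mtree \<Rightarrow> bool" where
  "shape_of_marked n c s \<longleftrightarrow>
     real_root s \<and> leaf_count True s = 1 \<and> leaf_count False s + 1 = n \<and> contracted s = c"

lemma real_root_map [simp]: "real_root (map_mtree f \<tau>) = real_root \<tau>"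
  by (cases \<tau>) auto

lemma shape_of_marked_shape:
  assumes "marked_tree n \<tau>" "0 < n"
  shows "shape_of_marked n (contracted \<tau>) (shape \<tau>)"
proof -
  have \<tau>: "separated \<tau>" "leaves \<tau> = {1..n}" "real_root \<tau>" using assms by (auto simp: marked_tree_def)
  have "{a \<in> {1..n}. (a = 1) = True} = {1}" "{a \<in> {1..n}. (a = 1) = False} = {2..n}" using assms(2) by auto
  then show ?thesis
    using \<tau> assms(2) by (simp add: shape_of_marked_def leaf_count_map)
qed

lemma marked_of_shape:
  assumes "shape_of_marked n c s"
  obtains \<tau> where "marked_tree n \<tau>" "contracted \<tau> = c" "shape \<tau> = s"
proof -
  have s: "real_root s" "leaf_count True s = 1" "leaf_count False s + 1 = n" "contracted s = c"
    using assms by (simp_all add: shape_of_marked_def)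
  have "finite {2..n}" "card {2..n} = leaf_count False s" "1 \<notin> {2..n}" using s(3) by auto
  then obtain \<tau> where \<tau>: "separated \<tau>" "shape \<tau> = s" "leaves \<tau> = {2..n} \<union> {1}"
    using labelling_exists[of "{2..n}" s] s(2) by auto
  have "{2..n} \<union> {1} = {1..n}" using s(3) by auto
  moreover have "real_root \<tau>" "contracted \<tau> = c" using s(1,4) \<tau>(2) real_root_map contracted_map by metis+
  moreover from this have "\<exists>u v. \<tau> = Node True u v" by (cases \<tau>) auto
  ultimately have "marked_tree n \<tau>" using \<tau>(1,3) by (simp only: marked_tree_def)
  then show ?thesis using that \<tau>(2) \<open>contracted \<tau> = c\<close> by blast
qed

text \<open>The value zero at all other shapes lets the relations hold without any condition on the
  tree: a relation never leaves the class \<open>shape_of_marked\<close>.\<close>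

definition shape_average :: "nat \<Rightarrow> nat \<Rightarrow> (nat mtree \<Rightarrow> complex) \<Rightarrow> bool mtree \<Rightarrow> complex" where
  "shape_average n c f s = (if shape_of_marked n c s
     then average n f (SOME \<tau>. marked_tree n \<tau> \<and> shape \<tau> = s) else 0)"

lemma shape_average_eq:
  assumes "marked_tree n \<tau>" "contracted \<tau> = c" "0 < n"
  shows "shape_average n c f (shape \<tau>) = average n f \<tau>"
proof -
  let ?\<sigma> = "SOME \<sigma>. marked_tree n \<sigma> \<and> shape \<sigma> = shape \<tau>"
  have "marked_tree n ?\<sigma> \<and> shape ?\<sigma> = shape \<tau>" by (rule someI[of _ \<tau>]) (use assms in simp)
  then have "average n f ?\<sigma> = average n f \<tau>" using average_shape[OF assms(1), of ?\<sigma> f] by simp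
  then show ?thesis
    using shape_of_marked_shape[OF assms(1,3)] assms(2) by (simp add: shape_average_def)
qed

lemma sum_list_sum_swap: "(\<Sum>x\<leftarrow>L. \<Sum>p\<in>S. g x p) = (\<Sum>p\<in>S. \<Sum>x\<leftarrow>L. g x p)"
  by (induction L) (simp_all add: sum.distrib)

text \<open>\<open>tree_relations\<close> commutes with relabelling, so a relation between shapes
  lifts to labelled trees, holds after every permutation of the labels, and can be summed over the
  permutations.\<close>

lemma shape_average_relations:
  assumes rel: "\<And>\<tau> L. marked_tree n \<tau> \<Longrightarrow> contracted \<tau> = c \<Longrightarrow> L \<in> set (tree_relations \<tau>)
      \<Longrightarrow> (\<Sum>(k, e, \<sigma>)\<leftarrow>L. \<delta> ^ k * of_int e * f \<sigma>) = 0"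
    and L: "L \<in> set (tree_relations s)" and n: "0 < n"
  shows "(\<Sum>(k, e, \<sigma>)\<leftarrow>L. \<delta> ^ k * of_int e * shape_average n c f \<sigma>) = 0"
proof (cases "shape_of_marked n c s")
  case False
  have zero: "shape_average n c f \<sigma> = 0" if \<sigma>: "(k, e, \<sigma>) \<in> set L" for k e \<sigma>
  proof -
    have "\<not> shape_of_marked n c \<sigma>"
      using False tree_relations_shape(4,6)[OF L \<sigma>] leaf_count_relations[OF L \<sigma>]
      by (simp only: shape_of_marked_def) simp
    then show ?thesis by (simp add: shape_average_def)
  qed
  have "(\<Sum>(k, e, \<sigma>)\<leftarrow>L. \<delta> ^ k * of_int e * shape_average n c f \<sigma>) = (\<Sum>x\<leftarrow>L. 0)"
    by (rule arg_cong[of _ _ sum_list], rule map_cong) (use zero in auto)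
  then show ?thesis by simp
next
  case True
  obtain \<tau> where \<tau>: "marked_tree n \<tau>" "contracted \<tau> = c" "shape \<tau> = s" using marked_of_shape[OF True] .
  then obtain L' where L': "L' \<in> set (tree_relations \<tau>)" "L = map (apsnd (apsnd shape)) L'"
    using L tree_relations_map[of "\<lambda>a. a = 1" \<tau>] by auto
  have eq: "shape_average n c f (shape \<sigma>) = average n f \<sigma>" if "(k, e, \<sigma>) \<in> set L'" for k e \<sigma>
    using shape_average_eq[OF tree_relations_marked[OF L'(1) that \<tau>(1)] _ n]
      tree_relations_shape(6)[OF L'(1) that] \<tau>(2) by simp
  have "(\<Sum>(k, e, \<sigma>)\<leftarrow>L. \<delta> ^ k * of_int e * shape_average n c f \<sigma>)
      = (\<Sum>(k, e, \<sigma>)\<leftarrow>L'. \<delta> ^ k * of_int e * average n f \<sigma>)"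
    unfolding L'(2) using eq by (auto intro!: arg_cong[of _ _ sum_list])
  also have "\<dots> = (\<Sum>x\<leftarrow>L'. \<Sum>\<pi> | \<pi> permutes {2..n}. \<delta> ^ fst x * of_int (fst (snd x)) * f (map_mtree \<pi> (snd (snd x))))"
    by (auto intro!: arg_cong[of _ _ sum_list] simp: average_def sum_distrib_left)
  also have "\<dots> = (\<Sum>\<pi> | \<pi> permutes {2..n}. \<Sum>x\<leftarrow>L'. \<delta> ^ fst x * of_int (fst (snd x)) * f (map_mtree \<pi> (snd (snd x))))"
    by (rule sum_list_sum_swap)
  also have "\<dots> = 0"
  proof (intro sum.neutral ballI)
    fix \<pi> assume "\<pi> \<in> {\<pi>. \<pi> permutes {2..n}}"
    then have "marked_tree n (map_mtree \<pi> \<tau>)" using marked_tree_permute(1)[OF \<tau>(1)] by simp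
    moreover have "map (apsnd (apsnd (map_mtree \<pi>))) L' \<in> set (tree_relations (map_mtree \<pi> \<tau>))"
      using L'(1) by (simp add: tree_relations_map)
    ultimately have "(\<Sum>(k, e, \<sigma>)\<leftarrow>map (apsnd (apsnd (map_mtree \<pi>))) L'. \<delta> ^ k * of_int e * f \<sigma>) = 0"
      using \<tau>(2) by (intro rel) simp_all
    then show "(\<Sum>x\<leftarrow>L'. \<delta> ^ fst x * of_int (fst (snd x)) * f (map_mtree \<pi> (snd (snd x)))) = 0"
      by (simp add: o_def case_prod_unfold)
  qed
  finally show ?thesis .
qed

section \<open>Consequences of the relations with repeated arguments\<close>

context
  fixes G :: "bool mtree \<Rightarrow> complex" and \<delta> :: complex
  assumes G: "\<And>s L. L \<in> set (tree_relations s) \<Longrightarrow> (\<Sum>(k, e, \<sigma>)\<leftarrow>L. \<delta> ^ k * of_int e * G \<sigma>) = 0"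
begin

text \<open>These are the assumptions on \<open>G\<close> for the functions
  \<open>\<lambda>\<sigma>. G (Node r t \<sigma>)\<close> and
  \<open>\<lambda>\<sigma>. G (Node r \<sigma> t)\<close>. Identities proved at the root thus become
  available at any position of a tree.\<close>

lemma relations_in_context:
  assumes "L \<in> set (tree_relations s)"
  shows "(\<Sum>(k, e, \<sigma>)\<leftarrow>L. \<delta> ^ k * of_int e * G (Node r t \<sigma>)) = 0"
    "(\<Sum>(k, e, \<sigma>)\<leftarrow>L. \<delta> ^ k * of_int e * G (Node r \<sigma> t)) = 0"
proof -
  have "map (apsnd (apsnd (\<lambda>s'. Node r t s'))) L \<in> set (tree_relations (Node r t s))"
    "map (apsnd (apsnd (\<lambda>s'. Node r s' t))) L \<in> set (tree_relations (Node r s t))"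
    using assms by simp_all
  from G[OF this(1)] G[OF this(2)] show "(\<Sum>(k, e, \<sigma>)\<leftarrow>L. \<delta> ^ k * of_int e * G (Node r t \<sigma>)) = 0"
    "(\<Sum>(k, e, \<sigma>)\<leftarrow>L. \<delta> ^ k * of_int e * G (Node r \<sigma> t)) = 0"
    by (simp_all add: o_def case_prod_unfold)
qed

lemma swap_sign_Leaf [simp]: "swap_sign (Leaf a) t = 1" "swap_sign t (Leaf a) = 1"
  by (simp_all add: swap_sign_def)

lemma left_relation: "G (Node r (Node False u v) t) + of_int (swap_sign v t) * G (Node r (Node False u t) v) = 0"
  using G[of "[(0, 1, Node r (Node False u v) t), (0, swap_sign v t, Node r (Node False u t) v)]" "Node r (Node False u v) t"]
  by simp

lemma right_relation:
  "\<delta> * G (Node r (Node False s u) v) + \<delta> * of_int (swap_sign s u) * G (Node r (Node False u s) v)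
    + G (Node r s (Node False u v)) + of_int (swap_sign s u) * G (Node r u (Node False s v)) = 0"
  using G[of "[(1, 1, Node r (Node False s u) v), (1, swap_sign s u, Node r (Node False u s) v),
     (0, 1, Node r s (Node False u v)), (0, swap_sign s u, Node r u (Node False s v))]" "Node r s (Node False u v)"]
  by (simp add: add.assoc)

lemma left_twice: "G (Node r (Node False u (Leaf a)) (Leaf a)) = 0"
  using left_relation[of r u "Leaf a" "Leaf a"] by simp

text \<open>For equal arguments the second relation reads 2 (\<delta> (xx)t + x(xt)) = 0, and (xx)t
  = -(xt)x by the first one.\<close>

lemma right_twice: "G (Node r (Leaf a) (Node False (Leaf a) t)) = \<delta> * G (Node r (Node False (Leaf a) t) (Leaf a))"
proof -
  have "2 * (\<delta> * G (Node r (Node False (Leaf a) (Leaf a)) t) + G (Node r (Leaf a) (Node False (Leaf a) t))) = 0"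
    using right_relation[of r "Leaf a" "Leaf a" t] by (simp add: algebra_simps)
  moreover have "G (Node r (Node False (Leaf a) (Leaf a)) t) = - G (Node r (Node False (Leaf a) t) (Leaf a))"
    using left_relation[of r "Leaf a" "Leaf a" t] by (simp add: add_eq_0_iff)
  ultimately show ?thesis by (simp add: add_eq_0_iff2 algebra_simps)
qed

end

text \<open>Inside the product, x(xt) is replaced by \<delta> (xt)x; then ((xt)x)x vanishes because
  the last two factors anticommute.\<close>

lemma vanishing_rll:
  fixes G :: "bool mtree \<Rightarrow> complex"
  assumes G: "\<And>s L. L \<in> set (tree_relations s) \<Longrightarrow> (\<Sum>(k, e, \<sigma>)\<leftarrow>L. \<delta> ^ k * of_int e * G \<sigma>) = 0"
  shows "G (Node r (Node False (Leaf a) (Node False (Leaf a) t)) (Leaf a)) = 0"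
proof -
  have "G (Node r (Node False (Leaf a) (Node False (Leaf a) t)) (Leaf a))
      = \<delta> * G (Node r (Node False (Node False (Leaf a) t) (Leaf a)) (Leaf a))"
    by (rule right_twice[OF relations_in_context(2)[OF G]])
  also have "\<dots> = 0" using left_twice[OF G] by simp
  finally show ?thesis .
qed

text \<open>First (x(xx))t = \<delta> ((xx)x)t = 0, hence (xt)(xx) = 0 by the first relation. In the
  second relation for x, xt, x the terms (x(xt))x, ((xt)x)x and (xt)(xx) all vanish, which leaves
  x((xt)x) = 0.\<close>

lemma vanishing_lrl:
  fixes G :: "bool mtree \<Rightarrow> complex"
  assumes G: "\<And>s L. L \<in> set (tree_relations s) \<Longrightarrow> (\<Sum>(k, e, \<sigma>)\<leftarrow>L. \<delta> ^ k * of_int e * G \<sigma>) = 0"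
  shows "G (Node r (Leaf a) (Node False (Node False (Leaf a) t) (Leaf a))) = 0"
proof -
  let ?x = "Leaf a"
  let ?xx = "Node False ?x ?x" and ?xt = "Node False ?x t"
  have "G (Node r (Node False ?x ?xx) t) = \<delta> * G (Node r (Node False ?xx ?x) t)"
    by (rule right_twice[OF relations_in_context(2)[OF G]])
  also have "G (Node r (Node False ?xx ?x) t) = 0"
    by (rule left_twice[OF relations_in_context(2)[OF G]])
  finally have 1: "G (Node r (Node False ?x ?xx) t) = 0" by simp
  have "G (Node r ?xt ?xx) = 0"
    using left_relation[of \<delta> G r ?x t ?xx, OF G] 1 by (simp add: swap_sign_def)
  then show ?thesis
    using right_relation[of \<delta> G r ?x ?xt ?x, OF G] vanishing_rll[of \<delta> G r a t, OF G] left_twice[of \<delta> G r ?xt a, OF G]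
    by simp
qed

section \<open>An explicit cocycle in arity six\<close>

abbreviation X :: "bool mtree" where "X \<equiv> Leaf False"
abbreviation Y :: "bool mtree" where "Y \<equiv> Leaf True"
abbreviation real_node :: "'a mtree \<Rightarrow> 'a mtree \<Rightarrow> 'a mtree" (infixl \<open>\<bullet>\<close> 70) where "s \<bullet> t \<equiv> Node True s t"
abbreviation contracted_node :: "'a mtree \<Rightarrow> 'a mtree \<Rightarrow> 'a mtree" (infixl \<open>\<star>\<close> 70) where "s \<star> t \<equiv> Node False s t"

text \<open>
  The values of the cocycle are polynomials in \<open>\<delta>\<close>, represented by the lists of their coefficients with
  the constant term first. The table gives the value at the tree with subtrees \<open>s\<close> and \<open>t\<close>.
\<close>

definition root_coeffs :: "bool mtree \<Rightarrow> bool mtree \<Rightarrow> int list" where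
  "root_coeffs s t = (
  if s = X then
    if t = X \<bullet> (X \<bullet> (X \<bullet> (X \<star> Y))) then [0, 1, 1]
    else if t = X \<bullet> (X \<bullet> (X \<star> (X \<bullet> Y))) then [0, 0, 1]
    else if t = X \<bullet> (X \<star> (X \<bullet> (X \<bullet> Y))) then [0, -1]
    else if t = X \<bullet> (X \<bullet> (Y \<bullet> (X \<star> X))) then [0, -1, -1]
    else if t = X \<bullet> (X \<bullet> (Y \<star> (X \<bullet> X))) then [0, 0, -1]
    else if t = X \<bullet> (X \<star> (Y \<bullet> (X \<bullet> X))) then [0, 1]
    else if t = X \<bullet> (X \<bullet> ((X \<star> X) \<bullet> Y)) then [-1, -1]
    else if t = X \<bullet> (X \<bullet> ((X \<bullet> X) \<star> Y)) then [-1, -1, -1]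
    else if t = X \<bullet> (X \<star> ((X \<bullet> X) \<bullet> Y)) then [0, 0, -1]
    else if t = X \<bullet> (X \<bullet> ((X \<star> Y) \<bullet> X)) then [1, 1]
    else if t = X \<bullet> (X \<bullet> ((X \<bullet> Y) \<star> X)) then [1, 1]
    else if t = X \<bullet> (Y \<bullet> (X \<star> (X \<bullet> X))) then [0, 1, 1]
    else if t = X \<bullet> (Y \<star> (X \<bullet> (X \<bullet> X))) then [0, 1, 1]
    else if t = X \<bullet> (Y \<bullet> ((X \<bullet> X) \<star> X)) then [0, 1]
    else if t = X \<bullet> (Y \<star> ((X \<bullet> X) \<bullet> X)) then [0, 1]
    else if t = X \<bullet> ((X \<star> X) \<bullet> (X \<bullet> Y)) then [0, -1]
    else if t = X \<bullet> ((X \<bullet> X) \<bullet> (X \<star> Y)) then [1, -1, 1]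
    else if t = X \<bullet> ((X \<bullet> X) \<star> (X \<bullet> Y)) then [1, 0, 1]
    else if t = X \<bullet> ((X \<star> Y) \<bullet> (X \<bullet> X)) then [-1]
    else if t = X \<bullet> ((X \<bullet> Y) \<bullet> (X \<star> X)) then [-1, -1, -1]
    else if t = X \<bullet> ((X \<bullet> Y) \<star> (X \<bullet> X)) then [0, -1, -1]
    else if t = X \<bullet> ((X \<star> (X \<bullet> X)) \<bullet> Y) then [1]
    else if t = X \<bullet> ((X \<bullet> (X \<bullet> X)) \<star> Y) then [1]
    else if t = X \<bullet> ((X \<star> (X \<bullet> Y)) \<bullet> X) then [0, 1]
    else if t = X \<bullet> ((X \<bullet> (X \<bullet> Y)) \<star> X) then [0, 1]
    else if t = X \<bullet> (((X \<bullet> X) \<star> X) \<bullet> Y) then [1]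
    else if t = X \<bullet> (((X \<bullet> X) \<bullet> X) \<star> Y) then [1]
    else if t = X \<bullet> (((X \<bullet> X) \<star> Y) \<bullet> X) then [-1]
    else if t = X \<bullet> (((X \<bullet> X) \<bullet> Y) \<star> X) then [-1]
    else if t = Y \<bullet> (X \<bullet> (X \<star> (X \<bullet> X))) then [0, -1, -1]
    else if t = Y \<bullet> (X \<star> (X \<bullet> (X \<bullet> X))) then [0, -1, -1]
    else if t = Y \<bullet> (X \<bullet> ((X \<bullet> X) \<star> X)) then [0, -1]
    else if t = Y \<bullet> (X \<star> ((X \<bullet> X) \<bullet> X)) then [0, -1]
    else if t = Y \<bullet> ((X \<star> X) \<bullet> (X \<bullet> X)) then [1, 1]
    else if t = Y \<bullet> ((X \<bullet> X) \<bullet> (X \<star> X)) then [0, 2, 1]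
    else if t = Y \<bullet> ((X \<bullet> X) \<star> (X \<bullet> X)) then [-1, 1, 1]
    else if t = Y \<bullet> ((X \<star> (X \<bullet> X)) \<bullet> X) then [-1, -1]
    else if t = Y \<bullet> ((X \<bullet> (X \<bullet> X)) \<star> X) then [-1, -1]
    else if t = (X \<star> X) \<bullet> (X \<bullet> (X \<bullet> Y)) then [1]
    else if t = (X \<star> X) \<bullet> (Y \<bullet> (X \<bullet> X)) then [-1]
    else if t = (X \<star> X) \<bullet> ((X \<bullet> X) \<bullet> Y) then [0, 1]
    else if t = (X \<bullet> X) \<bullet> (X \<bullet> (X \<star> Y)) then [0, 0, -2]
    else if t = (X \<bullet> X) \<bullet> (X \<star> (X \<bullet> Y)) then [-1, 1, -2]
    else if t = (X \<bullet> X) \<star> (X \<bullet> (X \<bullet> Y)) then [0, 1]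
    else if t = (X \<bullet> X) \<bullet> (Y \<bullet> (X \<star> X)) then [0, 0, 2]
    else if t = (X \<bullet> X) \<bullet> (Y \<star> (X \<bullet> X)) then [1, -1, 1]
    else if t = (X \<bullet> X) \<star> (Y \<bullet> (X \<bullet> X)) then [0, -1, -1]
    else if t = (X \<bullet> X) \<bullet> ((X \<star> X) \<bullet> Y) then [0, 2]
    else if t = (X \<bullet> X) \<bullet> ((X \<bullet> X) \<star> Y) then [0, 1, 1]
    else if t = (X \<bullet> X) \<star> ((X \<bullet> X) \<bullet> Y) then [0, 0, 1]
    else if t = (X \<bullet> X) \<bullet> ((X \<star> Y) \<bullet> X) then [0, -2]
    else if t = (X \<bullet> X) \<bullet> ((X \<bullet> Y) \<star> X) then [0, -2]
    else if t = (X \<star> (X \<bullet> X)) \<bullet> (X \<bullet> Y) then [0, 1]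
    else if t = (X \<bullet> (X \<bullet> X)) \<bullet> (X \<star> Y) then [-1, 1]
    else if t = (X \<bullet> (X \<bullet> X)) \<star> (X \<bullet> Y) then [-1]
    else if t = (X \<bullet> (X \<bullet> X)) \<bullet> (Y \<star> X) then [1]
    else if t = (X \<bullet> (X \<bullet> X)) \<star> (Y \<bullet> X) then [1]
    else if t = (X \<bullet> (X \<star> Y)) \<bullet> (X \<bullet> X) then [0, 1]
    else if t = (X \<star> (X \<bullet> Y)) \<bullet> (X \<bullet> X) then [0, 1]
    else if t = (X \<star> (X \<bullet> (X \<bullet> Y))) \<bullet> X then [-1]
    else if t = (X \<bullet> (X \<bullet> (X \<bullet> Y))) \<star> X then [-1]
    else if t = (X \<star> (Y \<bullet> (X \<bullet> X))) \<bullet> X then [1]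
    else if t = (X \<bullet> (Y \<bullet> (X \<bullet> X))) \<star> X then [1]
    else if t = (X \<bullet> ((X \<bullet> X) \<star> Y)) \<bullet> X then [0, -1]
    else if t = (X \<star> ((X \<bullet> X) \<bullet> Y)) \<bullet> X then [0, -1]
    else if t = (Y \<bullet> (X \<star> X)) \<bullet> (X \<bullet> X) then [0, -1]
    else if t = (Y \<star> (X \<bullet> X)) \<bullet> (X \<bullet> X) then [0, -2]
    else if t = (Y \<bullet> (X \<bullet> X)) \<bullet> (X \<star> X) then [0, -1]
    else if t = ((X \<star> X) \<bullet> Y) \<bullet> (X \<bullet> X) then [-1]
    else if t = ((X \<bullet> X) \<star> X) \<bullet> (X \<bullet> Y) then [-1]
    else if t = ((X \<bullet> X) \<bullet> X) \<bullet> (X \<star> Y) then [-1]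
    else if t = ((X \<bullet> X) \<bullet> Y) \<bullet> (X \<star> X) then [1, 0, 1]
    else if t = ((X \<bullet> X) \<bullet> Y) \<star> (X \<bullet> X) then [0, 0, 1]
    else if t = ((X \<bullet> X) \<bullet> (X \<star> Y)) \<bullet> X then [0, 1]
    else if t = ((X \<bullet> X) \<star> (X \<bullet> Y)) \<bullet> X then [1]
    else if t = ((X \<bullet> X) \<bullet> (X \<bullet> Y)) \<star> X then [1, -1]
    else if t = ((X \<star> Y) \<bullet> X) \<bullet> (X \<bullet> X) then [1]
    else if t = ((X \<bullet> Y) \<star> X) \<bullet> (X \<bullet> X) then [1]
    else if t = ((X \<bullet> Y) \<star> (X \<bullet> X)) \<bullet> X then [-1]
    else if t = ((X \<bullet> Y) \<bullet> (X \<bullet> X)) \<star> X then [-1]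
    else if t = ((X \<bullet> (X \<bullet> X)) \<star> X) \<bullet> Y then [-1]
    else if t = ((X \<bullet> (X \<bullet> X)) \<bullet> X) \<star> Y then [-1]
    else if t = ((X \<bullet> (X \<bullet> X)) \<star> Y) \<bullet> X then [1]
    else if t = ((X \<bullet> (X \<bullet> X)) \<bullet> Y) \<star> X then [1]
    else []
  else if s = X \<bullet> X then
    if t = X \<bullet> (Y \<star> (X \<bullet> X)) then [0, 0, 1]
    else if t = X \<star> (Y \<bullet> (X \<bullet> X)) then [0, 0, 1]
    else if t = X \<bullet> ((X \<bullet> X) \<star> Y) then [0, 0, -2]
    else if t = X \<star> ((X \<bullet> X) \<bullet> Y) then [0, 0, -2]
    else if t = Y \<bullet> (X \<star> (X \<bullet> X)) then [0, 0, 1]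
    else if t = Y \<star> (X \<bullet> (X \<bullet> X)) then [0, 0, 1]
    else if t = (X \<star> Y) \<bullet> (X \<bullet> X) then [0, -2]
    else if t = (X \<bullet> Y) \<star> (X \<bullet> X) then [0, 2]
    else if t = (X \<star> (X \<bullet> X)) \<bullet> Y then [0, 2]
    else if t = (X \<bullet> (X \<bullet> X)) \<star> Y then [0, 2]
    else []
  else if s = X \<bullet> Y then
    if t = X \<bullet> (X \<star> (X \<bullet> X)) then [0, 0, -1]
    else if t = X \<star> (X \<bullet> (X \<bullet> X)) then [0, 0, -1]
    else if t = (X \<star> X) \<bullet> (X \<bullet> X) then [0, 1]
    else if t = (X \<bullet> X) \<bullet> (X \<star> X) then [0, 0, 1]
    else if t = (X \<bullet> X) \<star> (X \<bullet> X) then [0, -1, 1]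
    else if t = (X \<star> (X \<bullet> X)) \<bullet> X then [0, -1]
    else if t = (X \<bullet> (X \<bullet> X)) \<star> X then [0, -1]
    else []
  else if s = X \<star> (X \<bullet> X) then
    if t = X \<bullet> (X \<bullet> Y) then [-1]
    else if t = Y \<bullet> (X \<bullet> X) then [1]
    else if t = (X \<bullet> X) \<bullet> Y then [0, 1]
    else []
  else if s = X \<bullet> (X \<bullet> X) then
    if t = X \<bullet> (X \<star> Y) then [0, 0, 1]
    else if t = X \<star> (X \<bullet> Y) then [1, 0, 1]
    else if t = X \<bullet> (Y \<star> X) then [-1]
    else if t = X \<star> (Y \<bullet> X) then [-1]
    else if t = Y \<bullet> (X \<star> X) then [1, 0, -1]
    else if t = Y \<star> (X \<bullet> X) then [0, 0, -1]
    else if t = (X \<star> X) \<bullet> Y then [0, -1]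
    else if t = (X \<bullet> X) \<star> Y then [0, -2]
    else if t = (X \<star> Y) \<bullet> X then [0, 1]
    else if t = (X \<bullet> Y) \<star> X then [0, 1]
    else []
  else if s = X \<star> (X \<bullet> Y) then
    if t = X \<bullet> (X \<bullet> X) then [0, 1]
    else []
  else if s = X \<bullet> (X \<bullet> Y) then
    if t = X \<star> (X \<bullet> X) then [0, -1]
    else []
  else if s = Y \<star> (X \<bullet> X) then
    if t = X \<bullet> (X \<bullet> X) then [0, -1]
    else []
  else if s = Y \<bullet> (X \<bullet> X) then
    if t = X \<star> (X \<bullet> X) then [0, 1]
    else []
  else if s = X \<bullet> (X \<star> (X \<bullet> X)) then
    if t = X \<bullet> Y then [0, -1]
    else []
  else if s = X \<star> (X \<bullet> (X \<bullet> X)) then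
    if t = X \<bullet> Y then [0, -1]
    else []
  else if s = X \<star> (X \<bullet> (X \<bullet> Y)) then
    if t = X \<bullet> X then [1]
    else []
  else if s = X \<bullet> (X \<bullet> (X \<bullet> Y)) then
    if t = X \<star> X then [1]
    else []
  else if s = X \<star> (Y \<bullet> (X \<bullet> X)) then
    if t = X \<bullet> X then [-1]
    else []
  else if s = X \<bullet> (Y \<bullet> (X \<bullet> X)) then
    if t = X \<star> X then [-1]
    else []
  else if s = X \<bullet> ((X \<bullet> X) \<star> Y) then
    if t = X \<bullet> X then [0, -1]
    else []
  else if s = X \<star> ((X \<bullet> X) \<bullet> Y) then
    if t = X \<bullet> X then [0, -1]
    else []
  else if s = Y \<bullet> (X \<star> (X \<bullet> X)) then
    if t = X \<bullet> X then [0, 1]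
    else []
  else if s = Y \<star> (X \<bullet> (X \<bullet> X)) then
    if t = X \<bullet> X then [0, 1]
    else []
  else if s = (X \<star> X) \<bullet> (X \<bullet> X) then
    if t = X \<bullet> Y then [1]
    else []
  else if s = (X \<bullet> X) \<bullet> (X \<star> X) then
    if t = X \<bullet> Y then [0, 1]
    else []
  else if s = (X \<bullet> X) \<star> (X \<bullet> X) then
    if t = X \<bullet> Y then [-1, 1]
    else []
  else if s = (X \<bullet> X) \<star> (X \<bullet> Y) then
    if t = X \<bullet> X then [-1, 1]
    else []
  else if s = (X \<bullet> X) \<bullet> (X \<bullet> Y) then
    if t = X \<star> X then [-1, 1]
    else []
  else if s = (X \<star> Y) \<bullet> (X \<bullet> X) then
    if t = X \<bullet> X then [-1]
    else []
  else if s = (X \<bullet> Y) \<star> (X \<bullet> X) then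
    if t = X \<bullet> X then [2]
    else []
  else if s = (X \<bullet> Y) \<bullet> (X \<bullet> X) then
    if t = X \<star> X then [1]
    else []
  else if s = (X \<star> (X \<bullet> X)) \<bullet> X then
    if t = X \<bullet> Y then [-1]
    else []
  else if s = (X \<star> (X \<bullet> X)) \<bullet> Y then
    if t = X \<bullet> X then [1]
    else []
  else if s = (X \<bullet> (X \<bullet> X)) \<bullet> X then
    if t = X \<star> Y then [1]
    else []
  else if s = (X \<bullet> (X \<bullet> X)) \<bullet> Y then
    if t = X \<star> X then [-1]
    else []
  else [])"

primrec cocycle_coeffs :: "bool mtree \<Rightarrow> int list" where
  "cocycle_coeffs (Leaf a) = []"
| "cocycle_coeffs (Node r s t) = (if r then root_coeffs s t else [])"

fun add_coeffs :: "int list \<Rightarrow> int list \<Rightarrow> int list" where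
  "add_coeffs [] ys = ys"
| "add_coeffs xs [] = xs"
| "add_coeffs (x # xs) (y # ys) = (x + y) # add_coeffs xs ys"

text \<open>Prefixing \<open>k\<close> zeros multiplies a polynomial by \<delta> ^ k, as the
  constant term comes first.\<close>

definition relation_coeffs :: "(nat \<times> int \<times> bool mtree) list \<Rightarrow> int list" where
  "relation_coeffs L = foldr (\<lambda>(k, e, \<sigma>). add_coeffs (replicate k 0 @ map ((*) e) (cocycle_coeffs \<sigma>))) L []"

primrec alternating_coeffs :: "bool mtree list \<Rightarrow> int list" where
  "alternating_coeffs [] = []"
| "alternating_coeffs (s # ss) = add_coeffs (cocycle_coeffs s) (map uminus (alternating_coeffs ss))"

definition nodes :: "bool \<Rightarrow> 'a mtree list \<Rightarrow> 'a mtree list \<Rightarrow> 'a mtree list" where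
  "nodes r ss ts = concat (map (\<lambda>s. map (Node r s) ts) ss)"

text \<open>
  The four lists contain the trees without \<open>Y\<close> and without contracted nodes, without \<open>Y\<close> and with
  one contracted node, with one \<open>Y\<close> and without contracted nodes, and with one \<open>Y\<close> and one
  contracted node. The entry \<open>i\<close> of \<open>levels m\<close> is about trees with \<open>i + 1\<close> leaves.
\<close>

type_synonym tree_lists = "bool mtree list \<times> bool mtree list \<times> bool mtree list \<times> bool mtree list"

fun combine :: "tree_lists \<Rightarrow> tree_lists \<Rightarrow> tree_lists \<Rightarrow> tree_lists" where
  "combine (a, b, c, d) (a', b', c', d') (x, y, z, w) =
    (nodes True a a' @ x,
     nodes True a b' @ nodes True b a' @ nodes False a a' @ y,
     nodes True a c' @ nodes True c a' @ z,
     nodes True a d' @ nodes True b c' @ nodes True c b' @ nodes True d a' @ nodes False a c' @ nodes False c a' @ w)"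

text \<open>Zipping with the reversed list pairs the entries \<open>i\<close> and
  \<open>m - i\<close>, that is, all splittings of \<open>m + 2\<close> leaves into two
  subtrees.\<close>

definition next_level :: "tree_lists list \<Rightarrow> tree_lists" where
  "next_level L = foldr (\<lambda>(p, q). combine p q) (zip L (rev L)) ([], [], [], [])"

primrec levels :: "nat \<Rightarrow> tree_lists list" where
  "levels 0 = [([X], [], [Y], [])]"
| "levels (Suc n) = (let L = levels n in L @ [next_level L])"

definition cocycle_on :: "tree_lists \<Rightarrow> bool" where
  "cocycle_on = (\<lambda>(a, b, c, d).
     list_all (\<lambda>s. list_all (\<lambda>k. k = 0) (alternating_coeffs (inner_contractions s))) c)"

text \<open>The lists also contain trees with a contracted root. These are needed as subtrees of
  larger ones, but they are not shapes of marked trees, hence the condition.\<close>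

definition relations_on :: "tree_lists \<Rightarrow> bool" where
  "relations_on = (\<lambda>(a, b, c, d). list_all (\<lambda>s. real_root s \<longrightarrow>
     list_all (\<lambda>L. list_all (\<lambda>k. k = 0) (relation_coeffs L)) (tree_relations s)) d)"

text \<open>\<open>levels 4\<close> holds the trees with one to five leaves, so the next level has
  six. The test is a computation with integer lists: a list of zeros means that the polynomial
  vanishes identically, hence at every complex \<delta>.\<close>

lemma cocycle_on_six_leaves: "cocycle_on (next_level (levels 4))"
  by code_simp

lemma relations_on_six_leaves: "relations_on (next_level (levels 4))"
  by code_simp

section \<open>Completeness of the enumeration\<close>

lemma Node_in_nodes [simp]: "Node r s t \<in> set (nodes q ss ts) \<longleftrightarrow> r = q \<and> s \<in> set ss \<and> t \<in> set ts"
  by (auto simp: nodes_def)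

definition covers :: "tree_lists \<Rightarrow> bool mtree \<Rightarrow> bool" where
  "covers = (\<lambda>(a, b, c, d) s.
     (leaf_count True s = 0 \<longrightarrow> contracted s = 0 \<longrightarrow> s \<in> set a) \<and>
     (leaf_count True s = 0 \<longrightarrow> contracted s = 1 \<longrightarrow> s \<in> set b) \<and>
     (leaf_count True s = 1 \<longrightarrow> contracted s = 0 \<longrightarrow> s \<in> set c) \<and>
     (leaf_count True s = 1 \<longrightarrow> contracted s = 1 \<longrightarrow> s \<in> set d))"

lemma covers_combine:
  assumes "covers p s" "covers q t"
  shows "covers (combine p q T) (Node r s t)"
  using assms by (cases p; cases q; cases T) (auto simp: covers_def add_is_1)

lemma covers_combine_mono: "covers T s \<Longrightarrow> covers (combine p q T) s"
  by (cases p; cases q; cases T) (auto simp: covers_def)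

lemma covers_foldr:
  "(p, q) \<in> set ps \<Longrightarrow> covers p s \<Longrightarrow> covers q t \<Longrightarrow>
    covers (foldr (\<lambda>(p, q). combine p q) ps T) (Node r s t)"
  by (induction ps) (auto intro: covers_combine covers_combine_mono)

abbreviation leaf_number :: "bool mtree \<Rightarrow> nat" where
  "leaf_number s \<equiv> leaf_count False s + leaf_count True s"

lemma leaf_number_pos: "0 < leaf_number s"
  by (induction s) auto

lemma length_levels [simp]: "length (levels m) = Suc m"
  by (induction m) (simp_all add: Let_def)

lemma covers_next_level:
  assumes levels: "\<And>s i. i \<le> m \<Longrightarrow> leaf_number s = Suc i \<Longrightarrow> covers (levels m ! i) s"
    and u: "leaf_number u = m + 2"
  shows "covers (next_level (levels m)) u"
proof (cases u)
  case (Leaf a)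
  then show ?thesis using u by (auto split: if_splits)
next
  case (Node r s t)
  define i where "i = leaf_number s - 1"
  have i: "i \<le> m" "leaf_number s = Suc i" "leaf_number t = Suc (m - i)"
    using u Node leaf_number_pos[of s] leaf_number_pos[of t] by (auto simp: i_def)
  have "(levels m ! i, levels m ! (m - i)) \<in> set (zip (levels m) (rev (levels m)))"
    using i(1) by (auto simp: set_zip rev_nth intro!: exI[of _ i])
  moreover have "covers (levels m ! i) s" "covers (levels m ! (m - i)) t" using levels i by simp_all
  ultimately show ?thesis unfolding Node next_level_def by (rule covers_foldr)
qed

lemma covers_levels: "i \<le> m \<Longrightarrow> leaf_number s = Suc i \<Longrightarrow> covers (levels m ! i) s"
proof (induction m arbitrary: i s)
  case 0
  then show ?case
  proof (cases s)
    case (Leaf a)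
    then show ?thesis using 0 by (cases a) (simp_all add: covers_def)
  next
    case (Node r u v)
    then show ?thesis using 0 leaf_number_pos[of u] leaf_number_pos[of v] by simp
  qed
next
  case (Suc m)
  show ?case
  proof (cases "i \<le> m")
    case True
    then show ?thesis using Suc by (simp add: Let_def nth_append)
  next
    case False
    then have "covers (next_level (levels m)) s" using Suc by (intro covers_next_level) simp_all
    then show ?thesis using False Suc.prems(1) by (simp add: Let_def nth_append le_Suc_eq)
  qed
qed

lemma covers_six_leaves: "leaf_number s = 6 \<Longrightarrow> covers (next_level (levels 4)) s"
  by (rule covers_next_level) (simp_all add: covers_levels)

section \<open>From coefficient lists to complex values\<close>

primrec coeffs_value :: "complex \<Rightarrow> int list \<Rightarrow> complex" where
  "coeffs_value \<delta> [] = 0"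
| "coeffs_value \<delta> (k # ks) = of_int k + \<delta> * coeffs_value \<delta> ks"

lemma coeffs_value_add [simp]: "coeffs_value \<delta> (add_coeffs xs ys) = coeffs_value \<delta> xs + coeffs_value \<delta> ys"
  by (induction xs ys rule: add_coeffs.induct) (simp_all add: algebra_simps)

lemma coeffs_value_uminus [simp]: "coeffs_value \<delta> (map uminus ks) = - coeffs_value \<delta> ks"
  by (induction ks) simp_all

lemma coeffs_value_scale [simp]: "coeffs_value \<delta> (map ((*) e) ks) = of_int e * coeffs_value \<delta> ks"
  by (induction ks) (simp_all add: algebra_simps)

lemma coeffs_value_shift [simp]: "coeffs_value \<delta> (replicate k 0 @ ks) = \<delta> ^ k * coeffs_value \<delta> ks"
  by (induction k) simp_all

lemma coeffs_value_zero: "list_all (\<lambda>k. k = 0) ks \<Longrightarrow> coeffs_value \<delta> ks = 0"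
  by (induction ks) simp_all

definition cocycle_value :: "complex \<Rightarrow> bool mtree \<Rightarrow> complex" where
  "cocycle_value \<delta> s = coeffs_value \<delta> (cocycle_coeffs s)"

lemma relation_coeffs_value:
  "coeffs_value \<delta> (relation_coeffs L) = (\<Sum>(k, e, \<sigma>)\<leftarrow>L. \<delta> ^ k * of_int e * cocycle_value \<delta> \<sigma>)"
  by (induction L) (auto simp: relation_coeffs_def cocycle_value_def)

lemma alternating_coeffs_value:
  "coeffs_value \<delta> (alternating_coeffs ss) = (\<Sum>j<length ss. (-1) ^ j * cocycle_value \<delta> (ss ! j))"
  by (induction ss) (simp_all add: sum.lessThan_Suc_shift cocycle_value_def sum_negf del: sum.lessThan_Suc)

lemma cocycle_value_relations:
  assumes "shape_of_marked 6 1 s" "L \<in> set (tree_relations s)"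
  shows "(\<Sum>(k, e, \<sigma>)\<leftarrow>L. \<delta> ^ k * of_int e * cocycle_value \<delta> \<sigma>) = 0"
proof -
  obtain a b c d where T: "next_level (levels 4) = (a, b, c, d)" by (metis prod_cases4)
  have "s \<in> set d" "real_root s"
    using covers_six_leaves[of s] assms(1) unfolding T by (simp_all add: covers_def shape_of_marked_def)
  then have "list_all (\<lambda>k. k = 0) (relation_coeffs L)"
    using relations_on_six_leaves[unfolded T] assms(2) by (simp add: relations_on_def list_all_iff)
  then show ?thesis unfolding relation_coeffs_value[symmetric] by (rule coeffs_value_zero)
qed

lemma cocycle_value_cocycle:
  assumes "shape_of_marked 6 0 s"
  shows "(\<Sum>j<length (inner_contractions s). (-1) ^ j * cocycle_value \<delta> (inner_contractions s ! j)) = 0"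
proof -
  obtain a b c d where T: "next_level (levels 4) = (a, b, c, d)" by (metis prod_cases4)
  have "s \<in> set c"
    using covers_six_leaves[of s] assms(1) unfolding T by (simp add: covers_def shape_of_marked_def)
  then have "list_all (\<lambda>k. k = 0) (alternating_coeffs (inner_contractions s))"
    using cocycle_on_six_leaves[unfolded T] by (simp add: cocycle_on_def list_all_iff)
  then show ?thesis unfolding alternating_coeffs_value[symmetric] by (rule coeffs_value_zero)
qed

text \<open>The table refers to the planar order of the edges; the factor converts its values to the
  order by \<open>set_encode\<close> used in the complex.\<close>

definition cocycle_form :: "complex \<Rightarrow> nat mtree \<Rightarrow> complex" where
  "cocycle_form \<delta> \<tau> = orientation \<tau> * cocycle_value \<delta> (shape \<tau>)"

lemma orientation_square [simp]: "orientation \<tau> * orientation \<tau> = 1"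
  by (simp add: orientation_def list_sign_square)

text \<open>The orientation of each tree in the relation is \<open>e\<close> times that of \<tau>.
  So the sign \<open>e\<close> in the relation for shapes is absorbed, and
  \<open>orientation \<tau>\<close> becomes a common factor.\<close>

lemma cocycle_form_relations:
  assumes \<tau>: "marked_tree 6 \<tau>" "contracted \<tau> = 1" and L: "L \<in> set (tree_relations \<tau>)"
  shows "(\<Sum>(k, e, \<sigma>)\<leftarrow>L. \<delta> ^ k * cocycle_form \<delta> \<sigma>) = 0"
proof -
  have sep: "separated \<tau>" using \<tau>(1) by (simp add: marked_tree_def)
  have "shape_of_marked 6 1 (shape \<tau>)" using shape_of_marked_shape[OF \<tau>(1)] \<tau>(2) by simp
  moreover have "map (apsnd (apsnd shape)) L \<in> set (tree_relations (shape \<tau>))"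
    using L by (simp add: tree_relations_map)
  ultimately have "(\<Sum>(k, e, \<sigma>)\<leftarrow>map (apsnd (apsnd shape)) L. \<delta> ^ k * of_int e * cocycle_value \<delta> \<sigma>) = 0"
    by (rule cocycle_value_relations)
  then have zero: "(\<Sum>x\<leftarrow>L. \<delta> ^ fst x * of_int (fst (snd x)) * cocycle_value \<delta> (shape (snd (snd x)))) = 0"
    by (simp add: o_def case_prod_unfold)
  have "\<delta> ^ fst x * cocycle_form \<delta> (snd (snd x))
      = orientation \<tau> * (\<delta> ^ fst x * of_int (fst (snd x)) * cocycle_value \<delta> (shape (snd (snd x))))"
    if "x \<in> set L" for x
    using orientation_tree_relations[OF L _ sep, of "fst x" "fst (snd x)" "snd (snd x)"] that
    by (simp add: cocycle_form_def)
  then have "(\<Sum>x\<leftarrow>L. \<delta> ^ fst x * cocycle_form \<delta> (snd (snd x)))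
      = (\<Sum>x\<leftarrow>L. orientation \<tau> * (\<delta> ^ fst x * of_int (fst (snd x)) * cocycle_value \<delta> (shape (snd (snd x)))))"
    by (intro arg_cong[of _ _ sum_list] map_cong) simp_all
  also have "\<dots> = 0" unfolding sum_list_const_mult zero by simp
  finally show ?thesis by (simp add: case_prod_unfold)
qed

lemma cocycle_form_cocycle:
  assumes \<tau>: "marked_tree 6 \<tau>" "contracted \<tau> = 0"
  shows "(\<Sum>j<length (inner_contractions \<tau>). (-1) ^ j *
    (orientation (inner_contractions \<tau> ! j) * cocycle_form \<delta> (inner_contractions \<tau> ! j))) = 0"
proof -
  have "shape_of_marked 6 0 (shape \<tau>)" using shape_of_marked_shape[OF \<tau>(1)] \<tau>(2) by simp
  from cocycle_value_cocycle[OF this, of \<delta>] show ?thesis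
    by (simp add: inner_contractions_map cocycle_form_def flip: mult.assoc)
qed

text \<open>A primitive \<psi> on labelled trees yields a function \<Psi> on shapes. As
  \<open>f\<close> does not see the labelling, summing over the permutations that fix 1 multiplies
  it by (n - 1)!. The trees under \<psi> have \<open>m\<close> vertices and \<open>c + 1\<close>
  contracted edges, and \<open>m + (c + 1)\<close> binary nodes have \<open>m + c + 2\<close>
  leaves.\<close>

lemma cocycle_value_average:
  assumes \<psi>: "cochain (mock_novikov_operad \<delta>) n m \<psi>" 
    and \<phi>: "\<And>\<tau>. marked_tree n \<tau> \<Longrightarrow> contracted \<tau> = c \<Longrightarrow>
       f (shape \<tau>) = orientation \<tau> * cobar_diff (mock_novikov_operad \<delta>) n \<psi> (clades \<tau>) (decor \<delta> \<tau>)"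
    and n: "m + c + 2 = n" "0 < m" and s: "shape_of_marked n c s"
  defines "\<Psi> \<equiv> shape_average n (Suc c) (\<lambda>\<sigma>. orientation \<sigma> * \<psi> (clades \<sigma>) (decor \<delta> \<sigma>))"
  shows "fact (n - 1) * f s = (\<Sum>j<length (inner_contractions s). (-1) ^ j * \<Psi> (inner_contractions s ! j))"
    and "L \<in> set (tree_relations t) \<Longrightarrow> (\<Sum>(k, e, \<sigma>)\<leftarrow>L. \<delta> ^ k * of_int e * \<Psi> \<sigma>) = 0"
proof -
  let ?P = "mock_novikov_operad \<delta>" and ?g = "\<lambda>\<sigma>. orientation \<sigma> * \<psi> (clades \<sigma>) (decor \<delta> \<sigma>)"
  have n0: "0 < n" using n by simp
  obtain \<tau> where \<tau>: "marked_tree n \<tau>" "contracted \<tau> = c" "shape \<tau> = s" using marked_of_shape[OF s] .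
  have len: "length (inner_contractions s) = length (inner_contractions \<tau>)"
    using \<tau>(3) by (auto simp: inner_contractions_map)
  have "fact (n - 1) * f s = (\<Sum>\<pi> | \<pi> permutes {2..n}. f s)"
    using card_permutations[of "{2..n}" "n - 1"] by simp
  also have "\<dots> = (\<Sum>\<pi> | \<pi> permutes {2..n}. \<Sum>j<length (inner_contractions \<tau>).
      (-1) ^ j * ?g (map_mtree \<pi> (inner_contractions \<tau> ! j)))"
  proof (rule sum.cong)
    fix \<pi> assume "\<pi> \<in> {\<pi>. \<pi> permutes {2..n}}"
    then have m: "marked_tree n (map_mtree \<pi> \<tau>)" "shape (map_mtree \<pi> \<tau>) = s"
      using marked_tree_permute[OF \<tau>(1)] \<tau>(3) by simp_all
    then have "f s = orientation (map_mtree \<pi> \<tau>)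
        * cobar_diff ?P n \<psi> (clades (map_mtree \<pi> \<tau>)) (decor \<delta> (map_mtree \<pi> \<tau>))"
      using \<phi>[OF m(1)] \<tau>(2) by simp
    also have "\<dots> = (\<Sum>j<length (inner_contractions \<tau>).
      (-1) ^ j * ?g (map_mtree \<pi> (inner_contractions \<tau> ! j)))"
      unfolding cobar_diff_decor[OF m(1)] by (simp add: inner_contractions_map)
    finally show "f s = (\<Sum>j<length (inner_contractions \<tau>). (-1) ^ j * ?g (map_mtree \<pi> (inner_contractions \<tau> ! j)))" .
  qed simp
  also have "\<dots> = (\<Sum>j<length (inner_contractions \<tau>). (-1) ^ j * average n ?g (inner_contractions \<tau> ! j))"
    unfolding average_def sum_distrib_left by (rule sum.swap)
  also have "\<dots> = (\<Sum>j<length (inner_contractions s). (-1) ^ j * \<Psi> (inner_contractions s ! j))"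
    unfolding len
  proof (rule sum.cong)
    fix j assume "j \<in> {..<length (inner_contractions \<tau>)}"
    then have j: "j < length (inner_contractions \<tau>)" by simp
    have "\<Psi> (shape (inner_contractions \<tau> ! j)) = average n ?g (inner_contractions \<tau> ! j)"
      unfolding \<Psi>_def using inner_contraction_contracted[OF \<tau>(1) j] \<tau>(2) n0
      by (intro shape_average_eq) simp_all
    moreover have "inner_contractions s ! j = shape (inner_contractions \<tau> ! j)"
      using j \<tau>(3) by (auto simp: inner_contractions_map)
    ultimately show "(-1) ^ j * average n ?g (inner_contractions \<tau> ! j) = (-1) ^ j * \<Psi> (inner_contractions s ! j)"
      by simp
  qed simp
  finally show "fact (n - 1) * f s = (\<Sum>j<length (inner_contractions s). (-1) ^ j * \<Psi> (inner_contractions s ! j))" .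
  assume L: "L \<in> set (tree_relations t)"
  show "(\<Sum>(k, e, \<sigma>)\<leftarrow>L. \<delta> ^ k * of_int e * \<Psi> \<sigma>) = 0"
    unfolding \<Psi>_def
  proof (rule shape_average_relations[OF _ L n0])
    fix \<tau> L assume \<tau>: "marked_tree n \<tau>" "contracted \<tau> = Suc c" and L: "L \<in> set (tree_relations \<tau>)"
    have sep: "separated \<tau>" using \<tau>(1) by (simp add: marked_tree_def)
    have "clades \<tau> \<in> trees_with n m"
      using marked_tree_reduced[OF \<tau>(1)] marked_tree_card[OF \<tau>(1)] \<tau>(2) n(1) by (simp add: trees_with_def)
    then have ml: "multilinear_functional ?P (clades \<tau>) (\<psi> (clades \<tau>))" using \<psi> by (simp add: cochain_def)
    have zero: "(\<Sum>x\<leftarrow>L. \<delta> ^ fst x * \<psi> (clades \<tau>) (decor \<delta> (snd (snd x)))) = 0"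
      using functional_tree_relations[OF ml L \<tau>(1)] by (simp add: case_prod_unfold)
    have "\<delta> ^ fst x * of_int (fst (snd x)) * ?g (snd (snd x))
        = orientation \<tau> * (\<delta> ^ fst x * \<psi> (clades \<tau>) (decor \<delta> (snd (snd x))))" if "x \<in> set L" for x
    proof -
      have x: "(fst x, fst (snd x), snd (snd x)) \<in> set L" using that by simp
      have "of_int (fst (snd x)) * of_int (fst (snd x)) = (1 :: complex)" by (rule tree_relations_sign[OF L x])
      then have "orientation \<tau> = of_int (fst (snd x)) * orientation (snd (snd x))"
        unfolding orientation_tree_relations[OF L x sep] by (simp flip: mult.assoc)
      then show ?thesis unfolding tree_relations_shape(3)[OF L x] by (simp only: ac_simps)
    qed
    then have "(\<Sum>x\<leftarrow>L. \<delta> ^ fst x * of_int (fst (snd x)) * ?g (snd (snd x)))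
        = (\<Sum>x\<leftarrow>L. orientation \<tau> * (\<delta> ^ fst x * \<psi> (clades \<tau>) (decor \<delta> (snd (snd x)))))"
      by (intro arg_cong[of _ _ sum_list] map_cong) simp_all
    also have "\<dots> = 0" unfolding sum_list_const_mult zero by simp
    finally show "(\<Sum>(k, e, \<sigma>)\<leftarrow>L. \<delta> ^ k * of_int e * ?g \<sigma>) = 0" by (simp add: case_prod_unfold)
  qed
qed

theorem theorem3p4:
  fixes \<delta> :: complex
  assumes "\<delta> \<noteq> 0"
  shows "\<not> koszul (mock_novikov_operad \<delta>)"
proof
  let ?P = "mock_novikov_operad \<delta>" and ?\<Phi> = "cocycle_value \<delta>"
  assume "koszul ?P"
  \<comment> \<open>In arity six the right end has index 4, so index 3 is the last place at which
    Koszulness demands exactness. Its cochains live on trees with four vertices, that is, with one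
    contracted edge.\<close>
  then have exact: "cobar_exact_at ?P 6 3" by (simp add: koszul_def)
  define \<phi> where "\<phi> = coset_functional 6 (cocycle_form \<delta>)"
  have cochain: "cochain ?P 6 (6 - 2) \<phi>"
    and closed: "H \<in> trees_with 6 (6 - 1) \<Longrightarrow> d \<in> decorations ?P H \<Longrightarrow> cobar_diff ?P 6 \<phi> H d = 0"
    and \<phi>_decor: "marked_tree 6 \<tau> \<Longrightarrow> contracted \<tau> = 1 \<Longrightarrow> \<phi> (clades \<tau>) (decor \<delta> \<tau>) = cocycle_form \<delta> \<tau>" for H d \<tau>
    unfolding \<phi>_def by (rule cocycle_from_trees; (intro cocycle_form_relations cocycle_form_cocycle)?; simp)+
  obtain \<psi> where \<psi>: "cochain ?P 6 3 \<psi>"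
    "\<And>H d. H \<in> trees_with 6 4 \<Longrightarrow> d \<in> decorations ?P H \<Longrightarrow> \<phi> H d = cobar_diff ?P 6 \<psi> H d"
    using exact cochain closed by (auto simp: cobar_exact_at_def)
  have \<Phi>: "?\<Phi> (shape \<tau>) = orientation \<tau> * cobar_diff ?P 6 \<psi> (clades \<tau>) (decor \<delta> \<tau>)"
    if \<tau>: "marked_tree 6 \<tau>" "contracted \<tau> = 1" for \<tau>
  proof -
    have "clades \<tau> \<in> trees_with 6 4"
      using marked_tree_reduced[OF \<tau>(1)] marked_tree_card[OF \<tau>(1)] \<tau>(2) by (simp add: trees_with_def)
    moreover have "decor \<delta> \<tau> \<in> decorations ?P (clades \<tau>)"
      using \<tau>(1) by (intro decor_decorations) (simp add: marked_tree_def)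
    ultimately have "cobar_diff ?P 6 \<psi> (clades \<tau>) (decor \<delta> \<tau>) = cocycle_form \<delta> \<tau>"
      using \<psi>(2) \<phi>_decor[OF \<tau>] by simp
    then show ?thesis by (simp add: cocycle_form_def flip: mult.assoc)
  qed
  define \<Psi> where "\<Psi> = shape_average 6 (Suc 1) (\<lambda>\<sigma>. orientation \<sigma> * \<psi> (clades \<sigma>) (decor \<delta> \<sigma>))"
  have coboundary: "fact (6 - 1) * ?\<Phi> s = (\<Sum>j<length (inner_contractions s). (-1) ^ j * \<Psi> (inner_contractions s ! j))"
    if "shape_of_marked 6 1 s" for s
    unfolding \<Psi>_def by (rule cocycle_value_average(1)[OF \<psi>(1) \<Phi> _ _ that]) simp_all
  \<comment> \<open>Both trees have three internal edges, in planar order those with upper vertex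
    \<open>X \<bullet> Y\<close>, \<open>?t\<close> and \<open>X \<bullet> ?t\<close>. Contracting
    the first turns \<open>?t\<close> into \<open>?u\<close>, contracting the second turns it into
    \<open>?v\<close>, and the signs alternate.\<close>
  let ?t = "(X \<star> (X \<bullet> Y)) \<bullet> X"
  let ?s1 = "X \<bullet> (X \<bullet> ?t)" and ?s2 = "(X \<bullet> ?t) \<bullet> X"
  have shape: "shape_of_marked 6 1 ?s1" "shape_of_marked 6 1 ?s2" by (simp_all add: shape_of_marked_def)
  have rel: "(\<Sum>(k, e, \<sigma>)\<leftarrow>L. \<delta> ^ k * of_int e * \<Psi> \<sigma>) = 0" if "L \<in> set (tree_relations t)" for L t
    unfolding \<Psi>_def by (rule cocycle_value_average(2)[OF \<psi>(1) \<Phi> _ _ shape(1) that]) simp_all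
  have val: "?\<Phi> ?s1 = \<delta>" "?\<Phi> ?s2 = 0" by (simp_all add: cocycle_value_def root_coeffs_def)
  let ?u = "(X \<star> (X \<star> Y)) \<bullet> X" and ?v = "(X \<star> (X \<bullet> Y)) \<star> X"
  have "fact 5 * \<delta> = \<Psi> (X \<bullet> (X \<bullet> ?u)) - \<Psi> (X \<bullet> (X \<bullet> ?v)) + \<Psi> (X \<bullet> (X \<star> ?t))"
    using coboundary[OF shape(1)] val(1) by (simp add: numeral_3_eq_3 del: fact_numeral)
  moreover have "0 = \<Psi> ((X \<bullet> ?u) \<bullet> X) - \<Psi> ((X \<bullet> ?v) \<bullet> X) + \<Psi> ((X \<star> ?t) \<bullet> X)"
    using coboundary[OF shape(2)] val(2) by (simp add: numeral_3_eq_3)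
  \<comment> \<open>This equation dictates the coefficient \<delta> of \<open>?s2\<close> in the
    cycle. All other terms vanish by \<open>vanishing_rll\<close> for \<open>?u\<close> and
    \<open>vanishing_lrl\<close> for \<open>?v\<close>, so what remains is 5! \<delta> = 0.\<close>
  moreover have "\<Psi> (X \<bullet> (X \<star> ?t)) = \<delta> * \<Psi> ((X \<star> ?t) \<bullet> X)" by (rule right_twice[OF rel])
  moreover have "\<Psi> (X \<bullet> (X \<bullet> ?u)) = 0"
    by (rule vanishing_rll[OF relations_in_context(1)[OF relations_in_context(1)[OF rel]]])
  moreover have "\<Psi> ((X \<bullet> ?u) \<bullet> X) = 0"
    by (rule vanishing_rll[OF relations_in_context(1)[OF relations_in_context(2)[OF rel]]])
  moreover have "\<Psi> (X \<bullet> (X \<bullet> ?v)) = 0"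
    by (rule vanishing_lrl[OF relations_in_context(1)[OF rel]])
  moreover have "\<Psi> ((X \<bullet> ?v) \<bullet> X) = 0"
    by (rule vanishing_lrl[OF relations_in_context(2)[OF rel]])
  ultimately show False using assms by (simp add: fact_nonzero)
qed

end
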